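(* Let $n\ge 2$ and let $\mathbb{V}=(V_1,\dots,V_n)$ and $\mathbb{W}=(W_1,\dots,W_n)$ be $n$-tuples of commuting shifts of finite multiplicity on Hilbert spaces $\mathfrak{H}$ and $\mathfrak{K}$, respectively. If $\mathrm{Ann}(\mathbb{V})$ is a prime ideal, then $\mathbb{V}\approx\mathbb{W}$ if and only if $\mathrm{Ann}(\mathbb{V})=\mathrm{Ann}(\mathbb{W})$ and $\kappa(\mathbb{V})=\kappa(\mathbb{W})$.
   Context: All Hilbert spaces are complex and separable; subspaces are closed. An isometry $V$ on a Hilbert space $\mathfrak{H}$ is a shift of multiplicity $k$ ($k$ a positive integer) if it is unitarily equivalent to the unilateral shift on $\ell^2(\mathbb{N})\otimes\mathbb{C}^k$; equivalently $\bigcap_{j\ge0}V^j\mathfrak{H}=\{0\}$ and $\dim\ker V^*=k$. It is a shift of finite multiplicity if this holds for some positive integer $k$ (the $V_i$ in a tuple may have different multiplicities). For an $n$-tuple $\mathbb{V}$ of commuting shifts of finite multiplicity, $\mathrm{Ann}(\mathbb{V})=\{p\in\mathbb{C}[x_1,\dots,x_n]:p(\mathbb{V})=0\}$. Write $\mathbb{V}\lesssim\mathbb{W}$ if there is a subspace $\mathfrak{K}'\subseteq\mathfrak{K}$ of finite codimension, invariant under every $W_i$, such that $\mathbb{W}|\mathfrak{K}'$ is similar to $\mathbb{V}$, i.e. there is a boundedly invertible operator $S:\mathfrak{H}\to\mathfrak{K}'$ with $SV_i=W_iS$ for $i=1,\dots,n$. Write $\mathbb{V}\approx\mathbb{W}$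 ($\mathbb{V}$ and $\mathbb{W}$ are virtually similar) if $\mathbb{V}\lesssim\mathbb{W}$ and $\mathbb{W}\lesssim\mathbb{V}$. The virtual cyclicity $\kappa(\mathbb{V})$ is the least $k$ for which there are $h_1,\dots,h_k\in\mathfrak{H}$ such that the closed linear span of $\{p(\mathbb{V})h_i: p\in\mathbb{C}[x_1,\dots,x_n],\ 1\le i\le k\}$ has finite codimension in $\mathfrak{H}$. *)

theory Defs
  imports
    "HOL-Analysis.Analysis"
    "HOL-Library.Poly_Mapping"
    "HOL-Algebra.Algebraic_Closure_Type"
begin

section \<open>Complex separable Hilbert spaces\<close>

class complex_vector = ab_group_add +
  fixes scaleC :: "complex \<Rightarrow> 'a \<Rightarrow> 'a" (infixr \<open>*\<^sub>C\<close> 75)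
  assumes scaleC_add_right: "a *\<^sub>C (x + y) = a *\<^sub>C x + a *\<^sub>C y"
    and scaleC_add_left: "(a + b) *\<^sub>C x = a *\<^sub>C x + b *\<^sub>C x"
    and scaleC_scaleC: "a *\<^sub>C b *\<^sub>C x = (a * b) *\<^sub>C x"
    and scaleC_one: "1 *\<^sub>C x = x"

global_interpretation complex_vector:
  vector_space "scaleC :: complex \<Rightarrow> 'a \<Rightarrow> 'a :: complex_vector"
  defines csubspace = complex_vector.subspace
    and cspan = complex_vector.span
  by unfold_locales (simp_all add: scaleC_add_right scaleC_add_left scaleC_scaleC scaleC_one)

text \<open>The inner product is linear in its first argument. Positive definiteness
  is a consequence of \<open>cinner_self\<close> and the norm axioms.\<close>

class complex_hilbert_space = complex_vector + banach +
  fixes cinner :: "'a \<Rightarrow> 'a \<Rightarrow> complex"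
  assumes scaleR_scaleC: "r *\<^sub>R x = complex_of_real r *\<^sub>C x"
    and cinner_commute: "cinner x y = cnj (cinner y x)"
    and cinner_add_left: "cinner (x + y) z = cinner x z + cinner y z"
    and cinner_scaleC_left: "cinner (c *\<^sub>C x) y = c * cinner x y"
    and cinner_self: "cinner x x = complex_of_real ((norm x)\<^sup>2)"

class separable_hilbert_space = complex_hilbert_space +
  assumes separable: "\<exists>D. countable D \<and> (\<forall>x. \<forall>e>0. \<exists>d\<in>D. dist d x < e)"

definition bounded_clinear ::
    "('a::complex_hilbert_space \<Rightarrow> 'b::complex_hilbert_space) \<Rightarrow> bool" where
  "bounded_clinear S \<longleftrightarrow>
     Vector_Spaces.linear scaleC scaleC S \<and> (\<exists>B. \<forall>x. norm (S x) \<le> B * norm x)"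

definition closed_csubspace :: "'a::complex_hilbert_space set \<Rightarrow> bool" where
  "closed_csubspace M \<longleftrightarrow> csubspace M \<and> closed M"

text \<open>For a subspace \<open>M\<close>: the quotient by \<open>M\<close> is spanned by finitely many classes.\<close>

definition finite_codim :: "'a::complex_vector set \<Rightarrow> bool" where
  "finite_codim M \<longleftrightarrow> (\<exists>F. finite F \<and> cspan (M \<union> F) = UNIV)"


section \<open>Shifts of finite multiplicity\<close>

text \<open>The Hilbert space \<open>\<ell>\<^sup>2(\<nat>) \<otimes> \<complex>\<^sup>k\<close>, realised as the square-summable sequences
  of vectors in \<open>\<complex>\<^sup>k\<close>: \<open>f j m\<close> is the \<open>m\<close>-th coordinate (\<open>m < k\<close>) of the \<open>j\<close>-th vector.\<close>

definition ell2 :: "nat \<Rightarrow> (nat \<Rightarrow> nat \<Rightarrow> complex) set" where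
  "ell2 k = {f. (\<forall>j m. k \<le> m \<longrightarrow> f j m = 0) \<and> summable (\<lambda>j. \<Sum>m<k. (cmod (f j m))\<^sup>2)}"

definition unilateral_shift :: "(nat \<Rightarrow> nat \<Rightarrow> complex) \<Rightarrow> nat \<Rightarrow> nat \<Rightarrow> complex" where
  "unilateral_shift f j m = (case j of 0 \<Rightarrow> 0 | Suc i \<Rightarrow> f i m)"

definition unitary_ell2 :: "nat \<Rightarrow> ('a::complex_hilbert_space \<Rightarrow> nat \<Rightarrow> nat \<Rightarrow> complex) \<Rightarrow> bool" where
  "unitary_ell2 k U \<longleftrightarrow>
     bij_betw U UNIV (ell2 k) \<and>
     (\<forall>x y j m. U (x + y) j m = U x j m + U y j m) \<and>
     (\<forall>c x j m. U (c *\<^sub>C x) j m = c * U x j m) \<and>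
     (\<forall>x y. (\<lambda>j. \<Sum>m<k. U x j m * cnj (U y j m)) sums cinner x y)"

definition shift_of_multiplicity :: "nat \<Rightarrow> ('a::complex_hilbert_space \<Rightarrow> 'a) \<Rightarrow> bool" where
  "shift_of_multiplicity k V \<longleftrightarrow>
     (\<exists>U. unitary_ell2 k U \<and> (\<forall>x. U (V x) = unilateral_shift (U x)))"

definition finite_multiplicity_shift :: "('a::complex_hilbert_space \<Rightarrow> 'a) \<Rightarrow> bool" where
  "finite_multiplicity_shift V \<longleftrightarrow> (\<exists>k>0. shift_of_multiplicity k V)"

text \<open>A tuple of operators is indexed by a finite type \<open>'n\<close>; its length is \<open>CARD('n)\<close>.\<close>

definition commuting_shifts :: "('n::finite \<Rightarrow> 'a::complex_hilbert_space \<Rightarrow> 'a) \<Rightarrow> bool" where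
  "commuting_shifts V \<longleftrightarrow>
     (\<forall>i. finite_multiplicity_shift (V i)) \<and> (\<forall>i j. V i \<circ> V j = V j \<circ> V i)"


section \<open>Polynomials in commuting operators\<close>

text \<open>Polynomials with complex coefficients in variables indexed by \<open>'n\<close>: finitely supported
  maps from exponent vectors to coefficients, with the convolution product.\<close>

type_synonym 'n cpoly = "('n \<Rightarrow>\<^sub>0 nat) \<Rightarrow>\<^sub>0 complex"

text \<open>The composition of the powers \<open>V i ^^ m i\<close> over all \<open>i\<close>. The fold is well defined
  (independent of the order of the factors) because the \<open>V i\<close> commute; it is used only for
  commuting tuples.\<close>

definition monom_op :: "('n::finite \<Rightarrow> 'a \<Rightarrow> 'a) \<Rightarrow> ('n \<Rightarrow>\<^sub>0 nat) \<Rightarrow> 'a \<Rightarrow> 'a" where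
  "monom_op V m = Finite_Set.fold (\<lambda>i T. (V i ^^ Poly_Mapping.lookup m i) \<circ> T) id UNIV"

definition poly_op :: "'n cpoly \<Rightarrow> ('n::finite \<Rightarrow> 'a::complex_vector \<Rightarrow> 'a) \<Rightarrow> 'a \<Rightarrow> 'a" where
  "poly_op p V h = (\<Sum>m\<in>Poly_Mapping.keys p. Poly_Mapping.lookup p m *\<^sub>C monom_op V m h)"

definition Ann :: "('n::finite \<Rightarrow> 'a::complex_vector \<Rightarrow> 'a) \<Rightarrow> 'n cpoly set" where
  "Ann V = {p. \<forall>h. poly_op p V h = 0}"


section \<open>Virtual similarity and virtual cyclicity\<close>

definition virt_sim_le ::
    "('n \<Rightarrow> 'a::complex_hilbert_space \<Rightarrow> 'a) \<Rightarrow> ('n \<Rightarrow> 'b::complex_hilbert_space \<Rightarrow> 'b) \<Rightarrow> bool" where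
  "virt_sim_le V W \<longleftrightarrow>
     (\<exists>K'. closed_csubspace K' \<and> finite_codim K' \<and> (\<forall>i. W i ` K' \<subseteq> K') \<and>
       (\<exists>S. bounded_clinear S \<and> bij_betw S UNIV K' \<and>
          (\<exists>B. \<forall>y\<in>K'. norm (inv_into UNIV S y) \<le> B * norm y) \<and>
          (\<forall>i. S \<circ> V i = W i \<circ> S)))"

definition virtually_similar ::
    "('n \<Rightarrow> 'a::complex_hilbert_space \<Rightarrow> 'a) \<Rightarrow> ('n \<Rightarrow> 'b::complex_hilbert_space \<Rightarrow> 'b) \<Rightarrow> bool" where
  "virtually_similar V W \<longleftrightarrow> virt_sim_le V W \<and> virt_sim_le W V"

text \<open>The minimum exists for every tuple of commuting shifts of finite multiplicity: a basis of
  the kernel of the adjoint of any single member already generates the whole space.\<close>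

definition virtual_cyclicity ::
    "('n::finite \<Rightarrow> 'a::complex_hilbert_space \<Rightarrow> 'a) \<Rightarrow> nat" where
  "virtual_cyclicity V = (LEAST k. \<exists>h :: nat \<Rightarrow> 'a.
     finite_codim (closure (cspan {poly_op p V (h i) | p i. i < k})))"

end

theory Submission
  imports Defs "Jordan_Normal_Form.Char_Poly" "HOL-Computational_Algebra.Polynomial_FPS"
begin

text \<open>Fix one coordinate \<open>i0\<close> and identify \<open>T = V\<^bsub>i0\<^esub>\<close> with multiplication by \<open>z\<close> on \<open>H\<^sup>2 \<otimes> \<complex>\<^sup>k\<close>.
  Since \<open>V\<^sub>j\<close> is an isometry of finite multiplicity commuting with \<open>T\<close>, there is a polynomial \<open>q\<close>
  without zeros on the unit circle such that \<open>V\<^sub>j\<^sup>-\<^sup>1 q(T)\<close> is multiplication by a polynomial matrix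
  \<open>G\<^sub>j\<close>, and \<open>G\<^sub>j\<close> is \<open>\<bar>q\<bar>\<close> times a unitary matrix on the circle.  If \<open>Ann(V)\<close> is prime, then
  \<open>A = \<complex>[x] / Ann(V)\<close> is a domain, algebraic over \<open>\<complex>[x\<^bsub>i0\<^esub>]\<close>, and the vectors with rational entries form a
  torsion-free \<open>A\<close>-module; its rank is the virtual cyclicity.  Hence for tuples with the same
  annihilator and the same cyclicity there is a polynomial matrix with nonzero determinant that
  intertwines the two families \<open>G\<^sub>j\<close>.  Using unitarity on the circle it can be modified until its
  determinant has no zeros there.  Then it is bounded below with closed range of finite
  codimension, which gives one half of virtual similarity, and the other half by symmetry.\<close>

text \<open>Zeros of the determinant off the unit circle are harmless: a factor \<open>T - z\<close>
  is bounded below by |1 - |z||, and the adjugate puts nonzero polynomial multiples of all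
  \<open>e a\<close> into the range, so only finitely many dimensions are lost. A zero on the circle
  destroys the lower bound, and clearing denominators gives no control over such zeros. Dividing Z
  by its modulus would help, but the modulus is in general not rational. However, on the circle the
  adjoint of Z intertwines in the opposite direction, so Z^* Z commutes with all
  \<open>G' j\<close>, and so does every rational expression in it; this leaves room for a rational
  substitute of the modulus. A second difficulty is the closure in the definition of cyclicity:
  generators are arbitrary vectors, not rational ones. The rank is therefore bounded through
  determinants over C[[z]], which vanish for too few generators and still vanish after
  coefficientwise limits. The two multiplicities are not given to be equal; injective intertwiners
  in both directions force equality, and only then is there a determinant to work with.\<close>

unbundle no vec_syntax
no_notation vec_index (infixl \<open>$\<close> 100)
hide_const (open) up_ring.coeff up_ring.monom module.smult Polynomials.degree Coset.order

section \<open>Intertwining polynomial matrices on the unit circle\<close>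

text \<open>Fraction-free Gaussian elimination: cross-multiplying with a nonzero pivot
  \<open>v j k\<close> replaces division, so the coefficients stay in the domain. Used with complex
  scalars and, for dependence over C(z), with polynomial scalars.\<close>

lemma exists_linear_relation:
  fixes v :: "'i \<Rightarrow> nat \<Rightarrow> 'r::idom"
  assumes "finite I" "k < card I"
  shows "\<exists>c. (\<exists>i\<in>I. c i \<noteq> 0) \<and> (\<forall>a<k. (\<Sum>i\<in>I. c i * v i a) = 0)"
  using assms
proof (induction k arbitrary: I v)
  case 0
  then have "I \<noteq> {}" by auto
  then show ?case by (intro exI[of _ "\<lambda>_. 1"]) auto
next
  case (Suc k)
  show ?case
  proof (cases "\<forall>i\<in>I. v i k = 0")
    case True
    from Suc.IH[OF Suc.prems(1), of v] Suc.prems(2)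
    obtain c where "\<exists>i\<in>I. c i \<noteq> 0" "\<forall>a<k. (\<Sum>i\<in>I. c i * v i a) = 0" by auto
    then show ?thesis using True by (intro exI[of _ c]) (auto simp: less_Suc_eq)
  next
    case False
    then obtain j where j: "j \<in> I" "v j k \<noteq> 0" by auto
    define w where "w i a = v j k * v i a - v i k * v j a" for i a
    have "k < card (I - {j})" using Suc.prems j by simp
    from Suc.IH[OF _ this, of w] Suc.prems
    obtain c where c: "\<exists>i\<in>I-{j}. c i \<noteq> 0" "\<forall>a<k. (\<Sum>i\<in>I-{j}. c i * w i a) = 0" by auto
    \<comment> \<open>The coefficient at the pivot index is the one that makes coordinate
      \<open>k\<close> cancel.\<close>
    define d where "d i = (if i = j then - (\<Sum>i\<in>I-{j}. c i * v i k) else c i * v j k)" for i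
    have "(\<Sum>i\<in>I. d i * v i a) = (\<Sum>i\<in>I-{j}. c i * w i a)" for a
    proof -
      have "(\<Sum>i\<in>I. d i * v i a) = d j * v j a + (\<Sum>i\<in>I-{j}. d i * v i a)"
        using Suc.prems(1) j by (simp add: sum.remove)
      also have "(\<Sum>i\<in>I-{j}. d i * v i a) = (\<Sum>i\<in>I-{j}. c i * v j k * v i a)"
        by (rule sum.cong) (auto simp: d_def)
      also have "d j * v j a = - (\<Sum>i\<in>I-{j}. c i * v i k * v j a)"
        by (simp add: d_def sum_distrib_right)
      finally show ?thesis
        by (simp add: w_def algebra_simps sum_subtractf)
    qed
    moreover have "(\<Sum>i\<in>I-{j}. c i * w i k) = 0" by (rule sum.neutral) (simp add: w_def)
    ultimately have "\<forall>a<Suc k. (\<Sum>i\<in>I. d i * v i a) = 0" using c(2) by (auto simp: less_Suc_eq)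
    moreover have "\<exists>i\<in>I. d i \<noteq> 0" using c(1) j by (auto simp: d_def)
    ultimately show ?thesis by blast
  qed
qed

section \<open>Polynomials on the unit circle and their zeros there\<close>

lemma infinite_unit_circle: "infinite {z::complex. cmod z = 1}"
proof -
  have "inj_on cis {0..pi}"
  proof (rule inj_onI)
    fix s t assume "s \<in> {0..pi}" "t \<in> {0..pi}" "cis s = cis t"
    then show "s = t" by (metis atLeastAtMost_iff cis.sel(1) cos_inj_pi)
  qed
  then have "infinite (cis ` {0..pi})" by (simp add: finite_image_iff infinite_Icc)
  then show ?thesis by (rule infinite_super[rotated]) auto
qed

lemma poly_eqI_unit_circle:
  fixes p q :: "complex poly"
  assumes "\<And>z. cmod z = 1 \<Longrightarrow> poly p z = poly q z"
  shows "p = q"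
proof (rule ccontr)
  assume "p \<noteq> q"
  then have "finite {z. poly (p - q) z = 0}" by (intro poly_roots_finite) simp
  moreover have "{z. cmod z = 1} \<subseteq> {z. poly (p - q) z = 0}" using assms by auto
  ultimately show False using infinite_unit_circle finite_subset by blast
qed

text \<open>This is z^d times the conjugate of p(1 / cnj z). The exponent \<open>d\<close> is a
  parameter, not \<open>degree p\<close>, so that all entries of a matrix can be reflected with one
  common power of z.\<close>

definition reflect_cnj :: "nat \<Rightarrow> complex poly \<Rightarrow> complex poly" where
  "reflect_cnj d p = (\<Sum>i\<le>d. monom (cnj (coeff p i)) (d - i))"

lemma coeff_reflect_cnj:
  "coeff (reflect_cnj d p) n = (if n \<le> d then cnj (coeff p (d - n)) else 0)"
proof -
  have "coeff (reflect_cnj d p) n = (\<Sum>i\<le>d. if d - i = n then cnj (coeff p i) else 0)"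
    by (simp add: reflect_cnj_def coeff_sum)
  also have "\<dots> = (\<Sum>i\<in>(if n \<le> d then {d - n} else {}). cnj (coeff p i))"
    by (rule sum.mono_neutral_cong_right) (auto split: if_splits)
  finally show ?thesis by simp
qed

lemma poly_reflect_cnj:
  assumes "degree p \<le> d" "cmod z = 1"
  shows "poly (reflect_cnj d p) z = z ^ d * cnj (poly p z)"
proof -
  have zz: "z * cnj z = 1" using assms(2) by (metis assms(2) complex_norm_square of_real_1 one_power2)
  have "poly p z = (\<Sum>i\<le>d. coeff p i * z ^ i)"
    unfolding poly_altdef using assms(1)
    by (intro sum.mono_neutral_left) (auto simp: coeff_eq_0)
  then have "z ^ d * cnj (poly p z) = (\<Sum>i\<le>d. cnj (coeff p i) * (z ^ d * cnj z ^ i))"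
    by (simp add: sum_distrib_left mult_ac)
  also have "\<dots> = (\<Sum>i\<le>d. cnj (coeff p i) * z ^ (d - i))"
  proof (rule sum.cong)
    fix i assume "i \<in> {..d}"
    then have "z ^ d * cnj z ^ i = z ^ (d - i) * (z * cnj z) ^ i"
      by (simp add: power_mult_distrib mult.assoc[symmetric] power_add[symmetric])
    then show "cnj (coeff p i) * (z ^ d * cnj z ^ i) = cnj (coeff p i) * z ^ (d - i)"
      by (simp add: zz)
  qed simp
  finally show ?thesis by (simp add: reflect_cnj_def poly_sum poly_monom)
qed

text \<open>Zeros on the circle counted with multiplicity: the measure that decreases when an
  intertwiner is improved.\<close>

definition circle_order :: "complex poly \<Rightarrow> nat" where
  "circle_order p = size {#z \<in># proots p. cmod z = 1#}"

lemma circle_order_mult: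
  "p \<noteq> 0 \<Longrightarrow> q \<noteq> 0 \<Longrightarrow> circle_order (p * q) = circle_order p + circle_order q"
  by (simp add: circle_order_def proots_mult)

lemma circle_order_power: "p \<noteq> 0 \<Longrightarrow> circle_order (p ^ n) = n * circle_order p"
  by (induction n) (simp_all add: circle_order_mult, simp add: circle_order_def)

lemma circle_order_eq_0_iff:
  assumes "p \<noteq> 0"
  shows "circle_order p = 0 \<longleftrightarrow> (\<forall>z. cmod z = 1 \<longrightarrow> poly p z \<noteq> 0)"
proof -
  have "circle_order p = 0 \<longleftrightarrow> set_mset {#z \<in># proots p. cmod z = 1#} = {}"
    by (simp only: circle_order_def size_eq_0_iff_empty set_mset_eq_empty_iff)
  then have "circle_order p = 0 \<longleftrightarrow> (\<forall>z. z \<in># proots p \<longrightarrow> cmod z \<noteq> 1)"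
    by auto
  then show ?thesis using assms by auto
qed

text \<open>An estimate that was divided by a power of \<open>cmod (z - w)\<close> is lost at
  \<open>w\<close> itself; continuity along the arc \<open>w * cis t\<close> restores it.\<close>

lemma circle_limit_le:
  assumes "cmod w = 1" "continuous_on UNIV f" "continuous_on UNIV g"
    and le: "\<And>z. cmod z = 1 \<Longrightarrow> z \<noteq> w \<Longrightarrow> f z \<le> (g z :: real)"
  shows "f w \<le> g w"
proof (rule tendsto_le)
  have "continuous_on UNIV (\<lambda>t. w * cis t)" by (intro continuous_intros)
  then have c: "isCont (\<lambda>t. w * cis t) 0" by (simp add: continuous_on_eq_continuous_at)
  have "isCont f w" "isCont g w" using assms(2,3) by (auto simp: continuous_on_eq_continuous_at)
  then have "isCont (\<lambda>t. f (w * cis t)) 0" "isCont (\<lambda>t. g (w * cis t)) 0"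
    using isCont_o2[OF c, of f] isCont_o2[OF c, of g] by auto
  then show "((\<lambda>t. f (w * cis t)) \<longlongrightarrow> f w) (at 0)" "((\<lambda>t. g (w * cis t)) \<longlongrightarrow> g w) (at 0)"
    by (auto simp: isCont_def)
  have "w * cis t \<noteq> w" if "t \<noteq> 0" "dist t 0 < pi" for t :: real
  proof
    assume "w * cis t = w"
    moreover have "w \<noteq> 0" using assms(1) by auto
    ultimately have "cis t = 1" by simp
    then have "cos t = 1" by (metis cis.sel(1) one_complex.sel(1))
    then have "\<bar>t\<bar> = 0" using cos_monotone_0_pi[of 0 "\<bar>t\<bar>"] that by (cases "t = 0") (auto simp: dist_real_def)
    then show False using that by simp
  qed
  then show "eventually (\<lambda>t. f (w * cis t) \<le> g (w * cis t)) (at 0)"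
    unfolding eventually_at using assms(1)
    by (intro exI[of _ pi]) (auto intro!: le simp: norm_mult)
qed simp

text \<open>The weight \<open>z\<^sup>2 - z0\<^sup>2\<close> vanishes to first order only, while the other two factors enter
  squared; hence the weighted estimate forces divisibility at every zero on the circle.\<close>

lemma divide_circle_zeros:
  fixes d :: "complex poly" and p :: "'i \<Rightarrow> complex poly"
  assumes "d \<noteq> 0" "z0 \<noteq> 0"
    and "\<And>i z. i \<in> I \<Longrightarrow> cmod z = 1 \<Longrightarrow>
      cmod (z\<^sup>2 - z0\<^sup>2) * (cmod (poly (p i) z))\<^sup>2 \<le> C * (cmod (poly d z))\<^sup>2"
  shows "\<exists>e u. d = e * u \<and> (\<forall>z. cmod z = 1 \<longrightarrow> poly u z \<noteq> 0) \<and> (\<forall>i\<in>I. e dvd p i)"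
  using assms(1,3)
proof (induction "circle_order d" arbitrary: d p)
  case 0
  then show ?case by (intro exI[of _ 1] exI[of _ d]) (auto simp: circle_order_eq_0_iff)
next
  case (Suc n)
  then have "circle_order d \<noteq> 0" by simp
  then obtain w where w: "cmod w = 1" "poly d w = 0" using Suc.prems circle_order_eq_0_iff by auto
  then obtain d1 where d1: "d = [:-w, 1:] * d1" by (auto simp: poly_eq_0_iff_dvd elim: dvdE)
  have d1_nz: "d1 \<noteq> 0" using d1 Suc.prems(1) by auto
  have "circle_order [:-w, 1:] = 1"
    using w by (simp add: circle_order_def)
  then have n: "n = circle_order d1"
    using Suc.hyps(2) circle_order_mult[of "[:-w, 1:]" d1] d1 d1_nz by simp
  have est: "cmod (z\<^sup>2 - z0\<^sup>2) * (cmod (poly (p i) z))\<^sup>2 \<le> C * ((cmod (z - w))\<^sup>2 * (cmod (poly d1 z))\<^sup>2)"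
    if "i \<in> I" "cmod z = 1" for i z
    using Suc.prems(2)[OF that]
    unfolding d1 poly_mult norm_mult power_mult_distrib by simp
  have "poly (p i) w = 0" if i: "i \<in> I" for i
  proof (cases "w\<^sup>2 = z0\<^sup>2")
    case False
    then show ?thesis using est[OF i w(1)] by (simp add: mult_le_0_iff)
  next
    case True
    \<comment> \<open>Here the weight vanishes at \<open>w\<close>, but only through the first
      factor of (z - w)(z + w), whereas the right-hand side has \<open>cmod (z - w)\<close> squared.
      After cancelling it once, the right-hand side is 0 at \<open>w\<close> and the weight there is
      2.\<close>
    have "cmod (w + w) * (cmod (poly (p i) w))\<^sup>2 \<le> C * (cmod (w - w) * (cmod (poly d1 w))\<^sup>2)"
    proof (rule circle_limit_le[OF w(1), where f = "\<lambda>z. cmod (z + w) * (cmod (poly (p i) z))\<^sup>2"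
          and g = "\<lambda>z. C * (cmod (z - w) * (cmod (poly d1 z))\<^sup>2)"])
      fix z assume z: "cmod z = 1" "z \<noteq> w"
      have "z\<^sup>2 - z0\<^sup>2 = (z - w) * (z + w)" unfolding True[symmetric] by (simp add: power2_eq_square algebra_simps)
      then have "cmod (z - w) * (cmod (z + w) * (cmod (poly (p i) z))\<^sup>2)
          \<le> cmod (z - w) * (C * (cmod (z - w) * (cmod (poly d1 z))\<^sup>2))"
        using est[OF i z(1)] by (simp add: norm_mult power2_eq_square mult_ac)
      then show "cmod (z + w) * (cmod (poly (p i) z))\<^sup>2 \<le> C * (cmod (z - w) * (cmod (poly d1 z))\<^sup>2)"
        using z by (simp add: mult_le_cancel_left)
    qed (intro continuous_intros)+
    moreover have "cmod (w + w) = 2" using w by (metis mult_2 norm_mult norm_numeral mult.right_neutral)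
    ultimately show ?thesis by simp
  qed
  then have "\<forall>i\<in>I. \<exists>p1. p i = [:-w, 1:] * p1"
    by (simp only: poly_eq_0_iff_dvd dvd_def) blast
  then obtain p1 where p1: "\<And>i. i \<in> I \<Longrightarrow> p i = [:-w, 1:] * p1 i" by metis
  \<comment> \<open>Both sides lose \<open>cmod (z - w)\<close> squared, so the quotients satisfy
    the same estimate and the induction continues.\<close>
  have "cmod (z\<^sup>2 - z0\<^sup>2) * (cmod (poly (p1 i) z))\<^sup>2 \<le> C * (cmod (poly d1 z))\<^sup>2"
    if i: "i \<in> I" and z: "cmod z = 1" for i z
  proof -
    have *: "cmod (z\<^sup>2 - z0\<^sup>2) * (cmod (poly (p1 i) z))\<^sup>2 \<le> C * (cmod (poly d1 z))\<^sup>2"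
      if z: "cmod z = 1" "z \<noteq> w" for z
    proof -
      have "(cmod (z - w))\<^sup>2 * (cmod (z\<^sup>2 - z0\<^sup>2) * (cmod (poly (p1 i) z))\<^sup>2)
        \<le> (cmod (z - w))\<^sup>2 * (C * (cmod (poly d1 z))\<^sup>2)"
        using est[OF i z(1)] unfolding p1[OF i] poly_mult norm_mult power_mult_distrib
        by (simp add: mult_ac)
      then show ?thesis using z by (simp add: mult_le_cancel_left)
    qed
    show ?thesis
    proof (cases "z = w")
      case True
      show ?thesis unfolding True
        by (rule circle_limit_le[OF w(1), where f = "\<lambda>z. cmod (z\<^sup>2 - z0\<^sup>2) * (cmod (poly (p1 i) z))\<^sup>2"
            and g = "\<lambda>z. C * (cmod (poly d1 z))\<^sup>2"]) (intro continuous_intros * | assumption)+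
    qed (use * z in auto)
  qed
  from Suc.hyps(1)[of d1 p1, OF n d1_nz this] obtain e u where eu: "d1 = e * u"
    "\<forall>z. cmod z = 1 \<longrightarrow> poly u z \<noteq> 0" "\<forall>i\<in>I. e dvd p1 i" by blast
  have "d = [:-w, 1:] * e * u" by (simp only: d1 eu(1) mult.assoc)
  moreover have "[:-w, 1:] * e dvd p i" if "i \<in> I" for i
    unfolding p1[OF that] using eu(3) that by (intro mult_dvd_mono dvd_refl) blast
  ultimately show ?case using eu(2) by blast
qed

section \<open>Adjoint matrices and the regularized quadratic form\<close>

definition adjoint_mat :: "complex mat \<Rightarrow> complex mat" where
  "adjoint_mat A = mat (dim_col A) (dim_row A) (\<lambda>(i, j). cnj (A $$ (j, i)))"

lemma adjoint_mat_carrier [simp]: "A \<in> carrier_mat n m \<Longrightarrow> adjoint_mat A \<in> carrier_mat m n"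
  by (auto simp: adjoint_mat_def)

lemma index_adjoint_mat [simp]:
  "A \<in> carrier_mat n m \<Longrightarrow> i < m \<Longrightarrow> j < n \<Longrightarrow> adjoint_mat A $$ (i, j) = cnj (A $$ (j, i))"
  by (auto simp: adjoint_mat_def)

lemma adjoint_adjoint_mat [simp]: "adjoint_mat (adjoint_mat A) = A"
  by (auto simp: adjoint_mat_def)

lemma index_mult_mat_sum:
  "A \<in> carrier_mat n m \<Longrightarrow> B \<in> carrier_mat m l \<Longrightarrow> i < n \<Longrightarrow> j < l \<Longrightarrow>
    (A * B) $$ (i, j) = (\<Sum>c<m. A $$ (i, c) * B $$ (c, j))"
  by (auto simp: scalar_prod_def atLeast0LessThan intro!: sum.cong)

lemma adjoint_mat_mult:
  assumes "A \<in> carrier_mat n m" "B \<in> carrier_mat m l"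
  shows "adjoint_mat (A * B) = adjoint_mat B * adjoint_mat A"
proof (rule eq_matI)
  fix i j assume "i < dim_row (adjoint_mat B * adjoint_mat A)" "j < dim_col (adjoint_mat B * adjoint_mat A)"
  then have ij: "i < l" "j < n" using assms by (auto simp: adjoint_mat_def)
  have "adjoint_mat (A * B) $$ (i, j) = cnj ((A * B) $$ (j, i))"
    using assms ij by (intro index_adjoint_mat[of _ n l]) auto
  also have "\<dots> = (\<Sum>c<m. cnj (A $$ (j, c)) * cnj (B $$ (c, i)))"
    using assms ij by (simp add: index_mult_mat_sum[OF assms] del: index_mult_mat)
  also have "\<dots> = (adjoint_mat B * adjoint_mat A) $$ (i, j)"
    using assms ij
    by (simp add: index_mult_mat_sum[of "adjoint_mat B" l m "adjoint_mat A" n] mult_ac del: index_mult_mat)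
  finally show "adjoint_mat (A * B) $$ (i, j) = (adjoint_mat B * adjoint_mat A) $$ (i, j)" .
qed (use assms in \<open>auto simp: adjoint_mat_def\<close>)

text \<open>\<open>B\<close> and \<open>C\<close> are multiples of unitary matrices, so their
  adjoints are \<open>c\<close> times their inverses. Multiplying \<open>A * C = B * A\<close> by
  \<open>adjoint_mat B\<close> on the left and \<open>adjoint_mat C\<close> on the right gives
  \<open>adjoint_mat B * A = A * adjoint_mat C\<close>; taking adjoints finishes the proof.\<close>

lemma adjoint_intertwines:
  assumes A: "A \<in> carrier_mat k k" and B: "B \<in> carrier_mat k k" and C: "C \<in> carrier_mat k k"
    and AC: "A * C = B * A"
    and BB: "adjoint_mat B * B = c \<cdot>\<^sub>m 1\<^sub>m k" and CC: "adjoint_mat C * C = c \<cdot>\<^sub>m 1\<^sub>m k" and "c \<noteq> 0"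
  shows "adjoint_mat A * B = C * adjoint_mat A"
proof -
  have "((1 / c) \<cdot>\<^sub>m adjoint_mat C) * C = 1\<^sub>m k"
    using C CC \<open>c \<noteq> 0\<close> by (auto simp: mult_smult_assoc_mat[of _ k k])
  then have "C * ((1 / c) \<cdot>\<^sub>m adjoint_mat C) = 1\<^sub>m k"
    by (rule mat_mult_left_right_inverse[rotated 2]) (use C in auto)
  then have "c \<cdot>\<^sub>m ((1 / c) \<cdot>\<^sub>m (C * adjoint_mat C)) = c \<cdot>\<^sub>m 1\<^sub>m k"
    using C by (simp add: mult_smult_distrib[of _ k k _ k])
  moreover have sc: "c \<cdot>\<^sub>m ((1 / c) \<cdot>\<^sub>m M) = M" "(1 / c) \<cdot>\<^sub>m (c \<cdot>\<^sub>m M) = M" for M :: "complex mat"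
    using \<open>c \<noteq> 0\<close> by (auto intro!: eq_matI)
  ultimately have CC': "C * adjoint_mat C = c \<cdot>\<^sub>m 1\<^sub>m k" by simp
  let ?B = "adjoint_mat B" and ?C = "adjoint_mat C"
  have Bc: "?B \<in> carrier_mat k k" "?C \<in> carrier_mat k k" using B C by auto
  have "?B * (A * C) * ?C = ?B * A * (C * ?C)"
    using A Bc C by (simp add: assoc_mult_mat[of _ k k _ k _ k])
  also have "\<dots> = c \<cdot>\<^sub>m (?B * A)"
    unfolding CC' using A Bc by (simp add: mult_smult_distrib[of _ k k _ k])
  finally have 1: "?B * (A * C) * ?C = c \<cdot>\<^sub>m (?B * A)" .
  have "?B * (B * A) * ?C = (?B * B) * (A * ?C)"
    using A Bc B by (simp add: assoc_mult_mat[of _ k k _ k _ k])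
  also have "\<dots> = c \<cdot>\<^sub>m (A * ?C)"
    unfolding BB using A Bc by (simp add: mult_smult_assoc_mat[of _ k k _ k])
  finally have "c \<cdot>\<^sub>m (?B * A) = c \<cdot>\<^sub>m (A * ?C)" using 1 AC by simp
  then have "(1 / c) \<cdot>\<^sub>m (c \<cdot>\<^sub>m (?B * A)) = (1 / c) \<cdot>\<^sub>m (c \<cdot>\<^sub>m (A * ?C))" by simp
  then have "?B * A = A * ?C" by (simp only: sc)
  then have "adjoint_mat (?B * A) = adjoint_mat (A * ?C)" by simp
  then show ?thesis
    using A B C Bc by (simp add: adjoint_mat_mult[of _ k k _ k])
qed

text \<open>With X the matrix of \<open>x\<close>, \<open>Q\<close> is \<open>\<rho>\<close> times
  X^* X + i t. Apart from the factor \<open>\<rho>\<close> the form has real part |X w|^2 and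
  imaginary part t |w|^2, so its modulus controls both.\<close>

lemma quadratic_form_identity:
  fixes x :: "nat \<Rightarrow> nat \<Rightarrow> complex" and w :: "nat \<Rightarrow> complex" and t :: real
  assumes Q: "\<And>i j. i < k \<Longrightarrow> j < k \<Longrightarrow>
      Q i j = \<rho> * ((\<Sum>c<k. cnj (x c i) * x c j) + (if i = j then \<i> * of_real t else 0))"
  shows "(\<Sum>i<k. cnj (w i) * (\<Sum>j<k. Q i j * w j)) =
    \<rho> * (of_real (\<Sum>c<k. (cmod (\<Sum>j<k. x c j * w j))\<^sup>2) + \<i> * of_real (t * (\<Sum>i<k. (cmod (w i))\<^sup>2)))"
proof -
  have 1: "(\<Sum>i<k. cnj (w i) * (\<Sum>j<k. (\<Sum>c<k. cnj (x c i) * x c j) * w j)) =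
      of_real (\<Sum>c<k. (cmod (\<Sum>j<k. x c j * w j))\<^sup>2)"
  proof -
    have "(\<Sum>i<k. cnj (w i) * (\<Sum>j<k. (\<Sum>c<k. cnj (x c i) * x c j) * w j))
      = (\<Sum>i<k. \<Sum>j<k. \<Sum>c<k. cnj (x c i) * cnj (w i) * (x c j * w j))"
      by (simp add: sum_distrib_left sum_distrib_right mult_ac)
    also have "\<dots> = (\<Sum>i<k. \<Sum>c<k. \<Sum>j<k. cnj (x c i) * cnj (w i) * (x c j * w j))"
      by (intro sum.cong refl sum.swap)
    also have "\<dots> = (\<Sum>c<k. \<Sum>i<k. \<Sum>j<k. cnj (x c i) * cnj (w i) * (x c j * w j))"
      by (rule sum.swap)
    also have "\<dots> = (\<Sum>c<k. cnj (\<Sum>i<k. x c i * w i) * (\<Sum>j<k. x c j * w j))"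
      by (simp add: sum_product)
    also have "\<dots> = (\<Sum>c<k. of_real ((cmod (\<Sum>j<k. x c j * w j))\<^sup>2))"
      unfolding complex_norm_square by (simp add: mult.commute)
    finally show ?thesis by simp
  qed
  have 2: "(\<Sum>i<k. cnj (w i) * w i) = of_real (\<Sum>i<k. (cmod (w i))\<^sup>2)"
    by (simp only: of_real_sum complex_norm_square mult.commute)
  have "(\<Sum>j<k. Q i j * w j) = \<rho> * ((\<Sum>j<k. (\<Sum>c<k. cnj (x c i) * x c j) * w j) + \<i> * of_real t * w i)"
    if "i < k" for i
  proof -
    have "(\<Sum>j<k. Q i j * w j) = (\<Sum>j<k. \<rho> * ((\<Sum>c<k. cnj (x c i) * x c j) * w j) + (if i = j then \<rho> * \<i> * of_real t * w j else 0))"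
      using that by (intro sum.cong refl) (simp add: Q algebra_simps)
    also have "\<dots> = (\<Sum>j<k. \<rho> * ((\<Sum>c<k. cnj (x c i) * x c j) * w j)) + \<rho> * \<i> * of_real t * w i"
      using that by (simp add: sum.distrib sum.delta')
    finally show ?thesis by (simp add: sum_distrib_left algebra_simps)
  qed
  then have "(\<Sum>i<k. cnj (w i) * (\<Sum>j<k. Q i j * w j)) =
    (\<Sum>i<k. \<rho> * (cnj (w i) * (\<Sum>j<k. (\<Sum>c<k. cnj (x c i) * x c j) * w j)) + \<rho> * (\<i> * of_real t) * (cnj (w i) * w i))"
    by (intro sum.cong refl) (simp add: algebra_simps)
  also have "\<dots> = \<rho> * (\<Sum>i<k. cnj (w i) * (\<Sum>j<k. (\<Sum>c<k. cnj (x c i) * x c j) * w j))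
      + \<rho> * (\<i> * of_real t) * (\<Sum>i<k. cnj (w i) * w i)"
    by (simp only: sum.distrib sum_distrib_left)
  finally show ?thesis unfolding 1 2 by (simp add: algebra_simps)
qed

text \<open>With S = |X w|^2 and N = |w|^2, the identity above bounds both S and |t| N by
  \<open>cmod (w b) * cmod \<Delta>\<close>. Since |w b|^2 is at most N, the second bound gives |t|
  |w b| <= |\<Delta>|, and with this the first gives the claim.\<close>

lemma regularized_solution_estimate:
  fixes x :: "nat \<Rightarrow> nat \<Rightarrow> complex" and w :: "nat \<Rightarrow> complex" and t :: real
  assumes Q: "\<And>i j. i < k \<Longrightarrow> j < k \<Longrightarrow>
      Q i j = \<rho> * ((\<Sum>c<k. cnj (x c i) * x c j) + (if i = j then \<i> * of_real t else 0))"
    and "cmod \<rho> = 1" "a < k" "b < k"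
    and sol: "\<And>i. i < k \<Longrightarrow> (\<Sum>j<k. Q i j * w j) = (if i = b then \<Delta> else 0)"
  shows "\<bar>t\<bar> * (cmod (\<Sum>j<k. x a j * w j))\<^sup>2 \<le> (cmod \<Delta>)\<^sup>2"
proof -
  define S where "S = (\<Sum>c<k. (cmod (\<Sum>j<k. x c j * w j))\<^sup>2)"
  define N where "N = (\<Sum>i<k. (cmod (w i))\<^sup>2)"
  have "(\<Sum>i<k. cnj (w i) * (\<Sum>j<k. Q i j * w j)) = (\<Sum>i<k. if i = b then cnj (w i) * \<Delta> else 0)"
    by (intro sum.cong refl) (simp add: sol)
  also have "\<dots> = cnj (w b) * \<Delta>" using \<open>b < k\<close> by simp
  finally have eq: "\<rho> * (of_real S + \<i> * of_real (t * N)) = cnj (w b) * \<Delta>"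
    unfolding S_def N_def using quadratic_form_identity[OF Q, of w] by (simp only:)
  have "cmod (\<rho> * (of_real S + \<i> * of_real (t * N))) = cmod (cnj (w b) * \<Delta>)" by (simp only: eq)
  then have n: "cmod (of_real S + \<i> * of_real (t * N)) = cmod (w b) * cmod \<Delta>"
    by (simp add: norm_mult \<open>cmod \<rho> = 1\<close>)
  have "S \<le> cmod (w b) * cmod \<Delta>" "\<bar>t * N\<bar> \<le> cmod (w b) * cmod \<Delta>"
    unfolding n[symmetric]
    using abs_Re_le_cmod[of "of_real S + \<i> * of_real (t * N)"] abs_Im_le_cmod[of "of_real S + \<i> * of_real (t * N)"]
    by auto
  moreover have "(cmod (w b))\<^sup>2 \<le> N" unfolding N_def using \<open>b < k\<close> by (intro member_le_sum) auto
  moreover have N0: "N \<ge> 0" unfolding N_def by (intro sum_nonneg) auto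
  moreover have yS: "(cmod (\<Sum>j<k. x a j * w j))\<^sup>2 \<le> S"
    unfolding S_def using \<open>a < k\<close> by (intro member_le_sum[of a _ "\<lambda>c. (cmod (\<Sum>j<k. x c j * w j))\<^sup>2"]) auto
  ultimately have SN: "S \<le> cmod (w b) * cmod \<Delta>" "\<bar>t\<bar> * N \<le> cmod (w b) * cmod \<Delta>"
      "\<bar>t\<bar> * (cmod (w b))\<^sup>2 \<le> \<bar>t\<bar> * N"
    by (auto simp: abs_mult intro: mult_left_mono)
  then have "\<bar>t\<bar> * (cmod (w b))\<^sup>2 \<le> cmod (w b) * cmod \<Delta>" by linarith
  then have tw: "\<bar>t\<bar> * cmod (w b) \<le> cmod \<Delta>"
    by (cases "w b = 0") (auto simp: power2_eq_square mult.left_commute[of "\<bar>t\<bar>"])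
  have "\<bar>t\<bar> * (cmod (\<Sum>j<k. x a j * w j))\<^sup>2 \<le> \<bar>t\<bar> * (cmod (w b) * cmod \<Delta>)"
    using yS SN(1) by (intro mult_left_mono) auto
  also have "\<dots> \<le> cmod \<Delta> * cmod \<Delta>"
    using mult_right_mono[OF tw norm_ge_zero[of \<Delta>]] by (simp add: mult.assoc)
  finally show ?thesis by (simp add: power2_eq_square)
qed

lemma map_mat_poly_mult:
  "A \<in> carrier_mat n m \<Longrightarrow> B \<in> carrier_mat m l \<Longrightarrow>
    map_mat (\<lambda>p. poly p z) (A * B) = map_mat (\<lambda>p. poly p z) A * map_mat (\<lambda>p. poly p z) B"
  by (intro eq_matI) (auto simp: scalar_prod_def poly_sum)

lemma det_map_mat_poly: "det (map_mat (\<lambda>p. poly p z) A) = poly (det A) z"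
  by (rule comm_ring_hom.hom_det[OF poly_hom.comm_ring_hom_axioms])

text \<open>Replacing \<open>Z\<close> by \<open>Z (Z\<^sup>* Z + \<i>\<tau>)\<^sup>-\<^sup>1\<close>, where the real function \<open>\<tau>\<close> has simple zeros
  on the circle, one of them at a zero of \<open>det Z\<close>, keeps the intertwining property, introduces
  no poles on the circle (its norm is at most \<open>\<bar>\<tau>\<bar>\<close> to the power \<open>-1/2\<close>), and removes zeros
  of the determinant from the circle.\<close>

lemma intertwiner_fewer_circle_zeros:
  fixes G G' :: "'j \<Rightarrow> complex poly mat" and q :: "'j \<Rightarrow> complex poly"
  assumes G: "\<And>j. G j \<in> carrier_mat k k" and G': "\<And>j. G' j \<in> carrier_mat k k"
    and q: "\<And>j z. cmod z = 1 \<Longrightarrow> poly (q j) z \<noteq> 0"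
    and uG: "\<And>j z. cmod z = 1 \<Longrightarrow> adjoint_mat (map_mat (\<lambda>p. poly p z) (G j)) * map_mat (\<lambda>p. poly p z) (G j) =
      of_real ((cmod (poly (q j) z))\<^sup>2) \<cdot>\<^sub>m 1\<^sub>m k"
    and uG': "\<And>j z. cmod z = 1 \<Longrightarrow> adjoint_mat (map_mat (\<lambda>p. poly p z) (G' j)) * map_mat (\<lambda>p. poly p z) (G' j) =
      of_real ((cmod (poly (q j) z))\<^sup>2) \<cdot>\<^sub>m 1\<^sub>m k"
    and Z: "Z \<in> carrier_mat k k" and ZG: "\<And>j. Z * G' j = G j * Z" and dZ: "det Z \<noteq> 0"
    and z0: "cmod z0 = 1" "poly (det Z) z0 = 0"
  shows "\<exists>Y\<in>carrier_mat k k. (\<forall>j. Y * G' j = G j * Y) \<and> det Y \<noteq> 0 \<and> circle_order (det Y) < circle_order (det Z)"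
proof -
  let ?E = "\<lambda>z. map_mat (\<lambda>p. poly p z)"
  \<comment> \<open>\<open>D\<close> bounds the degrees of all entries, and \<open>Suc\<close> keeps
    the exponent \<open>D - 1\<close> in \<open>s\<close> from being truncated.\<close>
  define D where "D = Suc (Max ((\<lambda>(a, b). degree (Z $$ (a, b))) ` ({..<k} \<times> {..<k})))"
  have D: "degree (Z $$ (a, b)) \<le> D" if "a < k" "b < k" for a b
  proof -
    have "degree (Z $$ (a, b)) \<le> Max ((\<lambda>(a, b). degree (Z $$ (a, b))) ` ({..<k} \<times> {..<k}))"
      using that by (intro Max_ge) (auto intro!: image_eqI[of _ _ "(a, b)"])
    then show ?thesis by (simp add: D_def)
  qed
  define Zs where "Zs = mat k k (\<lambda>(a, b). reflect_cnj D (Z $$ (b, a)))"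
  \<comment> \<open>On the circle i \<tau> = (cnj z0 z - z0 cnj z) / 2, and multiplication by z^D
    turns this into the polynomial \<open>s\<close>. Accordingly \<open>Q\<close> is z^D times Z^* Z
    + i \<tau> there, and \<open>\<tau>\<close> vanishes exactly at z0 and -z0.\<close>
  define s where "s = Polynomial.smult (cnj z0 / 2) (monom 1 (D + 1)) - Polynomial.smult (z0 / 2) (monom 1 (D - 1))"
  define Q where "Q = Zs * Z + s \<cdot>\<^sub>m 1\<^sub>m k"
  define \<tau> where "\<tau> z = Im (cnj z0 * z)" for z
  have Zs: "Zs \<in> carrier_mat k k" by (simp add: Zs_def)
  have Q: "Q \<in> carrier_mat k k" using Z Zs by (simp add: Q_def)
  have EZs: "?E z Zs = z ^ D \<cdot>\<^sub>m adjoint_mat (?E z Z)" if "cmod z = 1" for z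
    using Z that by (intro eq_matI) (auto simp: Zs_def adjoint_mat_def poly_reflect_cnj D)
  have s_eq: "poly s z = z ^ D * (\<i> * of_real (\<tau> z))" and \<tau>_eq: "cmod (z\<^sup>2 - z0\<^sup>2) = 2 * \<bar>\<tau> z\<bar>"
    if z: "cmod z = 1" for z
  proof -
    have zz: "z * cnj z = 1" "z0 * cnj z0 = 1" using z z0
      by (metis complex_norm_square of_real_1 one_power2)+
    have zD: "z ^ (D - Suc 0) = z ^ D * cnj z" using zz by (simp add: D_def mult_ac)
    have it: "\<i> * of_real (\<tau> z) = (cnj z0 * z - z0 * cnj z) / 2"
      unfolding \<tau>_def by (auto simp: complex_eq_iff)
    show "poly s z = z ^ D * (\<i> * of_real (\<tau> z))"
      unfolding it by (simp add: s_def poly_monom zD algebra_simps)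
    have "cnj z0 * z - z0 * cnj z = cnj z0 * cnj z * (z\<^sup>2 - z0\<^sup>2)"
    proof -
      have "cnj z0 * cnj z * (z\<^sup>2 - z0\<^sup>2) = cnj z0 * z * (z * cnj z) - z0 * cnj z * (z0 * cnj z0)"
        by (simp add: power2_eq_square algebra_simps)
      then show ?thesis by (simp add: zz)
    qed
    then have "cmod (2 * (\<i> * of_real (\<tau> z))) = cmod (cnj z0 * cnj z * (z\<^sup>2 - z0\<^sup>2))"
      unfolding it by simp
    then show "cmod (z\<^sup>2 - z0\<^sup>2) = 2 * \<bar>\<tau> z\<bar>" using z z0 by (simp add: norm_mult)
  qed
  have EQ: "?E z Q $$ (i, j) = z ^ D * ((\<Sum>c<k. cnj (poly (Z $$ (c, i)) z) * poly (Z $$ (c, j)) z)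
      + (if i = j then \<i> * of_real (\<tau> z) else 0))" if "i < k" "j < k" "cmod z = 1" for i j z
  proof -
    have "?E z Q $$ (i, j) = poly ((Zs * Z) $$ (i, j)) z + (if i = j then poly s z else 0)"
      using that Z Zs by (simp add: Q_def)
    also have "poly ((Zs * Z) $$ (i, j)) z = (\<Sum>c<k. poly (Zs $$ (i, c)) z * poly (Z $$ (c, j)) z)"
      using that by (simp add: index_mult_mat_sum[OF Zs Z] poly_sum del: index_mult_mat)
    also have "\<dots> = (\<Sum>c<k. z ^ D * (cnj (poly (Z $$ (c, i)) z) * poly (Z $$ (c, j)) z))"
      using that by (intro sum.cong) (auto simp: Zs_def poly_reflect_cnj D)
    finally show ?thesis using that by (simp add: s_eq sum_distrib_left algebra_simps)
  qed
  \<comment> \<open>An identity of polynomials may be checked on the circle, where \<open>Zs\<close>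
    is a power of z times the adjoint of \<open>Z\<close> and \<open>adjoint_intertwines\<close>
    applies.\<close>
  have ZsG: "Zs * G j = G' j * Zs" for j
  proof (rule eq_matI)
    fix a b assume "a < dim_row (G' j * Zs)" "b < dim_col (G' j * Zs)"
    then have ab: "a < k" "b < k" using G'[of j] Zs by auto
    show "(Zs * G j) $$ (a, b) = (G' j * Zs) $$ (a, b)"
    proof (rule poly_eqI_unit_circle)
      fix z :: complex assume z: "cmod z = 1"
      have c: "?E z (G j) \<in> carrier_mat k k" "?E z (G' j) \<in> carrier_mat k k" "?E z Z \<in> carrier_mat k k"
        using G G' Z by auto
      have "?E z Z * ?E z (G' j) = ?E z (G j) * ?E z Z"
        using arg_cong[OF ZG[of j], of "?E z"]
        by (simp add: map_mat_poly_mult[OF Z G'] map_mat_poly_mult[OF G Z])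
      from adjoint_intertwines[OF c(3,1,2) this uG[OF z] uG'[OF z]] q[OF z, of j]
      have "adjoint_mat (?E z Z) * ?E z (G j) = ?E z (G' j) * adjoint_mat (?E z Z)" by simp
      then have "?E z Zs * ?E z (G j) = ?E z (G' j) * ?E z Zs"
        unfolding EZs[OF z] using c
        by (simp add: mult_smult_assoc_mat[of _ k k _ k] mult_smult_distrib[of _ k k _ k])
      then have "?E z (Zs * G j) = ?E z (G' j * Zs)"
        by (simp add: map_mat_poly_mult[OF Zs G] map_mat_poly_mult[OF G' Zs])
      then have "?E z (Zs * G j) $$ (a, b) = ?E z (G' j * Zs) $$ (a, b)" by simp
      then show "poly ((Zs * G j) $$ (a, b)) z = poly ((G' j * Zs) $$ (a, b)) z"
        using ab Zs G[of j] G'[of j] by (simp del: index_mult_mat(1))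
    qed
  qed (use Zs G[of j] G'[of j] in auto)
  have QG: "Q * G' j = G' j * Q" for j
  proof -
    have "(Zs * Z) * G' j = Zs * (G j * Z)"
      using Zs Z G'[of j] by (simp add: assoc_mult_mat[of _ k k _ k _ k] ZG)
    also have "\<dots> = (Zs * G j) * Z" using Zs Z G[of j] by simp
    also have "\<dots> = G' j * (Zs * Z)" using Zs Z G'[of j] by (simp add: ZsG)
    finally show ?thesis using Zs Z G'[of j]
      by (simp add: Q_def add_mult_distrib_mat[of _ k k _ _ k] mult_add_distrib_mat[of _ k k _ k]
          mult_smult_assoc_mat[of _ k k _ k] mult_smult_distrib[of _ k k _ k])
  qed
  define \<Delta> where "\<Delta> = det Q"
  have detE: "poly \<Delta> z = det (?E z Q)" for z by (simp add: \<Delta>_def det_map_mat_poly)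
  \<comment> \<open>At i z0 the modulus of \<open>\<tau>\<close> is 1, so a kernel vector of
    \<open>Q\<close> there would have norm 0. Hence \<open>\<Delta>\<close> is not the zero
    polynomial.\<close>
  have "poly \<Delta> (\<i> * z0) \<noteq> 0"
  proof
    let ?z = "\<i> * z0"
    have z: "cmod ?z = 1" using z0 by (simp add: norm_mult)
    assume "poly \<Delta> ?z = 0"
    then obtain v where v: "v \<in> carrier_vec k" "v \<noteq> 0\<^sub>v k" "?E ?z Q *\<^sub>v v = 0\<^sub>v k"
      unfolding detE using det_0_iff_vec_prod_zero[of "?E ?z Q" k] Q by auto
    have Qv: "(\<Sum>j<k. ?E ?z Q $$ (i, j) * vec_index v j) = 0" if "i < k" for i
    proof -
      have "(\<Sum>j<k. ?E ?z Q $$ (i, j) * vec_index v j) = vec_index (?E ?z Q *\<^sub>v v) i"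
        using that Q v(1) by (auto simp: scalar_prod_def atLeast0LessThan intro!: sum.cong)
      then show ?thesis using that by (simp add: v(3))
    qed
    have "(\<Sum>i<k. cnj (vec_index v i) * (\<Sum>j<k. ?E ?z Q $$ (i, j) * vec_index v j)) = 0"
      by (intro sum.neutral) (use Qv in auto)
    moreover have "?z ^ D \<noteq> 0" using z by auto
    ultimately have "complex_of_real (\<Sum>c<k. (cmod (\<Sum>j<k. poly (Z $$ (c, j)) ?z * vec_index v j))\<^sup>2) +
        \<i> * complex_of_real (\<tau> ?z * (\<Sum>i<k. (cmod (vec_index v i))\<^sup>2)) = 0"
      using quadratic_form_identity[where Q = "\<lambda>i j. ?E ?z Q $$ (i, j)" and t = "\<tau> ?z" and \<rho> = "?z ^ D" and k = k
          and x = "\<lambda>c i. poly (Z $$ (c, i)) ?z" and w = "vec_index v", OF EQ[OF _ _ z]]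
      by (simp only: mult_eq_0_iff) blast
    then have "\<tau> ?z * (\<Sum>i<k. (cmod (vec_index v i))\<^sup>2) = 0"
      by (auto simp: complex_eq_iff)
    moreover have "\<bar>\<tau> ?z\<bar> = 1"
    proof -
      have "2 * \<bar>\<tau> ?z\<bar> = cmod ((-2) * z0\<^sup>2)"
        unfolding \<tau>_eq[OF z, symmetric] by (simp add: power_mult_distrib)
      also have "\<dots> = 2" using z0 by (simp add: norm_mult norm_power)
      finally show ?thesis by simp
    qed
    ultimately have "(\<Sum>i<k. (cmod (vec_index v i))\<^sup>2) = 0" by auto
    then have "vec_index v i = 0" if "i < k" for i
      using that by (simp add: sum_nonneg_eq_0_iff)
    then have "v = 0\<^sub>v k" using v(1) by (intro eq_vecI) auto
    then show False using v by simp
  qed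
  then have \<Delta>_nz: "\<Delta> \<noteq> 0" by auto
  \<comment> \<open>At z0 the regularizing term vanishes, so \<open>\<Delta>\<close> inherits the
    zero of \<open>det Z\<close>. This is what makes the circle order drop at the end.\<close>
  have "?E z0 Q = ?E z0 Zs * ?E z0 Z"
    using Zs Z s_eq[OF z0(1)] \<tau>_eq[OF z0(1)]
    by (intro eq_matI) (auto simp: Q_def map_mat_poly_mult[OF Zs Z, symmetric] simp del: index_mult_mat(1))
  then have \<Delta>_z0: "poly \<Delta> z0 = 0"
    unfolding detE using Zs Z z0(2) by (simp add: det_mult[of _ k] det_map_mat_poly)
  define A where "A = adj_mat Q"
  have A: "A \<in> carrier_mat k k" "Q * A = \<Delta> \<cdot>\<^sub>m 1\<^sub>m k" "A * Q = \<Delta> \<cdot>\<^sub>m 1\<^sub>m k"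
    using adj_mat[OF Q] by (auto simp: A_def \<Delta>_def)
  \<comment> \<open>\<open>P\<close> is \<open>\<Delta>\<close> times Z Q^(-1); the adjugate keeps
    everything polynomial.\<close>
  define P where "P = Z * A"
  have P: "P \<in> carrier_mat k k" using Z A by (simp add: P_def)
  have cancel: "M = N" if "c \<cdot>\<^sub>m M = c \<cdot>\<^sub>m N" "c \<noteq> 0" "M \<in> carrier_mat k k" "N \<in> carrier_mat k k"
    for M N :: "complex poly mat" and c
  proof (rule eq_matI)
    fix i j assume "i < dim_row N" "j < dim_col N"
    then show "M $$ (i, j) = N $$ (i, j)"
      using arg_cong[OF that(1), of "\<lambda>M. M $$ (i, j)"] that(2-4) by auto
  qed (use that in auto)
  have AG: "A * G' j = G' j * A" for j
  proof (rule cancel)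
    have "A * (Q * G' j) * A = A * (G' j * Q) * A" by (simp add: QG)
    then have "(A * Q) * (G' j * A) = (A * G' j) * (Q * A)"
      using A(1) Q G'[of j] by (simp add: assoc_mult_mat[of _ k k _ k _ k])
    then show "\<Delta> \<cdot>\<^sub>m (A * G' j) = \<Delta> \<cdot>\<^sub>m (G' j * A)"
      unfolding A(2,3) using A(1) G'[of j]
      by (simp add: mult_smult_assoc_mat[of _ k k _ k] mult_smult_distrib[of _ k k _ k])
  qed (use A G'[of j] \<Delta>_nz in auto)
  have PG: "P * G' j = G j * P" for j
  proof -
    note c = Z A(1) G[of j] G'[of j]
    have "P * G' j = Z * (A * G' j)" unfolding P_def using c by (intro assoc_mult_mat) auto
    also have "\<dots> = Z * G' j * A"
      unfolding AG using c by (intro assoc_mult_mat[symmetric, of _ k k _ k _ k]) auto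
    also have "\<dots> = G j * P"
      unfolding ZG P_def using c by (intro assoc_mult_mat[of _ k k _ k _ k]) auto
    finally show ?thesis .
  qed
  \<comment> \<open>Column \<open>b\<close> of the adjugate solves the linear system in
    \<open>regularized_solution_estimate\<close>; the factor 2 comes from |z^2 - z0^2| = 2
    |\<tau>|.\<close>
  have "cmod (z\<^sup>2 - z0\<^sup>2) * (cmod (poly (P $$ ab) z))\<^sup>2 \<le> 2 * (cmod (poly \<Delta> z))\<^sup>2"
    if "ab \<in> {..<k} \<times> {..<k}" and z: "cmod z = 1" for ab z
  proof -
    obtain a b where ab: "ab = (a, b)" "a < k" "b < k" using \<open>ab \<in> _\<close> by auto
    have "(\<Sum>j<k. ?E z Q $$ (i, j) * poly (A $$ (j, b)) z) = (if i = b then poly \<Delta> z else 0)" if "i < k" for i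
    proof -
      have "(Q * A) $$ (i, b) = (\<Sum>j<k. Q $$ (i, j) * A $$ (j, b))"
        using that ab by (intro index_mult_mat_sum[OF Q A(1)])
      then have "(\<Sum>j<k. Q $$ (i, j) * A $$ (j, b)) = (\<Delta> \<cdot>\<^sub>m 1\<^sub>m k) $$ (i, b)"
        by (simp only: A(2))
      also have "\<dots> = (if i = b then \<Delta> else 0)" using that ab by simp
      finally have "poly (\<Sum>j<k. Q $$ (i, j) * A $$ (j, b)) z = (if i = b then poly \<Delta> z else 0)"
        by simp
      moreover have "?E z Q $$ (i, j) = poly (Q $$ (i, j)) z" if "j < k" for j
        using that \<open>i < k\<close> Q by simp
      ultimately show ?thesis by (simp add: poly_sum)
    qed
    from regularized_solution_estimate[where Q = "\<lambda>i j. ?E z Q $$ (i, j)" and t = "\<tau> z" and \<rho> = "z ^ D" and k = k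
        and x = "\<lambda>c i. poly (Z $$ (c, i)) z" and w = "\<lambda>j. poly (A $$ (j, b)) z", OF EQ[OF _ _ z] _ ab(2,3) this]
    have "\<bar>\<tau> z\<bar> * (cmod (\<Sum>j<k. poly (Z $$ (a, j)) z * poly (A $$ (j, b)) z))\<^sup>2 \<le> (cmod (poly \<Delta> z))\<^sup>2"
      using z by (simp add: norm_power)
    moreover have "poly (P $$ ab) z = (\<Sum>j<k. poly (Z $$ (a, j)) z * poly (A $$ (j, b)) z)"
      using ab by (simp add: P_def index_mult_mat_sum[OF Z A(1)] poly_sum del: index_mult_mat)
    ultimately show ?thesis using \<tau>_eq[OF z] by simp
  qed
  moreover have "z0 \<noteq> 0" using z0 by auto
  ultimately obtain e u where eu: "\<Delta> = e * u" "\<And>z. cmod z = 1 \<Longrightarrow> poly u z \<noteq> 0"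
    and dvd: "\<And>ab. ab \<in> {..<k} \<times> {..<k} \<Longrightarrow> e dvd P $$ ab"
    using divide_circle_zeros[OF \<Delta>_nz, of z0 "{..<k} \<times> {..<k}" "\<lambda>ab. P $$ ab" 2] by blast
  have e_nz: "e \<noteq> 0" "u \<noteq> 0" using \<Delta>_nz eu(1) by auto
  define Y where "Y = mat k k (\<lambda>ab. P $$ ab div e)"
  have Y: "Y \<in> carrier_mat k k" by (simp add: Y_def)
  have PY: "P = e \<cdot>\<^sub>m Y"
    using P by (intro eq_matI) (auto simp: Y_def dvd)
  have YG: "Y * G' j = G j * Y" for j
  proof (rule cancel)
    show "e \<cdot>\<^sub>m (Y * G' j) = e \<cdot>\<^sub>m (G j * Y)"
      using PG[of j] Y G[of j] G'[of j]
      by (simp add: PY mult_smult_assoc_mat[of _ k k _ k] mult_smult_distrib[of _ k k _ k])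
  qed (use Y G[of j] G'[of j] e_nz in auto)
  \<comment> \<open>Determinants in P Q = Z A Q yield det Y \<Delta> = det Z u^k, where
    \<open>u\<close> has no zeros on the circle. So the circle order of \<open>det Y\<close> is that
    of \<open>det Z\<close> minus that of \<open>\<Delta>\<close>, and the latter is
    positive.\<close>
  have "e ^ k * det Y * \<Delta> = det P * det Q"
    using Y by (simp add: PY \<Delta>_def)
  also have "\<dots> = det Z * det (A * Q)"
    using Z A(1) Q by (simp add: P_def det_mult[of _ k])
  also have "\<dots> = det Z * \<Delta> ^ k" by (simp add: A(3))
  finally have "det Y * \<Delta> = det Z * u ^ k" using e_nz by (simp add: eu(1) power_mult_distrib)
  then have dY: "det Y * \<Delta> = det Z * u ^ k" .
  then have dY_nz: "det Y \<noteq> 0" using dZ e_nz by auto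
  have "circle_order (det Y) + circle_order \<Delta> = circle_order (det Z) + k * circle_order u"
    using arg_cong[OF dY, of circle_order] dY_nz \<Delta>_nz dZ e_nz
    by (simp add: circle_order_mult circle_order_power)
  moreover have "circle_order u = 0" using eu(2) e_nz by (simp add: circle_order_eq_0_iff)
  moreover have "circle_order \<Delta> \<noteq> 0" using \<Delta>_z0 z0 \<Delta>_nz by (auto simp: circle_order_eq_0_iff)
  ultimately show ?thesis using Y YG dY_nz by (intro bexI[of _ Y]) auto
qed

lemma intertwiner_invertible_on_circle:
  fixes G G' :: "'j \<Rightarrow> complex poly mat" and q :: "'j \<Rightarrow> complex poly"
  assumes G: "\<And>j. G j \<in> carrier_mat k k" and G': "\<And>j. G' j \<in> carrier_mat k k"
    and q: "\<And>j z. cmod z = 1 \<Longrightarrow> poly (q j) z \<noteq> 0"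
    and uG: "\<And>j z. cmod z = 1 \<Longrightarrow> adjoint_mat (map_mat (\<lambda>p. poly p z) (G j)) * map_mat (\<lambda>p. poly p z) (G j) =
      of_real ((cmod (poly (q j) z))\<^sup>2) \<cdot>\<^sub>m 1\<^sub>m k"
    and uG': "\<And>j z. cmod z = 1 \<Longrightarrow> adjoint_mat (map_mat (\<lambda>p. poly p z) (G' j)) * map_mat (\<lambda>p. poly p z) (G' j) =
      of_real ((cmod (poly (q j) z))\<^sup>2) \<cdot>\<^sub>m 1\<^sub>m k"
    and Z: "Z \<in> carrier_mat k k" and ZG: "\<And>j. Z * G' j = G j * Z" and dZ: "det Z \<noteq> 0"
  shows "\<exists>Y\<in>carrier_mat k k. (\<forall>j. Y * G' j = G j * Y) \<and> det Y \<noteq> 0 \<and> (\<forall>z. cmod z = 1 \<longrightarrow> poly (det Y) z \<noteq> 0)"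
  using Z ZG dZ
proof (induction "circle_order (det Z)" arbitrary: Z rule: less_induct)
  case less
  show ?case
  proof (cases "\<forall>z. cmod z = 1 \<longrightarrow> poly (det Z) z \<noteq> 0")
    case False
    then obtain z0 where "cmod z0 = 1" "poly (det Z) z0 = 0" by auto
    have "\<exists>Y\<in>carrier_mat k k. (\<forall>j. Y * G' j = G j * Y) \<and> det Y \<noteq> 0 \<and> circle_order (det Y) < circle_order (det Z)"
      by (rule intertwiner_fewer_circle_zeros[where q = q and ?z0.0 = z0]) fact+
    then obtain Y where Y: "Y \<in> carrier_mat k k" "\<forall>j. Y * G' j = G j * Y" "det Y \<noteq> 0"
      "circle_order (det Y) < circle_order (det Z)" by blast
    show ?thesis by (rule less.hyps[OF Y(4,1) _ Y(3)]) (use Y(2) in simp)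
  qed (use less.prems in auto)
qed

section \<open>Polynomials in commuting operators\<close>

abbreviation clinear :: "('a::complex_vector \<Rightarrow> 'b::complex_vector) \<Rightarrow> bool" where
  "clinear \<equiv> Vector_Spaces.linear scaleC scaleC"

lemma clinear_iff:
  "clinear f \<longleftrightarrow> (\<forall>x y. f (x + y) = f x + f y) \<and> (\<forall>c x. f (c *\<^sub>C x) = c *\<^sub>C f x)"
  by (simp add: Vector_Spaces.linear_iff complex_vector.vector_space_axioms)

lemma clinear_add: "clinear f \<Longrightarrow> f (x + y) = f x + f y"
  and clinear_scale: "clinear f \<Longrightarrow> f (c *\<^sub>C x) = c *\<^sub>C f x"
  by (auto simp: clinear_iff)

lemma clinear_0: "clinear f \<Longrightarrow> f 0 = 0"
  using clinear_scale[of f 0 0] by simp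

lemma clinear_diff: "clinear f \<Longrightarrow> f (x - y) = f x - f y"
  using clinear_add[of f "x - y" y] by simp

lemma clinear_sum: "clinear f \<Longrightarrow> f (sum g A) = (\<Sum>i\<in>A. f (g i))"
  by (induction A rule: infinite_finite_induct) (simp_all add: clinear_0 clinear_add)

lemma clinear_id [simp]: "clinear id" and clinear_ident [simp]: "clinear (\<lambda>x. x)"
  by (auto simp: clinear_iff)

lemma clinear_compose: "clinear f \<Longrightarrow> clinear g \<Longrightarrow> clinear (\<lambda>x. f (g x))"
  by (auto simp: clinear_iff)

lemma clinear_comp: "clinear f \<Longrightarrow> clinear g \<Longrightarrow> clinear (f \<circ> g)"
  by (auto simp: clinear_iff)

lemma clinear_funpow:
  fixes f :: "'a::complex_vector \<Rightarrow> 'a"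
  shows "clinear f \<Longrightarrow> clinear (f ^^ n)"
  by (induction n) (auto simp: clinear_iff)

lemma clinear_plus: "clinear f \<Longrightarrow> clinear g \<Longrightarrow> clinear (\<lambda>x. f x + g x)"
  by (auto simp: clinear_iff complex_vector.scale_right_distrib)

lemma clinear_smult: "clinear f \<Longrightarrow> clinear (\<lambda>x. c *\<^sub>C f x)"
  by (auto simp: clinear_iff complex_vector.scale_right_distrib mult.commute)

lemma clinear_zero_fun: "clinear (\<lambda>x. 0)"
  by (auto simp: clinear_iff)

lemma clinear_sum_fun: "(\<And>i. i \<in> A \<Longrightarrow> clinear (f i)) \<Longrightarrow> clinear (\<lambda>x. \<Sum>i\<in>A. f i x)"
  by (induction A rule: infinite_finite_induct) (auto intro: clinear_plus clinear_zero_fun)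

lemma intertwine_funpow: "(\<And>x. S (T x) = T' (S x)) \<Longrightarrow> S ((T ^^ n) x) = (T' ^^ n) (S x)"
  by (induction n) simp_all

section \<open>Polynomials in a single operator\<close>

definition op_poly :: "complex poly \<Rightarrow> ('a::complex_vector \<Rightarrow> 'a) \<Rightarrow> 'a \<Rightarrow> 'a" where
  "op_poly c T x = (\<Sum>i\<le>degree c. coeff c i *\<^sub>C (T ^^ i) x)"

lemma op_poly_atMost:
  assumes "degree c \<le> n"
  shows "op_poly c T x = (\<Sum>i\<le>n. coeff c i *\<^sub>C (T ^^ i) x)"
  unfolding op_poly_def using assms by (intro sum.mono_neutral_left) (auto simp: coeff_eq_0)

lemma op_poly_0 [simp]: "op_poly 0 T x = 0"
  by (simp add: op_poly_def)

lemma op_poly_1 [simp]: "op_poly 1 T x = x"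
  by (simp add: op_poly_def)

lemma op_poly_add: "op_poly (p + q) T x = op_poly p T x + op_poly q T x"
proof -
  let ?n = "max (degree p) (degree q)"
  have "degree (p + q) \<le> ?n" by (rule degree_add_le) auto
  then show ?thesis
    by (simp add: op_poly_atMost[of _ ?n] complex_vector.scale_left_distrib sum.distrib)
qed

lemma op_poly_smult: "op_poly (Polynomial.smult c p) T x = c *\<^sub>C op_poly p T x"
  by (simp add: op_poly_atMost[of _ "degree p"] complex_vector.scale_sum_right)

lemma op_poly_minus: "op_poly (- p) T x = - op_poly p T x"
  by (simp add: op_poly_def sum_negf)

lemma op_poly_sum: "op_poly (\<Sum>i\<in>A. p i) T x = (\<Sum>i\<in>A. op_poly (p i) T x)"
  by (induction A rule: infinite_finite_induct) (simp_all add: op_poly_add)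

lemma clinear_op_poly: "clinear T \<Longrightarrow> clinear (op_poly p T)"
  unfolding op_poly_def by (intro clinear_sum_fun clinear_smult clinear_funpow)

lemma op_poly_pCons:
  assumes "clinear T"
  shows "op_poly (pCons a p) T x = a *\<^sub>C x + T (op_poly p T x)"
proof -
  have "op_poly (pCons a p) T x = (\<Sum>i\<le>Suc (degree p). coeff (pCons a p) i *\<^sub>C (T ^^ i) x)"
    by (rule op_poly_atMost) (rule degree_pCons_le)
  also have "\<dots> = a *\<^sub>C x + (\<Sum>i\<le>degree p. coeff p i *\<^sub>C T ((T ^^ i) x))"
    by (simp add: sum.atMost_Suc_shift del: sum.atMost_Suc)
  also have "(\<Sum>i\<le>degree p. coeff p i *\<^sub>C T ((T ^^ i) x)) = T (op_poly p T x)"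
    by (simp add: op_poly_def clinear_sum[OF assms] clinear_scale[OF assms])
  finally show ?thesis .
qed

lemma op_poly_monom: "op_poly (monom c n) T x = c *\<^sub>C (T ^^ n) x"
proof -
  have "op_poly (monom c n) T x = (\<Sum>i\<le>n. coeff (monom c n) i *\<^sub>C (T ^^ i) x)"
    by (rule op_poly_atMost) (rule degree_monom_le)
  also have "\<dots> = (\<Sum>i\<in>{n}. c *\<^sub>C (T ^^ i) x)"
    by (rule sum.mono_neutral_cong_right) auto
  finally show ?thesis by simp
qed

lemma op_poly_intertwine:
  assumes "clinear S" "\<And>x. S (T x) = T' (S x)"
  shows "S (op_poly p T x) = op_poly p T' (S x)"
  by (simp add: op_poly_def clinear_sum[OF assms(1)] clinear_scale[OF assms(1)]
      intertwine_funpow[of S T T', OF assms(2)])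

lemma op_poly_mult:
  assumes T: "clinear T"
  shows "op_poly (p * q) T x = op_poly p T (op_poly q T x)"
proof (induction p)
  case 0
  then show ?case by (simp)
next
  case (pCons a p)
  have "op_poly (pCons a p * q) T x = op_poly (Polynomial.smult a q) T x + op_poly (pCons 0 (p * q)) T x"
    by (simp add: op_poly_add)
  then show ?case by (simp add: op_poly_smult op_poly_pCons[OF T] pCons.IH)
qed

text \<open>Singles out one factor of a product of denominators, so that it can be cleared at its
  own index.\<close>

lemma op_poly_prod_mem:
  assumes "clinear T" "finite A" "a \<in> A"
  shows "op_poly (\<Prod>i\<in>A. p i) T x = op_poly (\<Prod>i\<in>A-{a}. p i) T (op_poly (p a) T x)"
  using prod.remove[OF assms(2,3), of p]
  by (simp add: op_poly_mult[OF assms(1), symmetric] mult.commute)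

lemma funpow_commute_funpow:
  assumes "f \<circ> g = g \<circ> f"
  shows "(f ^^ n) \<circ> (g ^^ m) = (g ^^ m) \<circ> (f ^^ n)"
proof -
  have "f (g x) = g (f x)" for x using assms by (metis comp_apply)
  then have "f ((g ^^ m) x) = (g ^^ m) (f x)" for x by (rule intertwine_funpow)
  then have "(g ^^ m) ((f ^^ n) x) = (f ^^ n) ((g ^^ m) x)" for x by (intro intertwine_funpow) simp
  then show ?thesis by auto
qed

section \<open>Polynomials in a commuting tuple\<close>

locale commuting_family =
  fixes V :: "'n::finite \<Rightarrow> 'a::complex_vector \<Rightarrow> 'a"
  assumes commute: "V i \<circ> V j = V j \<circ> V i"
    and lin: "clinear (V i)"
begin

lemma commute': "V i (V j x) = V j (V i x)"
  using commute by (metis comp_apply)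

text \<open>\<open>monom_op\<close> folds over all indices at once; folding over a subset makes
  induction on the index set possible.\<close>

definition partial_monom :: "'n set \<Rightarrow> ('n \<Rightarrow>\<^sub>0 nat) \<Rightarrow> 'a \<Rightarrow> 'a" where
  "partial_monom A m = Finite_Set.fold (\<lambda>i T. (V i ^^ Poly_Mapping.lookup m i) \<circ> T) id A"

lemma partial_monom_empty: "partial_monom {} m = id"
  by (simp add: partial_monom_def)

lemma partial_monom_insert:
  assumes "i \<notin> A"
  shows "partial_monom (insert i A) m = (V i ^^ Poly_Mapping.lookup m i) \<circ> partial_monom A m"
proof -
  define f where "f = (\<lambda>i T. (V i ^^ Poly_Mapping.lookup m i) \<circ> (T :: 'a \<Rightarrow> 'a))"
  have "f j \<circ> f i = f i \<circ> f j" for i j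
    using funpow_commute_funpow[OF commute[of j i], of "Poly_Mapping.lookup m j" "Poly_Mapping.lookup m i"]
    by (intro ext) (simp add: f_def comp_assoc[symmetric])
  then interpret comp_fun_commute_on UNIV f by unfold_locales
  have "Finite_Set.fold f id (insert i A) = f i (Finite_Set.fold f id A)"
    using assms by (intro fold_insert) auto
  then show ?thesis by (simp add: partial_monom_def f_def)
qed

lemma monom_op_partial: "monom_op V m = partial_monom UNIV m"
  by (simp add: monom_op_def partial_monom_def)

lemma partial_monom_intertwine:
  assumes "commuting_family W" "\<And>i x. S (V i x) = W i (S x)"
  shows "S (partial_monom A m x) = commuting_family.partial_monom W A m (S x)"
proof -
  interpret W: commuting_family W by fact
  show ?thesis
  proof (induction A arbitrary: x rule: infinite_finite_induct)
    case (insert i A)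
    then show ?case
      by (simp add: partial_monom_insert W.partial_monom_insert intertwine_funpow[of S "V i" "W i", OF assms(2)])
  qed (simp_all add: partial_monom_empty W.partial_monom_empty)
qed

lemma monom_op_intertwine:
  assumes "commuting_family W" "\<And>i x. S (V i x) = W i (S x)"
  shows "S (monom_op V m x) = monom_op W m (S x)"
  using partial_monom_intertwine[OF assms]
  by (simp add: monom_op_partial commuting_family.monom_op_partial[OF assms(1)])

lemma clinear_monom_op: "clinear (monom_op V m)"
proof -
  have "clinear (partial_monom A m)" for A
  proof (induction A rule: infinite_finite_induct)
    case (insert i A)
    show ?case unfolding partial_monom_insert[OF insert.hyps(2)]
      by (rule clinear_comp[OF clinear_funpow[OF lin] insert.IH])
  qed (simp_all add: partial_monom_empty)
  then show ?thesis by (simp add: monom_op_partial)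
qed

lemma monom_op_add: "monom_op V (m + n) x = monom_op V m (monom_op V n x)"
proof -
  have "partial_monom A (m + n) x = partial_monom A m (partial_monom A n x)" for A x
  proof (induction A arbitrary: x rule: infinite_finite_induct)
    case (insert i A)
    have "partial_monom A m ((V i ^^ Poly_Mapping.lookup n i) y) =
        (V i ^^ Poly_Mapping.lookup n i) (partial_monom A m y)" for y
      by (rule partial_monom_intertwine[OF commuting_family_axioms, symmetric])
        (metis commute' intertwine_funpow)
    then show ?case
      by (simp add: partial_monom_insert[OF insert.hyps(2)] lookup_add funpow_add insert.IH)
  qed (simp_all add: partial_monom_empty)
  then show ?thesis by (simp add: monom_op_partial)
qed

lemma monom_op_single: "monom_op V (Poly_Mapping.single i n) = V i ^^ n"
proof -
  have "partial_monom A (Poly_Mapping.single i n) = (if i \<in> A then V i ^^ n else id)" for A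
    by (induction A rule: infinite_finite_induct)
      (auto simp: partial_monom_empty partial_monom_insert lookup_single when_def)
  then show ?thesis by (simp add: monom_op_partial)
qed

lemma poly_op_superset:
  assumes "finite K" "Poly_Mapping.keys p \<subseteq> K"
  shows "poly_op p V x = (\<Sum>m\<in>K. Poly_Mapping.lookup p m *\<^sub>C monom_op V m x)"
  unfolding poly_op_def using assms by (intro sum.mono_neutral_left) (auto simp: in_keys_iff)

lemma poly_op_add: "poly_op (p + q) V x = poly_op p V x + poly_op q V x"
proof -
  let ?K = "Poly_Mapping.keys p \<union> Poly_Mapping.keys q"
  have "Poly_Mapping.keys (p + q) \<subseteq> ?K" by (rule keys_add)
  then show ?thesis
    by (simp add: poly_op_superset[of ?K] lookup_add complex_vector.scale_left_distrib sum.distrib)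
qed

lemma poly_op_0 [simp]: "poly_op 0 V x = 0"
  by (simp add: poly_op_def)

lemma poly_op_uminus: "poly_op (- p) V x = - poly_op p V x"
  using poly_op_add[of p "-p" x] by (simp add: eq_neg_iff_add_eq_0 add.commute)

lemma poly_op_diff: "poly_op (p - q) V x = poly_op p V x - poly_op q V x"
  using poly_op_add[of p "-q" x] by (simp add: poly_op_uminus)

lemma poly_op_sum: "poly_op (\<Sum>i\<in>A. p i) V x = (\<Sum>i\<in>A. poly_op (p i) V x)"
  by (induction A rule: infinite_finite_induct) (simp_all add: poly_op_add)

lemma poly_op_single: "poly_op (Poly_Mapping.single m c) V x = c *\<^sub>C monom_op V m x"
  by (cases "c = 0") (simp_all add: poly_op_def)

lemma clinear_poly_op: "clinear (poly_op p V)"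
  unfolding poly_op_def by (intro clinear_sum_fun clinear_smult clinear_monom_op)

lemma poly_mapping_sum_single: "p = (\<Sum>m\<in>Poly_Mapping.keys p. Poly_Mapping.single m (Poly_Mapping.lookup p m))"
  by (rule poly_mapping_eqI) (auto simp: lookup_sum lookup_single when_def in_keys_iff)

lemma poly_op_mult: "poly_op (p * q) V x = poly_op p V (poly_op q V x)"
proof -
  have single: "poly_op (Poly_Mapping.single m a * q) V x = a *\<^sub>C monom_op V m (poly_op q V x)" for m a
  proof -
    have "poly_op (Poly_Mapping.single m a * q) V x =
      poly_op (Poly_Mapping.single m a * (\<Sum>n\<in>Poly_Mapping.keys q. Poly_Mapping.single n (Poly_Mapping.lookup q n))) V x"
      using poly_mapping_sum_single[of q] by simp
    also have "\<dots> = (\<Sum>n\<in>Poly_Mapping.keys q. (a * Poly_Mapping.lookup q n) *\<^sub>C monom_op V (m + n) x)"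
      by (simp add: sum_distrib_left mult_single poly_op_sum poly_op_single)
    also have "\<dots> = a *\<^sub>C monom_op V m (poly_op q V x)"
      by (simp add: poly_op_def clinear_sum[OF clinear_monom_op] clinear_scale[OF clinear_monom_op]
          monom_op_add complex_vector.scale_sum_right)
    finally show ?thesis .
  qed
  have "poly_op (p * q) V x =
      poly_op ((\<Sum>m\<in>Poly_Mapping.keys p. Poly_Mapping.single m (Poly_Mapping.lookup p m)) * q) V x"
    using poly_mapping_sum_single[of p] by simp
  also have "\<dots> = poly_op p V (poly_op q V x)"
    by (simp add: sum_distrib_right poly_op_sum single) (simp add: poly_op_def)
  finally show ?thesis .
qed

lemma poly_op_1 [simp]: "poly_op 1 V x = x"
proof -
  \<comment> \<open>\<open>Poly_Mapping.single i 0\<close> is the zero exponent for every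
    \<open>i\<close>, so an arbitrary index serves.\<close>
  have "monom_op V 0 = id" using monom_op_single[of undefined 0] by simp
  then show ?thesis using poly_op_single[of 0 1 x] by simp
qed

lemma poly_op_intertwine:
  assumes "commuting_family W" "clinear S" "\<And>i x. S (V i x) = W i (S x)"
  shows "S (poly_op p V x) = poly_op p W (S x)"
  by (simp add: poly_op_def clinear_sum[OF assms(2)] clinear_scale[OF assms(2)]
      monom_op_intertwine[OF assms(1,3)])

lemma poly_op_mem:
  assumes N: "csubspace N" "\<And>i x. x \<in> N \<Longrightarrow> V i x \<in> N" and x: "x \<in> N"
  shows "poly_op p V x \<in> N"
proof -
  have pow: "y \<in> N \<Longrightarrow> (V i ^^ n) y \<in> N" for i n y by (induction n) (auto intro: N(2))
  have "partial_monom A m x \<in> N" for A m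
    by (induction A rule: infinite_finite_induct) (auto simp: partial_monom_empty partial_monom_insert x pow)
  then show ?thesis unfolding poly_op_def monom_op_partial
    by (intro complex_vector.subspace_sum[OF N(1)] complex_vector.subspace_scale[OF N(1)])
qed

lemma poly_op_op_commute: "poly_op p V (V i x) = V i (poly_op p V x)"
  by (rule poly_op_intertwine[OF commuting_family_axioms lin, symmetric]) (rule commute')

end

text \<open>The map C[z] -> C[x] with z sent to x_i. It turns coefficients in C[z] into elements of
  C[x], to which primeness of \<open>Ann V\<close> applies.\<close>

definition embed_poly :: "'n \<Rightarrow> complex poly \<Rightarrow> 'n cpoly" where
  "embed_poly i c = (\<Sum>j\<le>degree c. Poly_Mapping.single (Poly_Mapping.single i j) (coeff c j))"

definition cvar :: "'n \<Rightarrow> 'n cpoly" where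
  "cvar i = Poly_Mapping.single (Poly_Mapping.single i 1) 1"

context commuting_family
begin

lemma poly_op_embed_poly: "poly_op (embed_poly i c) V x = op_poly c (V i) x"
  by (simp add: embed_poly_def poly_op_sum poly_op_single monom_op_single op_poly_def)

lemma poly_op_cvar: "poly_op (cvar i) V x = V i x"
  by (simp add: cvar_def poly_op_single monom_op_single)

end

lemma prime_AnnD:
  assumes "primeideal (Ann V) ring_of_type_algebra" "p * q \<in> Ann V"
  shows "p \<in> Ann V \<or> q \<in> Ann V"
  using primeideal.I_prime[OF assms(1), of p q] assms(2)
  by (simp add: ring_of_type_algebra_def)

lemma prime_Ann_nontrivial:
  assumes "primeideal (Ann V) ring_of_type_algebra"
  shows "Ann V \<noteq> UNIV"
  using primeideal.I_notcarr[OF assms] by (simp add: ring_of_type_algebra_def)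

section \<open>Bounded operators on complex Hilbert spaces\<close>

lemma cinner_scaleC_right: "cinner x (c *\<^sub>C y) = cnj c * cinner x y"
  by (metis cinner_commute cinner_scaleC_left complex_cnj_mult)

lemma cinner_add_right: "cinner x (y + z) = cinner x y + cinner x z"
  by (metis cinner_commute cinner_add_left complex_cnj_add)

lemma cinner_diff_left: "cinner (x - y) z = cinner x z - cinner y z"
  using cinner_add_left[of "x - y" y z] by simp

lemma cinner_diff_right: "cinner x (y - z) = cinner x y - cinner x z"
  using cinner_add_right[of x "y - z" z] by simp

lemma cinner_zero_right [simp]: "cinner x 0 = 0"
  using cinner_diff_right[of x 0 0] by simp

lemma norm_scaleC: "norm (c *\<^sub>C x) = cmod c * norm (x :: 'a::complex_hilbert_space)"
proof -
  have "complex_of_real ((norm (c *\<^sub>C x))\<^sup>2) = c * cnj c * complex_of_real ((norm x)\<^sup>2)"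
    by (simp only: cinner_self[symmetric] cinner_scaleC_left cinner_scaleC_right mult_ac)
  also have "\<dots> = complex_of_real ((cmod c * norm x)\<^sup>2)"
    by (simp add: complex_norm_square[symmetric] power_mult_distrib)
  finally have "(norm (c *\<^sub>C x))\<^sup>2 = (cmod c * norm x)\<^sup>2" by (simp only: of_real_eq_iff)
  then show ?thesis by (simp add: power2_eq_iff_nonneg)
qed

lemma cauchy_schwarz: "cmod (cinner x y) \<le> norm x * norm (y :: 'a::complex_hilbert_space)"
proof (cases "y = 0")
  case False
  define c where "c = cinner x y / complex_of_real ((norm y)\<^sup>2)"
  have ny: "complex_of_real ((norm y)\<^sup>2) \<noteq> 0" using False by simp
  have cy: "c * complex_of_real ((norm y)\<^sup>2) = cinner x y"
    unfolding c_def using ny by (simp del: of_real_power)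
  have cyx: "cinner y x = cnj c * complex_of_real ((norm y)\<^sup>2)"
    by (subst cinner_commute) (simp only: cy[symmetric] complex_cnj_mult complex_cnj_complex_of_real)
  have "complex_of_real ((norm (x - c *\<^sub>C y))\<^sup>2) =
      cinner x x - cnj c * cinner x y - c * cinner y x + c * cnj c * cinner y y"
    by (simp add: cinner_self[symmetric] cinner_diff_left cinner_diff_right cinner_scaleC_left
        cinner_scaleC_right algebra_simps del: of_real_power)
  also have "c * cnj c * cinner y y = cnj c * cinner x y"
    by (simp only: cinner_self cy[symmetric] mult_ac)
  also have "c * cinner y x = c * cnj c * complex_of_real ((norm y)\<^sup>2)"
    by (simp only: cyx mult.assoc)
  also have "c * cnj c * complex_of_real ((norm y)\<^sup>2) = complex_of_real ((cmod c)\<^sup>2 * (norm y)\<^sup>2)"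
    by (simp only: complex_norm_square[symmetric] of_real_mult)
  finally have "complex_of_real ((norm (x - c *\<^sub>C y))\<^sup>2) = complex_of_real ((norm x)\<^sup>2 - (cmod c)\<^sup>2 * (norm y)\<^sup>2)"
    by (simp add: cinner_self)
  then have "(norm (x - c *\<^sub>C y))\<^sup>2 = (norm x)\<^sup>2 - (cmod c)\<^sup>2 * (norm y)\<^sup>2"
    by (simp only: of_real_eq_iff)
  then have "(cmod c * norm y)\<^sup>2 \<le> (norm x)\<^sup>2"
    using zero_le_power2[of "norm (x - c *\<^sub>C y)"] by (simp add: power_mult_distrib)
  then have "cmod c * norm y \<le> norm x" by (rule power2_le_imp_le) simp
  then have "cmod c * norm y * norm y \<le> norm x * norm y" by (rule mult_right_mono) simp
  moreover have "cmod (cinner x y) = cmod c * norm y * norm y"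
    unfolding cy[symmetric] by (simp add: norm_mult power2_eq_square norm_power)
  ultimately show ?thesis by simp
qed simp

lemma bounded_clinearD:
  assumes "bounded_clinear S"
  shows "clinear S" "bounded_linear S"
proof -
  show c: "clinear S" using assms by (simp add: bounded_clinear_def)
  from assms obtain B where "\<And>x. norm (S x) \<le> B * norm x" by (auto simp: bounded_clinear_def)
  then show "bounded_linear S"
    by (intro bounded_linear_intro[of S B])
      (auto simp: clinear_add[OF c] scaleR_scaleC clinear_scale[OF c] mult.commute)
qed

lemma bounded_clinearI:
  assumes "clinear S" "bounded_linear S"
  shows "bounded_clinear S"
proof -
  obtain B where "\<And>x. norm (S x) \<le> norm x * B" using bounded_linear.bounded[OF assms(2)] by blast
  then show ?thesis using assms(1) unfolding bounded_clinear_def by (auto simp: mult.commute)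
qed

lemma bounded_clinear_continuous: "bounded_clinear S \<Longrightarrow> continuous_on A S"
  by (simp add: bounded_clinearD(2) linear_continuous_on)

lemma bounded_clinear_compose:
  assumes "bounded_clinear S" "bounded_clinear R"
  shows "bounded_clinear (\<lambda>x. S (R x))"
  by (rule bounded_clinearI[OF clinear_compose[OF assms[THEN bounded_clinearD(1)]]
        bounded_linear_compose[OF assms[THEN bounded_clinearD(2)]]])

lemma bounded_clinear_sum:
  assumes "\<And>i. i \<in> A \<Longrightarrow> bounded_clinear (f i)"
  shows "bounded_clinear (\<lambda>x. \<Sum>i\<in>A. f i x)"
  by (rule bounded_clinearI[OF clinear_sum_fun[OF bounded_clinearD(1)[OF assms]]
        bounded_linear_sum[OF bounded_clinearD(2)[OF assms]]])

lemma bounded_clinear_smult: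
  assumes "bounded_clinear f"
  shows "bounded_clinear (\<lambda>x. c *\<^sub>C f x)"
proof -
  obtain B where B: "\<And>x. norm (f x) \<le> B * norm x" using assms by (auto simp: bounded_clinear_def)
  have "norm (c *\<^sub>C f x) \<le> (cmod c * B) * norm x" for x
    using mult_left_mono[OF B[of x], of "cmod c"] by (simp add: norm_scaleC mult.assoc)
  then show ?thesis unfolding bounded_clinear_def
    using clinear_smult[OF bounded_clinearD(1)[OF assms]] by blast
qed

lemma bounded_clinear_id: "bounded_clinear (\<lambda>x. x)"
  unfolding bounded_clinear_def by (auto intro: exI[of _ 1])

lemma bounded_clinear_isometry:
  assumes "clinear f" "\<And>x. norm (f x) = norm x"
  shows "bounded_clinear f"
  unfolding bounded_clinear_def using assms by (auto intro!: exI[of _ 1])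

lemma bounded_clinear_funpow:
  fixes f :: "'a::complex_hilbert_space \<Rightarrow> 'a"
  assumes "bounded_clinear f"
  shows "bounded_clinear (f ^^ n)"
proof (induction n)
  case 0
  then show ?case using bounded_clinear_id by (simp add: id_def)
next
  case (Suc n)
  then show ?case using bounded_clinear_compose[OF assms Suc.IH] by (simp add: o_def)
qed

lemma bounded_clinear_op_poly:
  assumes "bounded_clinear T"
  shows "bounded_clinear (op_poly c T)"
  unfolding op_poly_def
  by (intro bounded_clinear_sum bounded_clinear_smult bounded_clinear_funpow assms)

lemma closed_agreement:
  assumes "bounded_clinear S" "bounded_clinear R"
  shows "closed {x. S x = R x}"
  using assms by (intro closed_Collect_eq bounded_clinear_continuous)

text \<open>A vector \<open>g\<close> outside \<open>N\<close> has positive distance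
  \<open>d\<close> from \<open>N\<close>, hence
  \<open>cmod c * d \<le> norm (x + c *\<^sub>C g)\<close> for \<open>x\<close> in \<open>N\<close>;
  the coefficients along a convergent sequence are therefore Cauchy.\<close>

lemma closed_plus_cspan_singleton:
  fixes N :: "'a::complex_hilbert_space set"
  assumes N: "csubspace N" "closed N"
  shows "closed {y. \<exists>c. y - c *\<^sub>C g \<in> N}"
proof (cases "g \<in> N")
  case True
  have "{y. \<exists>c. y - c *\<^sub>C g \<in> N} = N"
  proof
    show "{y. \<exists>c. y - c *\<^sub>C g \<in> N} \<subseteq> N"
    proof
      fix y assume "y \<in> {y. \<exists>c. y - c *\<^sub>C g \<in> N}"
      then obtain c where "y - c *\<^sub>C g \<in> N" by auto
      then have "(y - c *\<^sub>C g) + c *\<^sub>C g \<in> N"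
        using True by (intro complex_vector.subspace_add[OF N(1)] complex_vector.subspace_scale[OF N(1)])
      then show "y \<in> N" by simp
    qed
    show "N \<subseteq> {y. \<exists>c. y - c *\<^sub>C g \<in> N}" by (auto intro: exI[of _ 0])
  qed
  then show ?thesis using N by simp
next
  case False
  obtain d where d: "d > 0" "\<And>x. x \<in> N \<Longrightarrow> d \<le> dist g x"
  proof -
    have "open (- N)" "g \<in> - N" using N False by auto
    then obtain d where "d > 0" "ball g d \<subseteq> - N" by (metis open_contains_ball)
    moreover from this have "d \<le> dist g x" if "x \<in> N" for x
      using that by (meson ComplD mem_ball not_less subsetD)
    ultimately show thesis by (intro that)
  qed
  have est: "cmod c * d \<le> norm (x + c *\<^sub>C g)" if x: "x \<in> N" for x c
  proof (cases "c = 0")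
    case False
    define x' where "x' = - (1 / c) *\<^sub>C x"
    have "x' \<in> N" unfolding x'_def using x by (intro complex_vector.subspace_scale[OF N(1)])
    then have "d \<le> norm (g - x')" using d(2) by (simp add: dist_norm)
    moreover have "x + c *\<^sub>C g = c *\<^sub>C (g - x')"
      using False by (simp add: x'_def complex_vector.scale_right_diff_distrib complex_vector.scale_right_distrib)
    ultimately show ?thesis by (simp add: norm_scaleC mult_left_mono)
  qed (use d in simp)
  show ?thesis
    unfolding closed_sequential_limits
  proof (intro allI impI, elim conjE)
    fix y l assume y: "\<forall>n. y n \<in> {y. \<exists>c. y - c *\<^sub>C g \<in> N}" and l: "y \<longlonglongrightarrow> l"
    then obtain c where c: "\<And>n. y n - c n *\<^sub>C g \<in> N" by (auto dest!: choice)
    have "Cauchy c"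
    proof (rule metric_CauchyI)
      fix e :: real assume "e > 0"
      then have "e * d > 0" using d by simp
      then obtain M where M: "\<And>m n. m \<ge> M \<Longrightarrow> n \<ge> M \<Longrightarrow> dist (y m) (y n) < e * d"
        using LIMSEQ_imp_Cauchy[OF l] unfolding Cauchy_def by blast
      have "dist (c m) (c n) < e" if "m \<ge> M" "n \<ge> M" for m n
      proof -
        have "(y m - c m *\<^sub>C g) - (y n - c n *\<^sub>C g) \<in> N" by (intro complex_vector.subspace_diff[OF N(1)] c)
        from est[OF this, of "c m - c n"] have "cmod (c m - c n) * d \<le> norm (y m - y n)"
          by (simp add: complex_vector.scale_left_diff_distrib)
        also have "\<dots> < e * d" using M[OF that] by (simp add: dist_norm)
        finally show ?thesis using d by (simp add: dist_norm)
      qed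
      then show "\<exists>M. \<forall>m\<ge>M. \<forall>n\<ge>M. dist (c m) (c n) < e" by blast
    qed
    then obtain c0 where c0: "c \<longlonglongrightarrow> c0" using Cauchy_convergent convergent_def by blast
    have "bounded_linear (\<lambda>c. c *\<^sub>C g)"
      by (intro bounded_linear_intro[of _ "norm g"])
        (auto simp: complex_vector.scale_left_distrib scaleR_scaleC norm_scaleC scaleR_conv_of_real)
    from bounded_linear.tendsto[OF this c0] have "(\<lambda>n. y n - c n *\<^sub>C g) \<longlonglongrightarrow> l - c0 *\<^sub>C g"
      by (intro tendsto_diff l)
    from closed_sequentially[OF N(2) c this] have "l - c0 *\<^sub>C g \<in> N" .
    then show "l \<in> {y. \<exists>c. y - c *\<^sub>C g \<in> N}" by auto
  qed
qed

lemma closed_plus_finite_span: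
  fixes N :: "'a::complex_hilbert_space set"
  assumes "finite F" and N: "csubspace N" "closed N"
  shows "closed (cspan (N \<union> F))"
  using assms(1)
proof (induction F rule: finite_induct)
  case empty
  have "cspan N = N" using N(1) by (simp only: complex_vector.span_eq_iff)
  then show ?case using N by (simp only: Un_empty_right)
next
  case (insert g F)
  have "cspan (N \<union> insert g F) = cspan (insert g (N \<union> F))" by simp
  also have "\<dots> = {y. \<exists>c. y - c *\<^sub>C g \<in> cspan (N \<union> F)}" by (rule complex_vector.span_insert)
  finally show ?case
    using closed_plus_cspan_singleton[OF complex_vector.subspace_span insert.IH] by simp
qed

lemma closure_csubspace:
  fixes N :: "'a::complex_hilbert_space set"
  assumes N: "csubspace N"
  shows "csubspace (closure N)"
proof (rule complex_vector.subspaceI)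
  show "0 \<in> closure N" using complex_vector.subspace_0[OF N] closure_subset by blast
  fix x y c assume "x \<in> closure N"
  then obtain f where f: "\<And>n. f n \<in> N" "f \<longlonglongrightarrow> x" by (auto simp: closure_sequential)
  show "c *\<^sub>C x \<in> closure N"
  proof -
    have "(\<lambda>n. c *\<^sub>C f n) \<longlonglongrightarrow> c *\<^sub>C x"
      by (rule bounded_linear.tendsto[OF bounded_clinearD(2)[OF bounded_clinear_smult[OF bounded_clinear_id]] f(2)])
    then show ?thesis unfolding closure_sequential
      by (intro exI[of _ "\<lambda>n. c *\<^sub>C f n"]) (simp add: f(1) complex_vector.subspace_scale[OF N])
  qed
  assume "y \<in> closure N"
  then obtain g where g: "\<And>n. g n \<in> N" "g \<longlonglongrightarrow> y" by (auto simp: closure_sequential)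
  then show "x + y \<in> closure N" unfolding closure_sequential
    by (intro exI[of _ "\<lambda>n. f n + g n"])
      (simp add: f g(1) tendsto_add[OF f(2) g(2)] complex_vector.subspace_add[OF N])
qed

lemma closure_invariant:
  assumes "bounded_clinear S" "\<And>x. x \<in> N \<Longrightarrow> S x \<in> N" "x \<in> closure N"
  shows "S x \<in> closure N"
proof -
  obtain f where f: "\<And>n. f n \<in> N" "f \<longlonglongrightarrow> x" using assms(3) by (auto simp: closure_sequential)
  have "(\<lambda>n. S (f n)) \<longlonglongrightarrow> S x"
    by (rule bounded_linear.tendsto[OF bounded_clinearD(2)[OF assms(1)] f(2)])
  then show ?thesis unfolding closure_sequential
    by (intro exI[of _ "\<lambda>n. S (f n)"]) (simp add: f(1) assms(2))
qed

section \<open>Coordinates with respect to a shift\<close>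

lemma sums_truncate:
  fixes s :: "nat \<Rightarrow> 'a::real_normed_vector"
  assumes "s sums a"
  shows "(\<lambda>j. if j < n then 0 else s j) sums (a - (\<Sum>j<n. s j))"
proof -
  have "(\<lambda>j. if j \<in> {..<n} then s j else 0) sums (\<Sum>j<n. s j)"
    by (rule sums_If_finite_set) simp
  from sums_diff[OF assms this] have "(\<lambda>j. s j - (if j \<in> {..<n} then s j else 0)) sums (a - (\<Sum>j<n. s j))" .
  moreover have "(\<lambda>j. s j - (if j \<in> {..<n} then s j else 0)) = (\<lambda>j. if j < n then 0 else s j)"
    by auto
  ultimately show ?thesis by simp
qed

locale ell2_model =
  fixes k :: nat and U :: "'a::complex_hilbert_space \<Rightarrow> nat \<Rightarrow> nat \<Rightarrow> complex"
  assumes unitary: "unitary_ell2 k U"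
begin

lemma U_add: "U (x + y) j m = U x j m + U y j m"
  and U_scale: "U (c *\<^sub>C x) j m = c * U x j m"
  and U_cinner: "(\<lambda>j. \<Sum>m<k. U x j m * cnj (U y j m)) sums cinner x y"
  and U_bij: "bij_betw U UNIV (ell2 k)"
  using unitary by (auto simp: unitary_ell2_def)

lemma U_zero: "U 0 j m = 0"
  using U_add[of 0 0 j m] by simp

lemma U_diff: "U (x - y) j m = U x j m - U y j m"
  using U_add[of "x - y" y j m] by simp

lemma U_sum: "U (\<Sum>i\<in>A. f i) j m = (\<Sum>i\<in>A. U (f i) j m)"
  by (induction A rule: infinite_finite_induct) (simp_all add: U_zero U_add)

lemma U_outside: "k \<le> m \<Longrightarrow> U x j m = 0"
  using bij_betwE[OF U_bij] by (auto simp: ell2_def)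

lemma U_eqI: "(\<And>j m. m < k \<Longrightarrow> U x j m = U y j m) \<Longrightarrow> x = y"
proof (rule injD[of U])
  assume *: "\<And>j m. m < k \<Longrightarrow> U x j m = U y j m"
  have "U x j m = U y j m" for j m by (cases "m < k") (simp_all add: * U_outside)
  then show "U x = U y" by blast
qed (use U_bij in \<open>auto simp: bij_betw_def\<close>)

lemma U_surj: "f \<in> ell2 k \<Longrightarrow> \<exists>x. U x = f"
  using U_bij unfolding bij_betw_def by (metis rangeE)

lemma norm_sums: "(\<lambda>j. \<Sum>m<k. (cmod (U x j m))\<^sup>2) sums (norm x)\<^sup>2"
proof -
  have "(\<lambda>j. complex_of_real (\<Sum>m<k. (cmod (U x j m))\<^sup>2)) sums complex_of_real ((norm x)\<^sup>2)"
    using U_cinner[of x x] unfolding cinner_self of_real_sum complex_norm_square by simp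
  then show ?thesis by (simp only: sums_of_real_iff)
qed

lemma coordinate_le: "cmod (U x j m) \<le> norm x"
proof (cases "m < k")
  case True
  have "(cmod (U x j m))\<^sup>2 \<le> (\<Sum>m<k. (cmod (U x j m))\<^sup>2)"
    using True by (intro member_le_sum) auto
  also have "\<dots> = (\<Sum>i\<in>{j}. \<Sum>m<k. (cmod (U x i m))\<^sup>2)" by simp
  also have "\<dots> \<le> suminf (\<lambda>i. \<Sum>m<k. (cmod (U x i m))\<^sup>2)"
    using norm_sums[of x] by (intro sum_le_suminf) (auto simp: sums_iff intro: sum_nonneg)
  also have "\<dots> = (norm x)\<^sup>2" using norm_sums[of x] by (simp add: sums_iff)
  finally show ?thesis by (rule power2_le_imp_le) simp
qed (simp add: U_outside)

lemma finite_support_ell2: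
  assumes "\<And>j m. k \<le> m \<Longrightarrow> f j m = 0" "\<And>j m. n \<le> j \<Longrightarrow> f j m = 0"
  shows "f \<in> ell2 k"
proof -
  have "summable (\<lambda>j. \<Sum>m<k. (cmod (f j m))\<^sup>2)"
    by (rule summable_finite[of "{..<n}"]) (auto simp: assms not_less)
  then show ?thesis using assms by (auto simp: ell2_def)
qed

text \<open>For \<open>a < k\<close> these are the constant vectors in the picture of H^2 tensor
  C^k: once a shift is present, an orthonormal basis of the kernel of its adjoint.\<close>

definition e :: "nat \<Rightarrow> 'a" where
  "e a = inv_into UNIV U (\<lambda>j m. if j = 0 \<and> m = a then 1 else 0)"

lemma U_e: "a < k \<Longrightarrow> U (e a) j m = (if j = 0 \<and> m = a then 1 else 0)"
proof -
  assume "a < k"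
  then have "(\<lambda>j m. if j = 0 \<and> m = a then 1 else 0) \<in> ell2 k"
    by (intro finite_support_ell2[of _ 1]) auto
  then have "(\<lambda>j m. if j = 0 \<and> m = a then 1 else 0) \<in> range U"
    using U_bij by (simp add: bij_betw_def)
  from f_inv_into_f[OF this] show ?thesis by (simp add: e_def)
qed

text \<open>The Taylor series of the \<open>a\<close>-th coordinate function. Power series form an
  integral domain in which polynomials of the shift act by multiplication, so algebra is available
  for all vectors, not only for rational ones.\<close>

definition fps_coord :: "'a \<Rightarrow> nat \<Rightarrow> complex fps" where
  "fps_coord x a = Abs_fps (\<lambda>j. U x j a)"

lemma fps_coord_nth [simp]: "fps_nth (fps_coord x a) j = U x j a"
  by (simp add: fps_coord_def)

lemma fps_coord_add: "fps_coord (x + y) a = fps_coord x a + fps_coord y a"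
  by (simp add: fps_eq_iff U_add)

lemma fps_coord_zero: "fps_coord 0 a = 0"
  by (simp add: fps_eq_iff U_zero)

lemma fps_coord_sum: "fps_coord (\<Sum>i\<in>A. f i) a = (\<Sum>i\<in>A. fps_coord (f i) a)"
  by (induction A rule: infinite_finite_induct) (simp_all add: fps_coord_zero fps_coord_add)

lemma fps_coord_eqI: "(\<And>a. a < k \<Longrightarrow> fps_coord x a = fps_coord y a) \<Longrightarrow> x = y"
  by (intro U_eqI) (metis fps_coord_nth)

end

locale shift_model = ell2_model k U for k and U :: "'a::complex_hilbert_space \<Rightarrow> nat \<Rightarrow> nat \<Rightarrow> complex" +
  fixes T :: "'a \<Rightarrow> 'a"
  assumes shift: "U (T x) = unilateral_shift (U x)"
begin

lemma U_T_0 [simp]: "U (T x) 0 m = 0" and U_T_Suc [simp]: "U (T x) (Suc j) m = U x j m"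
  by (simp_all add: shift unilateral_shift_def)

lemma clinear_T: "clinear T"
  unfolding clinear_iff
proof (intro conjI allI)
  fix x y show "T (x + y) = T x + T y"
  proof (rule U_eqI)
    fix j m show "U (T (x + y)) j m = U (T x + T y) j m" by (cases j) (simp_all add: U_add)
  qed
next
  fix c x show "T (c *\<^sub>C x) = c *\<^sub>C T x"
  proof (rule U_eqI)
    fix j m show "U (T (c *\<^sub>C x)) j m = U (c *\<^sub>C T x) j m" by (cases j) (simp_all add: U_scale)
  qed
qed

lemma cinner_T: "cinner (T x) (T y) = cinner x y"
proof -
  have "(\<lambda>j. \<Sum>m<k. U (T x) (Suc j) m * cnj (U (T y) (Suc j) m)) sums cinner x y"
    using U_cinner[of x y] by simp
  then have "(\<lambda>j. \<Sum>m<k. U (T x) j m * cnj (U (T y) j m)) sums (cinner x y + (\<Sum>m<k. U (T x) 0 m * cnj (U (T y) 0 m)))"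
    by (rule sums_Suc)
  then show ?thesis using U_cinner[of "T x" "T y"] sums_unique2 by fastforce
qed

lemma norm_T: "norm (T x) = norm x"
proof -
  have "complex_of_real ((norm (T x))\<^sup>2) = complex_of_real ((norm x)\<^sup>2)"
    by (simp only: cinner_self[symmetric] cinner_T)
  then have "(norm (T x))\<^sup>2 = (norm x)\<^sup>2" by (simp only: of_real_eq_iff)
  then show ?thesis by (simp add: power2_eq_iff_nonneg)
qed

lemma bounded_T: "bounded_clinear T"
  by (rule bounded_clinear_isometry[OF clinear_T norm_T])

lemma T_inject: "T x = T y \<Longrightarrow> x = y"
  by (metis clinear_diff[OF clinear_T] norm_T norm_eq_zero right_minus_eq)

lemma in_range_T_iff: "x \<in> range T \<longleftrightarrow> (\<forall>m<k. U x 0 m = 0)"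
proof
  assume 0: "\<forall>m<k. U x 0 m = 0"
  have "summable (\<lambda>j. \<Sum>m<k. (cmod (U x (Suc j) m))\<^sup>2)"
    using norm_sums[of x] by (subst summable_Suc_iff) (auto simp: sums_iff)
  then have "(\<lambda>j. U x (Suc j)) \<in> ell2 k" by (auto simp: ell2_def U_outside)
  then obtain y where y: "U y = (\<lambda>j. U x (Suc j))" using U_surj by blast
  have "x = T y"
  proof (rule U_eqI)
    fix j m assume "m < k" then show "U x j m = U (T y) j m" by (cases j) (simp_all add: 0 y)
  qed
  then show "x \<in> range T" by simp
qed auto

lemma U_T_pow: "U ((T ^^ n) x) j m = (if j < n then 0 else U x (j - n) m)"
proof (induction n arbitrary: j)
  case (Suc n)
  then show ?case by (cases j) simp_all
qed simp

lemma norm_T_pow: "norm ((T ^^ n) x) = norm x"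
  by (induction n) (simp_all add: norm_T)

lemma U_op_poly_e: "a < k \<Longrightarrow> U (op_poly c T (e a)) j m = (if m = a then coeff c j else 0)"
proof -
  assume a: "a < k"
  have "U (op_poly c T (e a)) j m = (\<Sum>i\<le>max j (degree c). coeff c i * (if j < i then 0 else U (e a) (j - i) m))"
    by (simp add: op_poly_atMost[of c "max j (degree c)"] U_sum U_scale U_T_pow)
  also have "\<dots> = (\<Sum>i\<le>max j (degree c). if i = j then (if m = a then coeff c i else 0) else 0)"
    using a by (intro sum.cong) (auto simp: U_e)
  finally show ?thesis by simp
qed

text \<open>The embedding of C[z]^k into the Hilbert space; values of \<open>v\<close> at indices
  from \<open>k\<close> on are ignored.\<close>

definition vec :: "(nat \<Rightarrow> complex poly) \<Rightarrow> 'a" where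
  "vec v = (\<Sum>a<k. op_poly (v a) T (e a))"

lemma U_vec: "a < k \<Longrightarrow> U (vec v) j a = coeff (v a) j"
  by (simp add: vec_def U_sum U_op_poly_e)

lemma vec_inject: "vec v = vec w \<Longrightarrow> a < k \<Longrightarrow> v a = w a"
  by (metis U_vec poly_eqI)

lemma op_poly_vec: "op_poly c T (vec v) = vec (\<lambda>a. c * v a)"
  by (simp add: vec_def clinear_sum[OF clinear_op_poly[OF clinear_T]] op_poly_mult[OF clinear_T])

lemma vec_add: "vec v + vec w = vec (\<lambda>a. v a + w a)"
  by (simp add: vec_def op_poly_add sum.distrib)

lemma vec_sum: "(\<Sum>i\<in>A. vec (v i)) = vec (\<lambda>a. \<Sum>i\<in>A. v i a)"
  unfolding vec_def op_poly_sum by (rule sum.swap)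

lemma vec_zero: "vec (\<lambda>a. 0) = 0"
  by (simp add: vec_def)

lemma e_eq_vec: "a < k \<Longrightarrow> e a = vec (\<lambda>b. if b = a then 1 else 0)"
  by (rule U_eqI) (auto simp: U_vec U_e)

lemma finite_support_vec:
  assumes "\<And>j a. d < j \<Longrightarrow> a < k \<Longrightarrow> U x j a = 0"
  shows "\<exists>v. x = vec v"
proof
  show "x = vec (\<lambda>a. \<Sum>j\<le>d. monom (U x j a) j)"
  proof (rule U_eqI)
    fix j m assume m: "m < k"
    have "coeff (\<Sum>i\<le>d. monom (U x i m) i) j = (\<Sum>i\<le>d. if i = j then U x i m else 0)"
      by (simp add: coeff_sum)
    also have "\<dots> = U x j m" using assms[OF _ m] by (auto simp: not_le)
    finally show "U x j m = U (vec (\<lambda>a. \<Sum>j\<le>d. monom (U x j a) j)) j m" using m by (simp add: U_vec)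
  qed
qed

lemma fps_coord_op_poly: "fps_coord (op_poly c T x) a = fps_of_poly c * fps_coord x a"
proof (induction c)
  case (pCons b c)
  have T: "fps_coord (T y) a = fps_X * fps_coord y a" for y
  proof (rule fps_ext)
    fix n show "fps_nth (fps_coord (T y) a) n = fps_nth (fps_X * fps_coord y a) n"
      by (cases n) simp_all
  qed
  have scale: "fps_coord (b *\<^sub>C x) a = fps_const b * fps_coord x a"
    by (simp add: fps_eq_iff U_scale)
  show ?case
    by (simp add: op_poly_pCons[OF clinear_T] fps_coord_add T scale pCons.IH fps_of_poly_pCons algebra_simps)
qed (simp add: fps_coord_zero)

text \<open>Power series over C form a domain, so a nonzero polynomial in \<open>T\<close> has
  trivial kernel wherever its zeros lie.\<close>

lemma op_poly_inject:
  assumes "c \<noteq> 0" "op_poly c T x = op_poly c T y"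
  shows "x = y"
proof (rule fps_coord_eqI)
  fix a
  have "fps_of_poly c * fps_coord x a = fps_of_poly c * fps_coord y a"
    by (simp only: fps_coord_op_poly[symmetric] assms(2))
  then show "fps_coord x a = fps_coord y a" using assms(1) by simp
qed

lemma op_poly_eq_0: "c \<noteq> 0 \<Longrightarrow> op_poly c T x = 0 \<Longrightarrow> x = 0"
  using op_poly_inject[of c x 0] by (simp add: clinear_0[OF clinear_op_poly[OF clinear_T]])

definition trunc :: "nat \<Rightarrow> 'a \<Rightarrow> 'a" where
  "trunc n x = (\<Sum>j<n. \<Sum>a<k. U x j a *\<^sub>C (T ^^ j) (e a))"

lemma U_trunc: "m < k \<Longrightarrow> U (trunc n x) j m = (if j < n then U x j m else 0)"
proof -
  assume m: "m < k"
  have "U (trunc n x) j m = (\<Sum>i<n. \<Sum>a<k. U x i a * (if j < i then 0 else U (e a) (j - i) m))"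
    by (simp add: trunc_def U_sum U_scale U_T_pow)
  also have "\<dots> = (\<Sum>i<n. if i = j then U x i m else 0)"
  proof (rule sum.cong)
    fix i
    have "(\<Sum>a<k. U x i a * (if j < i then 0 else U (e a) (j - i) m)) =
        (\<Sum>a<k. if a = m then (if i = j then U x i m else 0) else 0)"
      by (rule sum.cong) (auto simp: U_e)
    then show "(\<Sum>a<k. U x i a * (if j < i then 0 else U (e a) (j - i) m)) = (if i = j then U x i m else 0)"
      using m by simp
  qed simp
  finally show ?thesis by simp
qed

lemma trunc_tendsto: "(\<lambda>n. trunc n x) \<longlonglongrightarrow> x"
proof -
  let ?s = "\<lambda>j. \<Sum>m<k. (cmod (U x j m))\<^sup>2"
  have norm: "(norm (trunc n x - x))\<^sup>2 = (norm x)\<^sup>2 - (\<Sum>j<n. ?s j)" for n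
  proof -
    have "(\<lambda>j. \<Sum>m<k. (cmod (U (trunc n x - x) j m))\<^sup>2) = (\<lambda>j. if j < n then 0 else ?s j)"
      by (rule ext) (simp add: U_diff U_trunc)
    then have "(\<lambda>j. if j < n then 0 else ?s j) sums (norm (trunc n x - x))\<^sup>2"
      using norm_sums[of "trunc n x - x"] by simp
    then show ?thesis using sums_truncate[OF norm_sums[of x], of n] sums_unique2 by blast
  qed
  have "(\<lambda>n. (norm x)\<^sup>2 - (\<Sum>j<n. ?s j)) \<longlonglongrightarrow> (norm x)\<^sup>2 - (norm x)\<^sup>2"
    using norm_sums[of x] by (intro tendsto_diff tendsto_const) (simp add: sums_def)
  then have "(\<lambda>n. sqrt ((norm (trunc n x - x))\<^sup>2)) \<longlonglongrightarrow> sqrt 0"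
    by (intro tendsto_real_sqrt) (simp add: norm)
  then show ?thesis by (simp add: LIM_zero_iff tendsto_norm_zero_iff)
qed

lemma closed_csubspace_UNIV:
  assumes "csubspace M" "closed M" "\<And>j a. a < k \<Longrightarrow> (T ^^ j) (e a) \<in> M"
  shows "x \<in> M"
proof (rule closed_sequentially[OF assms(2) _ trunc_tendsto])
  show "trunc n x \<in> M" for n
    unfolding trunc_def using assms(3)
    by (intro complex_vector.subspace_sum[OF assms(1)] complex_vector.subspace_scale[OF assms(1)]) auto
qed

text \<open>Both operators intertwine \<open>T\<close> with \<open>T'\<close>, so they agree on all
  \<open>(T ^^ j) (e a)\<close>, and these vectors span a dense subspace.\<close>

lemma bounded_clinear_eqI:
  assumes "bounded_clinear S" "bounded_clinear R"
    and "\<And>x. S (T x) = T' (S x)" "\<And>x. R (T x) = T' (R x)" "\<And>a. a < k \<Longrightarrow> S (e a) = R (e a)"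
  shows "S x = R x"
proof -
  note S = bounded_clinearD(1)[OF assms(1)] and R = bounded_clinearD(1)[OF assms(2)]
  have "x \<in> {x. S x = R x}"
  proof (rule closed_csubspace_UNIV)
    show "csubspace {x. S x = R x}"
      by (rule complex_vector.subspaceI)
        (auto simp: clinear_add[OF S] clinear_add[OF R] clinear_scale[OF S] clinear_scale[OF R]
          clinear_0[OF S] clinear_0[OF R])
    show "(T ^^ j) (e a) \<in> {x. S x = R x}" if "a < k" for j a
      using assms(5)[OF that] by (simp add: intertwine_funpow[of S T T', OF assms(3)]
          intertwine_funpow[of R T T', OF assms(4)])
  qed (rule closed_agreement[OF assms(1,2)])
  then show ?thesis by simp
qed

lemma cinner_T_pow_e: "a < k \<Longrightarrow> cinner x ((T ^^ n) (e a)) = U x n a"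
proof -
  assume a: "a < k"
  have "(\<lambda>j. \<Sum>m<k. U x j m * cnj (U ((T ^^ n) (e a)) j m)) = (\<lambda>j. if j = n then U x n a else 0)"
  proof
    fix j
    have "(\<Sum>m<k. U x j m * cnj (U ((T ^^ n) (e a)) j m)) = (\<Sum>m<k. if m = a then (if j = n then U x n a else 0) else 0)"
      using a by (intro sum.cong) (auto simp: U_T_pow U_e)
    then show "(\<Sum>m<k. U x j m * cnj (U ((T ^^ n) (e a)) j m)) = (if j = n then U x n a else 0)"
      using a by simp
  qed
  then have "(\<lambda>j. if j = n then U x n a else 0) sums cinner x ((T ^^ n) (e a))"
    using U_cinner[of x "(T ^^ n) (e a)"] by simp
  moreover have "(\<lambda>j. if j = n then U x n a else 0) sums U x n a"
    using sums_single[of n "\<lambda>_. U x n a"] by simp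
  ultimately show ?thesis by (rule sums_unique2)
qed

text \<open>\<open>(T ^^ n) x\<close> has no coefficients below \<open>n\<close>, so it is
  orthogonal to every truncation of \<open>y\<close> at some \<open>N \<le> n\<close>; truncations
  approximate \<open>y\<close>.\<close>

lemma cinner_T_pow_tendsto_0: "(\<lambda>n. cinner ((T ^^ n) x) y) \<longlonglongrightarrow> 0"
proof (rule LIMSEQ_I)
  fix \<epsilon> :: real assume \<epsilon>: "\<epsilon> > 0"
  have "norm x + 1 > 0" by (simp add: add_nonneg_pos)
  then have "\<epsilon> / (norm x + 1) > 0" using \<epsilon> by simp
  then obtain N where N: "norm (trunc N y - y) < \<epsilon> / (norm x + 1)"
    using LIMSEQ_D[OF trunc_tendsto[of y]] by blast
  have "norm (cinner ((T ^^ n) x) y - 0) < \<epsilon>" if "n \<ge> N" for n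
  proof -
    have "(\<lambda>j. \<Sum>m<k. U ((T ^^ n) x) j m * cnj (U (trunc N y) j m)) = (\<lambda>j. 0)"
      using that by (intro ext sum.neutral) (auto simp: U_T_pow U_trunc)
    then have "cinner ((T ^^ n) x) (trunc N y) = 0"
      using U_cinner[of "(T ^^ n) x" "trunc N y"] sums_unique2 sums_zero by metis
    then have "cinner ((T ^^ n) x) y = cinner ((T ^^ n) x) (y - trunc N y)"
      by (simp add: cinner_diff_right)
    then have "norm (cinner ((T ^^ n) x) y) \<le> norm x * norm (y - trunc N y)"
      using cauchy_schwarz[of "(T ^^ n) x" "y - trunc N y"] by (simp add: norm_T_pow)
    also have "\<dots> \<le> (norm x + 1) * norm (y - trunc N y)" by (rule mult_right_mono) auto
    also have "\<dots> < \<epsilon>" using N \<open>norm x + 1 > 0\<close> by (simp add: norm_minus_commute field_simps)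
    finally show ?thesis by simp
  qed
  then show "\<exists>N. \<forall>n\<ge>N. norm (cinner ((T ^^ n) x) y - 0) < \<epsilon>" by blast
qed

text \<open>Division with remainder by \<open>g a\<close> moves every \<open>(T ^^ j) (e a)\<close>
  into \<open>N\<close> plus the span of finitely many low powers. That sum is closed, so it is the
  whole space.\<close>

lemma finite_codim_of_polys:
  assumes N: "csubspace N" "closed N" and inv: "\<And>x. x \<in> N \<Longrightarrow> T x \<in> N"
    and g: "\<And>a. a < k \<Longrightarrow> g a \<noteq> 0" "\<And>a. a < k \<Longrightarrow> op_poly (g a) T (e a) \<in> N"
  shows "finite_codim N"
proof -
  define F where "F = (\<Union>a\<in>{..<k}. (\<lambda>j. (T ^^ j) (e a)) ` {..degree (g a)})"
  have F: "finite F" by (simp add: F_def)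
  have opN: "op_poly c T x \<in> N" if "x \<in> N" for c x
  proof -
    have "(T ^^ i) x \<in> N" for i by (induction i) (auto simp: that inv)
    then show ?thesis unfolding op_poly_def
      by (intro complex_vector.subspace_sum[OF N(1)] complex_vector.subspace_scale[OF N(1)])
  qed
  have "x \<in> cspan (N \<union> F)" for x
  proof (rule closed_csubspace_UNIV)
    show "closed (cspan (N \<union> F))" by (rule closed_plus_finite_span[OF F N])
    fix j a assume a: "a < k"
    define s r where "s = monom 1 j div g a" and "r = monom 1 j mod g a"
    have "(T ^^ j) (e a) = op_poly (monom 1 j) T (e a)" by (simp add: op_poly_monom)
    also have "monom 1 j = s * g a + r" by (simp add: s_def r_def)
    also have "op_poly (s * g a + r) T (e a) = op_poly s T (op_poly (g a) T (e a)) + op_poly r T (e a)"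
      by (simp add: op_poly_add op_poly_mult[OF clinear_T])
    finally have eq: "(T ^^ j) (e a) = op_poly s T (op_poly (g a) T (e a)) + op_poly r T (e a)" .
    have deg: "degree r \<le> degree (g a)"
      unfolding r_def using degree_mod_less[OF g(1)[OF a], of "monom 1 j"] by auto
    have "op_poly s T (op_poly (g a) T (e a)) \<in> cspan (N \<union> F)"
      using opN[OF g(2)[OF a]] by (intro complex_vector.span_base) blast
    moreover have "op_poly r T (e a) \<in> cspan (N \<union> F)"
      unfolding op_poly_def
    proof (intro complex_vector.span_sum complex_vector.span_scale complex_vector.span_base)
      fix i assume "i \<in> {..degree r}"
      then have "(T ^^ i) (e a) \<in> (\<lambda>j. (T ^^ j) (e a)) ` {..degree (g a)}"
        using deg by (intro imageI) simp
      then show "(T ^^ i) (e a) \<in> N \<union> F" using a unfolding F_def by blast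
    qed
    ultimately show "(T ^^ j) (e a) \<in> cspan (N \<union> F)"
      unfolding eq by (rule complex_vector.span_add)
  qed (rule complex_vector.subspace_span)
  then show ?thesis unfolding finite_codim_def using F by blast
qed

end

text \<open>In a quotient spanned by \<open>card F\<close> classes, the \<open>card F + 1\<close>
  vectors \<open>(T ^^ i) x\<close> are dependent; the coefficients of the relation form
  \<open>g\<close>.\<close>

lemma finite_codim_imp_poly:
  fixes x :: "'a::complex_vector"
  assumes N: "csubspace N" and "finite_codim N"
  shows "\<exists>g. g \<noteq> 0 \<and> op_poly g T x \<in> N"
proof -
  from assms(2) obtain F where F: "finite F" "cspan (N \<union> F) = UNIV"
    by (auto simp: finite_codim_def)
  have "\<exists>n u. n \<in> N \<and> y = n + (\<Sum>f\<in>F. u f *\<^sub>C f)" for y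
  proof -
    have "y \<in> cspan (N \<union> F)" using F by simp
    then obtain n b where "y = n + b" "n \<in> cspan N" "b \<in> cspan F"
      unfolding complex_vector.span_Un by auto
    moreover have "cspan N = N" using N by (simp only: complex_vector.span_eq_iff)
    ultimately show ?thesis using complex_vector.span_finite[OF F(1)] by auto
  qed
  then obtain n u where nu: "\<And>y. n y \<in> N" "\<And>y. y = n y + (\<Sum>f\<in>F. u y f *\<^sub>C f)" by metis
  obtain h where h: "bij_betw h {0..<card F} F" using ex_bij_betw_nat_finite[OF F(1)] by blast
  have "card F < card {..card F}" by simp
  from exists_linear_relation[OF finite_atMost this, of "\<lambda>m b. u ((T ^^ m) x) (h b)"]
  obtain c where c: "\<exists>i\<in>{..card F}. c i \<noteq> 0"
    "\<And>b. b < card F \<Longrightarrow> (\<Sum>i\<le>card F. c i * u ((T ^^ i) x) (h b)) = 0" by auto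
  have c': "(\<Sum>i\<le>card F. c i * u ((T ^^ i) x) f) = 0" if "f \<in> F" for f
  proof -
    have "f \<in> h ` {0..<card F}" using that h by (simp add: bij_betw_def)
    then obtain b where "b < card F" "f = h b" by auto
    then show ?thesis using c(2) by simp
  qed
  define g where "g = (\<Sum>i\<le>card F. monom (c i) i)"
  have "coeff g i = c i" if "i \<le> card F" for i
    using that by (simp add: g_def coeff_sum)
  then have "g \<noteq> 0" using c(1) by (metis atMost_iff coeff_0)
  have "op_poly g T x = (\<Sum>i\<le>card F. c i *\<^sub>C (T ^^ i) x)"
    by (simp add: g_def op_poly_sum op_poly_monom)
  also have "\<dots> = (\<Sum>i\<le>card F. c i *\<^sub>C (n ((T ^^ i) x) + (\<Sum>f\<in>F. u ((T ^^ i) x) f *\<^sub>C f)))"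
    by (simp only: nu(2)[symmetric])
  also have "\<dots> = (\<Sum>i\<le>card F. c i *\<^sub>C n ((T ^^ i) x)) + (\<Sum>i\<le>card F. \<Sum>f\<in>F. (c i * u ((T ^^ i) x) f) *\<^sub>C f)"
    by (simp add: complex_vector.scale_right_distrib sum.distrib complex_vector.scale_sum_right)
  also have "(\<Sum>i\<le>card F. \<Sum>f\<in>F. (c i * u ((T ^^ i) x) f) *\<^sub>C f) = (\<Sum>f\<in>F. (\<Sum>i\<le>card F. c i * u ((T ^^ i) x) f) *\<^sub>C f)"
    by (subst sum.swap) (simp add: complex_vector.scale_sum_left)
  also have "\<dots> = 0" by (intro sum.neutral) (simp add: c')
  finally have "op_poly g T x \<in> N"
    by (simp add: nu(1) complex_vector.subspace_sum[OF N] complex_vector.subspace_scale[OF N])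
  with \<open>g \<noteq> 0\<close> show ?thesis by blast
qed

section \<open>Tuples of shifts as rational matrix functions\<close>

lemma finite_multiplicity_shift_model:
  assumes "finite_multiplicity_shift S"
  obtains k U where "k > 0" "shift_model k U S"
  using assms unfolding finite_multiplicity_shift_def shift_of_multiplicity_def
  by (metis ell2_model.intro shift_model.intro shift_model_axioms.intro)

text \<open>Coordinates are fixed only for \<open>V i0\<close>. The other members enter through
  coordinate-free properties: they are isometries, commute with \<open>V i0\<close> and have ranges
  of finite codimension.\<close>

locale shift_tuple = commuting_family V + shift_model k U "V i0"
  for V :: "'n::finite \<Rightarrow> 'a::complex_hilbert_space \<Rightarrow> 'a" and i0 k U +
  assumes k_pos: "k > 0" and shifts: "finite_multiplicity_shift (V j)"
begin

abbreviation "T \<equiv> V i0"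

lemma bounded_V: "bounded_clinear (V j)"
  using finite_multiplicity_shift_model[OF shifts] shift_model.bounded_T by metis

lemma cinner_V: "cinner (V j x) (V j y) = cinner x y"
  using finite_multiplicity_shift_model[OF shifts] shift_model.cinner_T by metis

lemma norm_V: "norm (V j x) = norm x"
  using finite_multiplicity_shift_model[OF shifts] shift_model.norm_T by metis

lemma V_inject: "V j x = V j y \<Longrightarrow> x = y"
  using finite_multiplicity_shift_model[OF shifts] shift_model.T_inject by metis

lemma op_poly_V: "op_poly c T (V j x) = V j (op_poly c T x)"
  by (rule op_poly_intertwine[of "V j" T T, OF lin commute', symmetric])

text \<open>The space \<open>H / V\<^sub>j H\<close> is finite-dimensional and \<open>T\<close> acts on it.  A polynomial of least
  degree that annihilates this quotient has no zero \<open>z\<close> with \<open>\<bar>z\<bar> \<ge> 1\<close>, because the powers of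
  \<open>T\<close> tend weakly to 0.\<close>

lemma exists_poly_into_range:
  "\<exists>q. q \<noteq> 0 \<and> (\<forall>z. cmod z \<ge> 1 \<longrightarrow> poly q z \<noteq> 0) \<and> (\<forall>x. op_poly q T x \<in> range (V j))"
proof -
  obtain l Uj where "shift_model l Uj (V j)" using finite_multiplicity_shift_model[OF shifts] by blast
  then interpret S: shift_model l Uj "V j" .
  define Q where "Q q \<longleftrightarrow> q \<noteq> 0 \<and> (\<forall>x. op_poly q T x \<in> range (V j))" for q
  have ran: "csubspace (range (V j))"
  proof (rule complex_vector.subspaceI)
    show "0 \<in> range (V j)" by (rule range_eqI[of _ _ 0]) (simp add: clinear_0[OF lin])
    fix x y c assume "x \<in> range (V j)"
    then obtain x' where x': "x = V j x'" by blast
    show "c *\<^sub>C x \<in> range (V j)"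
      by (rule range_eqI[of _ _ "c *\<^sub>C x'"]) (simp add: x' clinear_scale[OF lin])
    assume "y \<in> range (V j)"
    then obtain y' where y': "y = V j y'" by blast
    show "x + y \<in> range (V j)"
      by (rule range_eqI[of _ _ "x' + y'"]) (simp add: x' y' clinear_add[OF lin])
  qed
  have ran_op: "op_poly c T x \<in> range (V j)" if "x \<in> range (V j)" for c x
    using that by (auto simp: op_poly_V)
  \<comment> \<open>The zeroth coefficients in the model of \<open>V j\<close> are coordinates on
    the quotient by \<open>range (V j)\<close>. Its dimension is thus at most \<open>l\<close>, and
    \<open>l + 1\<close> powers of \<open>T\<close> applied to one vector are dependent
    there.\<close>
  have "\<exists>c. c \<noteq> 0 \<and> op_poly c T (S.e b) \<in> range (V j)" for b
  proof -
    have "l < card {..l}" by simp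
    from exists_linear_relation[OF finite_atMost this, of "\<lambda>i m. Uj ((T ^^ i) (S.e b)) 0 m"]
    obtain c where c: "\<exists>i\<in>{..l}. c i \<noteq> 0" "\<forall>m<l. (\<Sum>i\<le>l. c i * Uj ((T ^^ i) (S.e b)) 0 m) = 0" by blast
    define g where "g = (\<Sum>i\<le>l. monom (c i) i)"
    have "coeff g i = c i" if "i \<le> l" for i
      using that by (simp add: g_def coeff_sum)
    then have "g \<noteq> 0" using c(1) by (metis atMost_iff coeff_0)
    moreover have "op_poly g T (S.e b) \<in> range (V j)"
      unfolding S.in_range_T_iff using c(2)
      by (simp add: g_def op_poly_sum op_poly_monom S.U_sum S.U_scale)
    ultimately show ?thesis by blast
  qed
  then obtain c where c: "\<And>b. c b \<noteq> 0" "\<And>b. op_poly (c b) T (S.e b) \<in> range (V j)" by metis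
  have "Q (\<Prod>b<l. c b)"
    unfolding Q_def
  proof (intro conjI allI)
    show "(\<Prod>b<l. c b) \<noteq> 0" using c(1) by simp
    fix x
    define y where "y = x - (\<Sum>b<l. Uj x 0 b *\<^sub>C S.e b)"
    have "y \<in> range (V j)"
      unfolding S.in_range_T_iff
    proof (intro allI impI)
      fix m assume m: "m < l"
      have "(\<Sum>b<l. Uj x 0 b * Uj (S.e b) 0 m) = (\<Sum>b<l. if b = m then Uj x 0 b else 0)"
        by (rule sum.cong) (auto simp: S.U_e)
      then show "Uj y 0 m = 0" using m by (simp add: y_def S.U_diff S.U_sum S.U_scale)
    qed
    note lo = clinear_op_poly[OF lin[of i0], of "\<Prod>b<l. c b"]
    have "op_poly (\<Prod>b<l. c b) T x =
      op_poly (\<Prod>b<l. c b) T y + (\<Sum>b<l. Uj x 0 b *\<^sub>C op_poly (\<Prod>b<l. c b) T (S.e b))"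
      by (simp add: y_def clinear_diff[OF lo] clinear_sum[OF lo] clinear_scale[OF lo])
    also have "\<dots> \<in> range (V j)"
    proof (intro complex_vector.subspace_add[OF ran] ran_op[OF \<open>y \<in> range (V j)\<close>]
        complex_vector.subspace_sum[OF ran] complex_vector.subspace_scale[OF ran])
      fix b assume "b \<in> {..<l}"
      then show "op_poly (\<Prod>b<l. c b) T (S.e b) \<in> range (V j)"
        by (simp add: op_poly_prod_mem[OF lin, of "{..<l}" b] ran_op[OF c(2)])
    qed
    finally show "op_poly (\<Prod>b<l. c b) T x \<in> range (V j)" .
  qed
  then obtain q where q: "Q q" and min: "\<And>p. Q p \<Longrightarrow> degree q \<le> degree p"
    using ex_has_least_nat[of Q "\<Prod>b<l. c b" degree] by blast
  have "poly q z \<noteq> 0" if z: "cmod z \<ge> 1" for z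
  proof
    assume "poly q z = 0"
    then obtain q1 where q1: "q = [:-z, 1:] * q1" by (auto simp: poly_eq_0_iff_dvd elim: dvdE)
    have "q1 \<noteq> 0" using q q1 by (auto simp: Q_def)
    have "Q q1"
      unfolding Q_def S.in_range_T_iff
    proof (intro conjI allI impI \<open>q1 \<noteq> 0\<close>)
      fix x b assume b: "b < l"
      \<comment> \<open>\<open>\<psi>\<close> is an eigenfunctional of \<open>T\<close> with
        eigenvalue \<open>z\<close>. As |z| >= 1, |\<psi> (T^n x)| never falls below |\<psi> x|, yet
        it tends to 0; so \<open>\<psi> x = 0\<close>. Then \<open>q1\<close> annihilates the
        quotient as well, against the minimal degree of \<open>q\<close>.\<close>
      define \<psi> where "\<psi> y = Uj (op_poly q1 T y) 0 b" for y
      have "\<psi> (T y) = z * \<psi> y" for y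
      proof -
        have "op_poly q T y = op_poly q1 T (op_poly [:-z, 1:] T y)"
          unfolding q1 by (subst mult.commute) (rule op_poly_mult[OF lin])
        also have "\<dots> = op_poly q1 T (T y) - z *\<^sub>C op_poly q1 T y"
          using clinear_diff[OF clinear_op_poly[OF lin]] clinear_scale[OF clinear_op_poly[OF lin]]
          by (simp add: op_poly_pCons[OF lin] clinear_0[OF lin])
        finally have "Uj (op_poly q1 T (T y) - z *\<^sub>C op_poly q1 T y) 0 b = 0"
          using q b unfolding Q_def S.in_range_T_iff by metis
        then show ?thesis by (simp add: \<psi>_def S.U_diff S.U_scale)
      qed
      then have pow: "\<psi> ((T ^^ n) x) = z ^ n * \<psi> x" for n
        by (induction n) simp_all
      have "\<psi> ((T ^^ n) x) = cinner ((T ^^ n) (op_poly q1 T x)) (S.e b)" for n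
        using S.cinner_T_pow_e[OF b, of _ 0]
        by (simp add: \<psi>_def intertwine_funpow[of "op_poly q1 T" T T] op_poly_V)
      then have "(\<lambda>n. \<psi> ((T ^^ n) x)) \<longlonglongrightarrow> 0"
        using cinner_T_pow_tendsto_0[of "op_poly q1 T x" "S.e b"] by simp
      then have "(\<lambda>n. cmod (\<psi> ((T ^^ n) x))) \<longlonglongrightarrow> 0" by (rule tendsto_norm_zero)
      moreover have "cmod (\<psi> x) \<le> cmod (\<psi> ((T ^^ n) x))" for n
        using mult_right_mono[OF one_le_power[OF z, of n], of "cmod (\<psi> x)"]
        by (simp add: pow norm_mult norm_power)
      ultimately have "cmod (\<psi> x) \<le> 0" by (intro LIMSEQ_le_const) auto
      then show "Uj (op_poly q1 T x) 0 b = 0" by (simp add: \<psi>_def)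
    qed
    from min[OF this] have "degree q \<le> degree q1" .
    moreover have "degree q = Suc (degree q1)" using \<open>q1 \<noteq> 0\<close> by (simp add: q1 degree_mult_eq del: mult_pCons_left)
    ultimately show False by simp
  qed
  then show ?thesis using q unfolding Q_def by blast
qed

lemma cinner_T_pow_vanish:
  assumes "\<And>i a. n \<le> i \<Longrightarrow> U x i a = 0"
  shows "cinner x ((T ^^ n) y) = 0"
proof -
  have "(\<lambda>i. \<Sum>m<k. U x i m * cnj (U ((T ^^ n) y) i m)) = (\<lambda>i. 0)"
    by (intro ext sum.neutral) (auto simp: U_T_pow assms)
  then show ?thesis using U_cinner[of x "(T ^^ n) y"] sums_unique2 sums_zero by metis
qed

text \<open>On the circle the polynomial is z^d times the pointwise inner product of
  \<open>v\<close> and \<open>w\<close>, so its Fourier coefficients are inner products of shifted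
  vectors. This turns identities between inner products in the Hilbert space into pointwise
  identities on the circle.\<close>

lemma coeff_correlation:
  assumes w: "\<And>c. c < k \<Longrightarrow> degree (w c) \<le> d"
  shows "coeff (\<Sum>c<k. v c * reflect_cnj d (w c)) n = cinner ((T ^^ d) (vec v)) ((T ^^ n) (vec w))"
proof -
  let ?f = "\<lambda>j. \<Sum>c<k. U ((T ^^ d) (vec v)) j c * cnj (U ((T ^^ n) (vec w)) j c)"
  have w0: "coeff (w c) j = 0" if "c < k" "d < j" for c j
    using w[OF that(1)] that(2) by (simp add: coeff_eq_0)
  have f: "?f j = (\<Sum>c<k. (if j < d then 0 else coeff (v c) (j - d)) * cnj (if j < n then 0 else coeff (w c) (j - n)))" for j
    by (intro sum.cong) (auto simp: U_T_pow U_vec)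
  \<comment> \<open>Below \<open>d\<close> the first factor vanishes, beyond \<open>d + n\<close>
    the second, because each \<open>w c\<close> has degree at most \<open>d\<close>.\<close>
  have "?f j = 0" if "j \<notin> {d..d + n}" for j
    unfolding f using that by (intro sum.neutral) (auto simp: w0)
  then have "?f sums (\<Sum>j\<in>{d..d + n}. ?f j)"
    using sums_finite[of "{d..d + n}" ?f] by blast
  then have "cinner ((T ^^ d) (vec v)) ((T ^^ n) (vec w)) = (\<Sum>j\<in>{d..d + n}. ?f j)"
    using U_cinner sums_unique2 by blast
  also have "\<dots> = (\<Sum>i\<le>n. ?f (d + i))"
    by (rule sum.reindex_bij_witness[of _ "\<lambda>i. d + i" "\<lambda>j. j - d"]) auto
  also have "\<dots> = (\<Sum>i\<le>n. \<Sum>c<k. coeff (v c) i * coeff (reflect_cnj d (w c)) (n - i))"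
  proof (rule sum.cong[OF refl])
    fix i assume "i \<in> {..n}"
    then show "?f (d + i) = (\<Sum>c<k. coeff (v c) i * coeff (reflect_cnj d (w c)) (n - i))"
      unfolding f by (intro sum.cong) (auto simp: coeff_reflect_cnj)
  qed
  also have "\<dots> = coeff (\<Sum>c<k. v c * reflect_cnj d (w c)) n"
    unfolding coeff_sum coeff_mult by (rule sum.swap)
  finally show ?thesis by simp
qed

text \<open>Wherever \<open>q(T) H \<subseteq> V\<^sub>j H\<close>, the operator \<open>V\<^sub>j\<^sup>-\<^sup>1 q(T)\<close> is \<open>V\<^sub>j\<^sup>* q(T)\<close>; being both analytic
  and of bounded co-analytic degree, it is given by a polynomial matrix.\<close>

definition quot_op :: "complex poly \<Rightarrow> 'n \<Rightarrow> 'a \<Rightarrow> 'a" where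
  "quot_op q j x = inv_into UNIV (V j) (op_poly q T x)"

definition quot_mat :: "complex poly \<Rightarrow> 'n \<Rightarrow> complex poly mat" where
  "quot_mat q j = mat k k (\<lambda>(b, a). (SOME v. quot_op q j (e a) = vec v) b)"

lemma quot_mat_carrier: "quot_mat q j \<in> carrier_mat k k"
  by (simp add: quot_mat_def)

context
  fixes q :: "complex poly" and j :: 'n
  assumes q_range: "\<And>x. op_poly q T x \<in> range (V j)"
begin

lemma V_quot_op: "V j (quot_op q j x) = op_poly q T x"
  unfolding quot_op_def by (rule f_inv_into_f[OF q_range])

lemma quot_op_V: "quot_op q j (V j x) = op_poly q T x"
  by (rule V_inject[of j]) (simp add: V_quot_op op_poly_V)

lemma quot_op_T: "quot_op q j (T x) = T (quot_op q j x)"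
  by (rule V_inject[of j]) (simp add: V_quot_op op_poly_V commute'[of j i0])

lemma clinear_quot_op: "clinear (quot_op q j)"
  unfolding clinear_iff
proof (intro conjI allI)
  note lo = clinear_op_poly[OF lin[of i0], of q]
  show "quot_op q j (x + y) = quot_op q j x + quot_op q j y" for x y
    by (rule V_inject[of j]) (simp add: V_quot_op clinear_add[OF lo] clinear_add[OF lin])
  show "quot_op q j (c *\<^sub>C x) = c *\<^sub>C quot_op q j x" for c x
    by (rule V_inject[of j]) (simp add: V_quot_op clinear_scale[OF lo] clinear_scale[OF lin])
qed

lemma cinner_quot_op: "cinner (quot_op q j x) (quot_op q j y) = cinner (op_poly q T x) (op_poly q T y)"
  by (simp add: V_quot_op[symmetric] cinner_V)

lemma bounded_quot_op: "bounded_clinear (quot_op q j)"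
proof -
  obtain B where "\<And>x. norm (op_poly q T x) \<le> B * norm x"
    using bounded_clinear_op_poly[OF bounded_V[of i0], of q] unfolding bounded_clinear_def by blast
  moreover have "norm (quot_op q j x) = norm (op_poly q T x)" for x
    by (metis V_quot_op norm_V)
  ultimately show ?thesis unfolding bounded_clinear_def using clinear_quot_op by metis
qed

text \<open>Coefficient \<open>n\<close> of \<open>quot_op q j (e a)\<close> is an inner product of
  \<open>op_poly q T (e a)\<close>, of degree at most \<open>degree q\<close>, with a vector that
  starts at index \<open>n\<close>. It vanishes for \<open>n > degree q\<close>, so the column is
  polynomial.\<close>

lemma quot_op_e:
  assumes "a < k"
  shows "quot_op q j (e a) = vec (\<lambda>b. quot_mat q j $$ (b, a))"
proof -
  have "\<exists>v. quot_op q j (e a) = vec v"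
  proof (rule finite_support_vec[of "degree q"])
    fix n b assume n: "degree q < n" and b: "b < k"
    have "U (quot_op q j (e a)) n b = cinner (V j (quot_op q j (e a))) (V j ((T ^^ n) (e b)))"
      by (simp add: cinner_V cinner_T_pow_e[OF b])
    also have "\<dots> = cinner (op_poly q T (e a)) ((T ^^ n) (V j (e b)))"
      by (simp add: V_quot_op intertwine_funpow[of "V j" T T, OF commute'])
    also have "\<dots> = 0"
      by (rule cinner_T_pow_vanish) (use n assms in \<open>auto simp: U_op_poly_e coeff_eq_0\<close>)
    finally show "U (quot_op q j (e a)) n b = 0" .
  qed
  from someI_ex[OF this] have "quot_op q j (e a) = vec (SOME v. quot_op q j (e a) = vec v)" .
  also have "\<dots> = vec (\<lambda>b. quot_mat q j $$ (b, a))"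
    by (rule U_eqI) (simp add: U_vec quot_mat_def assms)
  finally show ?thesis .
qed

lemma quot_op_vec: "quot_op q j (vec v) = vec (\<lambda>b. \<Sum>a<k. quot_mat q j $$ (b, a) * v a)"
proof -
  have "quot_op q j (vec v) = (\<Sum>a<k. op_poly (v a) T (quot_op q j (e a)))"
    by (simp add: vec_def clinear_sum[OF clinear_quot_op]
        op_poly_intertwine[of "quot_op q j" T T, OF clinear_quot_op quot_op_T])
  also have "\<dots> = (\<Sum>a<k. vec (\<lambda>b. v a * quot_mat q j $$ (b, a)))"
    by (intro sum.cong refl) (simp add: quot_op_e op_poly_vec)
  finally show ?thesis by (simp add: vec_sum mult.commute)
qed

text \<open>As \<open>V j\<close> is isometric, \<open>quot_op q j\<close> and
  \<open>op_poly q T\<close> produce the same inner products from \<open>(T ^^ d) (e a)\<close> and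
  \<open>(T ^^ n) (e b)\<close>. By \<open>coeff_correlation\<close> the corresponding functions on
  the circle have the same coefficients.\<close>

lemma quot_mat_unitary:
  assumes z: "cmod z = 1"
  shows "adjoint_mat (map_mat (\<lambda>p. poly p z) (quot_mat q j)) * map_mat (\<lambda>p. poly p z) (quot_mat q j) =
    of_real ((cmod (poly q z))\<^sup>2) \<cdot>\<^sub>m 1\<^sub>m k"
proof -
  let ?M = "quot_mat q j"
  have M: "map_mat (\<lambda>p. poly p z) ?M \<in> carrier_mat k k" using quot_mat_carrier[of q j] by simp
  \<comment> \<open>One reflection degree has to serve the entries of the matrix and
    \<open>q\<close> alike.\<close>
  define d where "d = degree q + Max ((\<lambda>(a, b). degree (?M $$ (a, b))) ` ({..<k} \<times> {..<k}))"
  have d: "degree (?M $$ (a, b)) \<le> d" if "a < k" "b < k" for a b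
  proof -
    have "degree (?M $$ (a, b)) \<le> Max ((\<lambda>(a, b). degree (?M $$ (a, b))) ` ({..<k} \<times> {..<k}))"
      using that by (intro Max_ge) (auto intro!: image_eqI[of _ _ "(a, b)"])
    then show ?thesis by (simp add: d_def)
  qed
  have eq: "(\<Sum>c<k. poly (?M $$ (c, a)) z * cnj (poly (?M $$ (c, b)) z)) =
      (if a = b then poly q z * cnj (poly q z) else 0)" if a: "a < k" and b: "b < k" for a b
  proof -
    define \<delta> where "\<delta> a c = (if c = a then q else 0)" for a c :: nat
    have op_e: "op_poly q T (e a) = vec (\<delta> a)" if "a < k" for a
      by (rule U_eqI) (auto simp: \<delta>_def U_vec U_op_poly_e that)
    have "coeff (\<Sum>c<k. ?M $$ (c, a) * reflect_cnj d (?M $$ (c, b))) n =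
        coeff (\<Sum>c<k. \<delta> a c * reflect_cnj d (\<delta> b c)) n" for n
    proof -
      have "coeff (\<Sum>c<k. ?M $$ (c, a) * reflect_cnj d (?M $$ (c, b))) n =
          cinner ((T ^^ d) (quot_op q j (e a))) ((T ^^ n) (quot_op q j (e b)))"
        using coeff_correlation[of "\<lambda>c. ?M $$ (c, b)" d "\<lambda>c. ?M $$ (c, a)" n] d[OF _ b]
        by (simp add: quot_op_e a b)
      also have "\<dots> = cinner (quot_op q j ((T ^^ d) (e a))) (quot_op q j ((T ^^ n) (e b)))"
        by (simp add: intertwine_funpow[of "quot_op q j" T T, OF quot_op_T])
      also have "\<dots> = cinner ((T ^^ d) (op_poly q T (e a))) ((T ^^ n) (op_poly q T (e b)))"
        by (simp add: cinner_quot_op intertwine_funpow[of "op_poly q T" T T, OF op_poly_V])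
      also have "\<dots> = coeff (\<Sum>c<k. \<delta> a c * reflect_cnj d (\<delta> b c)) n"
        by (simp only: op_e[OF a] op_e[OF b], rule coeff_correlation[symmetric]) (simp add: \<delta>_def d_def)
      finally show ?thesis .
    qed
    then have "(\<Sum>c<k. ?M $$ (c, a) * reflect_cnj d (?M $$ (c, b))) = (\<Sum>c<k. \<delta> a c * reflect_cnj d (\<delta> b c))"
      by (rule poly_eqI)
    then have "poly (\<Sum>c<k. ?M $$ (c, a) * reflect_cnj d (?M $$ (c, b))) z = poly (\<Sum>c<k. \<delta> a c * reflect_cnj d (\<delta> b c)) z"
      by simp
    moreover have "poly (\<Sum>c<k. ?M $$ (c, a) * reflect_cnj d (?M $$ (c, b))) z =
        z ^ d * (\<Sum>c<k. poly (?M $$ (c, a)) z * cnj (poly (?M $$ (c, b)) z))"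
      unfolding poly_sum poly_mult sum_distrib_left
      by (intro sum.cong refl) (simp add: poly_reflect_cnj d b z)
    moreover have "poly (\<Sum>c<k. \<delta> a c * reflect_cnj d (\<delta> b c)) z =
        (\<Sum>c<k. if c = a then z ^ d * (if a = b then poly q z * cnj (poly q z) else 0) else 0)"
      unfolding poly_sum poly_mult
      by (intro sum.cong refl) (auto simp: \<delta>_def poly_reflect_cnj z d_def)
    ultimately have "z ^ d * (\<Sum>c<k. poly (?M $$ (c, a)) z * cnj (poly (?M $$ (c, b)) z)) =
        z ^ d * (if a = b then poly q z * cnj (poly q z) else 0)" using a by simp
    moreover have "z ^ d \<noteq> 0" using z by auto
    ultimately show ?thesis by (simp only: mult_cancel_left) simp
  qed
  show ?thesis
  proof (rule eq_matI)
    fix b a assume "b < dim_row (of_real ((cmod (poly q z))\<^sup>2) \<cdot>\<^sub>m 1\<^sub>m k :: complex mat)"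
      "a < dim_col (of_real ((cmod (poly q z))\<^sup>2) \<cdot>\<^sub>m 1\<^sub>m k :: complex mat)"
    then have ab: "a < k" "b < k" by auto
    have "(adjoint_mat (map_mat (\<lambda>p. poly p z) ?M) * map_mat (\<lambda>p. poly p z) ?M) $$ (b, a) =
        (\<Sum>c<k. cnj (poly (?M $$ (c, b)) z) * poly (?M $$ (c, a)) z)"
      unfolding index_mult_mat_sum[OF adjoint_mat_carrier[OF M] M ab(2,1)]
      using ab quot_mat_carrier[of q j] by (intro sum.cong refl) (simp add: index_adjoint_mat[OF M])
    also have "\<dots> = (if a = b then poly q z * cnj (poly q z) else 0)"
      using eq[OF ab] by (simp add: mult.commute)
    finally show "(adjoint_mat (map_mat (\<lambda>p. poly p z) ?M) * map_mat (\<lambda>p. poly p z) ?M) $$ (b, a) =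
        (of_real ((cmod (poly q z))\<^sup>2) \<cdot>\<^sub>m 1\<^sub>m k) $$ (b, a)"
      using ab by (auto simp: complex_norm_square simp del: of_real_power)
  qed (use M in \<open>auto simp: adjoint_mat_def\<close>)
qed

lemma det_quot_mat:
  assumes "poly q 1 \<noteq> 0"
  shows "det (quot_mat q j) \<noteq> 0"
proof
  let ?M = "map_mat (\<lambda>p. poly p 1) (quot_mat q j)"
  have M: "?M \<in> carrier_mat k k" using quot_mat_carrier[of q j] by simp
  assume "det (quot_mat q j) = 0"
  then have "det ?M = 0" by (simp add: det_map_mat_poly)
  then have "det (adjoint_mat ?M * ?M) = 0"
    using det_mult[OF adjoint_mat_carrier[OF M] M] by simp
  then show False using assms unfolding quot_mat_unitary[of 1, simplified] by simp
qed

end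

section \<open>Vectors with rational coordinates\<close>

definition rational :: "'a set" where
  "rational = {h. \<exists>c v. c \<noteq> 0 \<and> op_poly c T h = vec v}"

lemma rationalI: "c \<noteq> 0 \<Longrightarrow> op_poly c T h = vec v \<Longrightarrow> h \<in> rational"
  by (auto simp: rational_def)

lemma e_rational: "a < k \<Longrightarrow> e a \<in> rational"
  by (rule rationalI[of 1]) (simp_all add: e_eq_vec)

lemma csubspace_rational: "csubspace rational"
proof (rule complex_vector.subspaceI)
  note lo = clinear_op_poly[OF lin[of i0]]
  show "0 \<in> rational" by (rule rationalI[of 1]) (simp_all add: vec_zero[symmetric])
  fix x y c assume "x \<in> rational"
  then obtain d v where x: "d \<noteq> 0" "op_poly d T x = vec v" by (auto simp: rational_def)
  have "c *\<^sub>C vec v = vec (\<lambda>a. Polynomial.smult c (v a))"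
    by (rule U_eqI) (simp add: U_vec U_scale)
  then have "op_poly d T (c *\<^sub>C x) = vec (\<lambda>a. Polynomial.smult c (v a))"
    using x by (simp add: clinear_scale[OF lo])
  with x(1) show "c *\<^sub>C x \<in> rational" by (rule rationalI)
  assume "y \<in> rational"
  then obtain d' v' where y: "d' \<noteq> 0" "op_poly d' T y = vec v'" by (auto simp: rational_def)
  have "op_poly (d * d') T (x + y) = op_poly d' T (op_poly d T x) + op_poly d T (op_poly d' T y)"
    by (simp add: clinear_add[OF lo] op_poly_mult[OF lin, symmetric] mult.commute)
  also have "\<dots> = vec (\<lambda>a. d' * v a + d * v' a)" by (simp add: x y op_poly_vec vec_add)
  finally show "x + y \<in> rational" by (rule rationalI[rotated]) (use x y in simp)
qed

lemma rational_op_polyD: "c \<noteq> 0 \<Longrightarrow> op_poly c T h \<in> rational \<Longrightarrow> h \<in> rational"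
  unfolding rational_def by (auto simp: op_poly_mult[OF lin, symmetric]) (metis mult_eq_0_iff)

lemma op_poly_rational: "h \<in> rational \<Longrightarrow> op_poly c T h \<in> rational"
proof -
  assume "h \<in> rational"
  then obtain d v where h: "d \<noteq> 0" "op_poly d T h = vec v" by (auto simp: rational_def)
  have "op_poly d T (op_poly c T h) = op_poly c T (op_poly d T h)"
    by (simp add: op_poly_mult[OF lin, symmetric] mult.commute)
  then show ?thesis using h by (intro rationalI[of d]) (simp_all add: op_poly_vec)
qed

text \<open>\<open>V j\<close> is \<open>op_poly q T\<close> composed with the inverse of the matrix
  \<open>quot_mat q j\<close>. The adjugate provides that inverse with denominator
  \<open>det ?M\<close>, which is not 0 because its value at 1 is not.\<close>

lemma V_e_rational:
  assumes a: "a < k"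
  shows "V j (e a) \<in> rational"
proof -
  obtain q where q: "q \<noteq> 0" "\<And>z. cmod z \<ge> 1 \<Longrightarrow> poly q z \<noteq> 0" "\<And>x. op_poly q T x \<in> range (V j)"
    using exists_poly_into_range by blast
  let ?M = "quot_mat q j"
  define A where "A = adj_mat ?M"
  have A: "A \<in> carrier_mat k k" "?M * A = det ?M \<cdot>\<^sub>m 1\<^sub>m k"
    using adj_mat[OF quot_mat_carrier[of q j]] by (auto simp: A_def)
  have "quot_op q j (vec (\<lambda>b. A $$ (b, a))) = vec (\<lambda>c. (?M * A) $$ (c, a))"
    unfolding quot_op_vec[OF q(3)]
    by (rule U_eqI) (simp add: U_vec index_mult_mat_sum[OF quot_mat_carrier A(1) _ a] del: index_mult_mat)
  also have "\<dots> = op_poly (det ?M) T (e a)"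
    unfolding A(2) by (rule U_eqI) (auto simp: U_vec U_op_poly_e a)
  finally have "op_poly q T (vec (\<lambda>b. A $$ (b, a))) = op_poly (det ?M) T (V j (e a))"
    by (metis V_quot_op[OF q(3)] op_poly_V)
  then have "op_poly (det ?M) T (V j (e a)) = vec (\<lambda>b. q * A $$ (b, a))"
    by (simp add: op_poly_vec)
  moreover have "det ?M \<noteq> 0" by (rule det_quot_mat[OF q(3)]) (simp add: q(2))
  ultimately show ?thesis by (intro rationalI)
qed

lemma V_rational:
  assumes "h \<in> rational"
  shows "V j h \<in> rational"
proof -
  obtain d v where h: "d \<noteq> 0" "op_poly d T h = vec v" using assms by (auto simp: rational_def)
  have "op_poly d T (V j h) = (\<Sum>a<k. op_poly (v a) T (V j (e a)))"
    by (simp add: op_poly_V h vec_def clinear_sum[OF lin])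
  also have "\<dots> \<in> rational"
    by (intro complex_vector.subspace_sum[OF csubspace_rational] op_poly_rational V_e_rational) simp
  finally show ?thesis by (rule rational_op_polyD[OF h(1)])
qed

lemma poly_op_rational: "h \<in> rational \<Longrightarrow> poly_op p V h \<in> rational"
  by (rule poly_op_mem[OF csubspace_rational V_rational])

lemma common_denominator:
  assumes "finite I" "\<And>i. i \<in> I \<Longrightarrow> h i \<in> rational"
  shows "\<exists>c v. c \<noteq> 0 \<and> (\<forall>i\<in>I. op_poly c T (h i) = vec (v i))"
proof -
  have "\<forall>i\<in>I. \<exists>c v. c \<noteq> 0 \<and> op_poly c T (h i) = vec v" using assms(2) by (auto simp: rational_def)
  then obtain c v where c: "\<And>i. i \<in> I \<Longrightarrow> c i \<noteq> 0" "\<And>i. i \<in> I \<Longrightarrow> op_poly (c i) T (h i) = vec (v i)"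
    by metis
  have "op_poly (\<Prod>i\<in>I. c i) T (h i) = vec (\<lambda>a. (\<Prod>i\<in>I-{i}. c i) * v i a)" if "i \<in> I" for i
    using that by (simp add: op_poly_prod_mem[OF lin assms(1) that] c(2) op_poly_vec)
  then show ?thesis using assms(1) c(1)
    by (intro exI[of _ "\<Prod>i\<in>I. c i"] exI[of _ "\<lambda>i a. (\<Prod>i\<in>I-{i}. c i) * v i a"]) simp
qed

end

lemma commuting_shifts_model:
  assumes "commuting_shifts V"
  obtains k U where "shift_tuple V i0 k U"
proof -
  have sh: "finite_multiplicity_shift (V j)" for j using assms by (simp add: commuting_shifts_def)
  obtain k U where kU: "k > 0" "shift_model k U (V i0)" using finite_multiplicity_shift_model[OF sh] by blast
  have "clinear (V j)" for j
    using finite_multiplicity_shift_model[OF sh] shift_model.clinear_T by metis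
  then have "shift_tuple V i0 k U"
    using assms kU sh
    by (intro shift_tuple.intro commuting_family.intro shift_tuple_axioms.intro)
      (auto simp: commuting_shifts_def)
  then show thesis by (rule that)
qed

section \<open>Virtual cyclicity as the rank of a module\<close>

lemma pair_index_less: "a < n \<Longrightarrow> b < k \<Longrightarrow> a * k + b < n * (k::nat)"
  using mult_le_mono1[of "Suc a" n k] by simp

text \<open>Coefficientwise, not X-adic, convergence: norm convergence of vectors implies it for
  their coordinate series, and determinants are continuous for it.\<close>

definition fps_conv :: "(nat \<Rightarrow> complex fps) \<Rightarrow> complex fps \<Rightarrow> bool" where
  "fps_conv f g \<longleftrightarrow> (\<forall>m. (\<lambda>n. fps_nth (f n) m) \<longlonglongrightarrow> fps_nth g m)"

lemma fps_conv_const: "fps_conv (\<lambda>n. c) c"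
  by (simp add: fps_conv_def)

lemma fps_conv_mult: "fps_conv f a \<Longrightarrow> fps_conv g b \<Longrightarrow> fps_conv (\<lambda>n. f n * g n) (a * b)"
  unfolding fps_conv_def fps_mult_nth by (intro allI tendsto_sum tendsto_mult) auto

lemma fps_conv_sum: "(\<And>i. i \<in> A \<Longrightarrow> fps_conv (f i) (g i)) \<Longrightarrow> fps_conv (\<lambda>n. \<Sum>i\<in>A. f i n) (\<Sum>i\<in>A. g i)"
  unfolding fps_conv_def fps_sum_nth by (intro allI tendsto_sum) auto

lemma fps_conv_prod: "(\<And>i. i \<in> A \<Longrightarrow> fps_conv (f i) (g i)) \<Longrightarrow> fps_conv (\<lambda>n. \<Prod>i\<in>A. f i n) (\<Prod>i\<in>A. g i)"
  by (induction A rule: infinite_finite_induct) (auto intro: fps_conv_const fps_conv_mult)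

lemma fps_conv_det:
  assumes "\<And>a b. a < k \<Longrightarrow> b < k \<Longrightarrow> fps_conv (\<lambda>n. f n a b) (g a b)"
  shows "fps_conv (\<lambda>n. det (mat k k (\<lambda>(a, b). f n a b))) (det (mat k k (\<lambda>(a, b). g a b)))"
proof -
  have "(\<lambda>n. det (mat k k (\<lambda>(a, b). f n a b))) =
      (\<lambda>n. \<Sum>p\<in>{p. p permutes {0..<k}}. signof p * (\<Prod>i = 0..<k. f n i (p i)))"
    by (intro ext) (auto simp: det_def intro!: sum.cong prod.cong arg_cong2[of _ _ _ _ times] permutes_in_image dest: permutes_in_image)
  moreover have "det (mat k k (\<lambda>(a, b). g a b)) =
      (\<Sum>p\<in>{p. p permutes {0..<k}}. signof p * (\<Prod>i = 0..<k. g i (p i)))"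
    by (auto simp: det_def intro!: sum.cong prod.cong arg_cong2[of _ _ _ _ times] dest: permutes_in_image)
  moreover have "fps_conv (\<lambda>n. \<Sum>p\<in>{p. p permutes {0..<k}}. signof p * (\<Prod>i = 0..<k. f n i (p i)))
      (\<Sum>p\<in>{p. p permutes {0..<k}}. signof p * (\<Prod>i = 0..<k. g i (p i)))"
    by (intro fps_conv_sum fps_conv_mult fps_conv_const fps_conv_prod assms)
      (auto dest: permutes_in_image)
  ultimately show ?thesis by simp
qed

lemma fps_conv_zeroD: "fps_conv (\<lambda>n. 0) g \<Longrightarrow> g = 0"
  by (auto simp: fps_conv_def fps_eq_iff LIMSEQ_const_iff)

lemma (in commuting_family) power_not_in_Ann:
  assumes "primeideal (Ann V) ring_of_type_algebra" "p \<notin> Ann V"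
  shows "p ^ n \<notin> Ann V"
proof (induction n)
  case 0
  have "1 \<in> Ann V \<Longrightarrow> Ann V = UNIV"
    by (auto simp: Ann_def)
  then show ?case using prime_Ann_nontrivial[OF assms(1)] by auto
next
  case (Suc n)
  then show ?case using prime_AnnD[OF assms(1), of p "p ^ n"] assms(2) by auto
qed

section \<open>Dependence over the polynomials in the distinguished coordinate\<close>

context shift_tuple
begin

lemma bounded_poly_op: "bounded_clinear (poly_op p V)"
proof -
  have "bounded_clinear (partial_monom A m)" for A m
  proof (induction A rule: infinite_finite_induct)
    case (insert i A)
    show ?case unfolding partial_monom_insert[OF insert.hyps(2)]
      using bounded_clinear_compose[OF bounded_clinear_funpow[OF bounded_V] insert.IH] by (simp add: o_def)
  qed (simp_all add: partial_monom_empty id_def bounded_clinear_id)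
  then show ?thesis unfolding poly_op_def monom_op_partial
    by (intro bounded_clinear_sum bounded_clinear_smult)
qed

lemma bounded_combination:
  "bounded_clinear (\<lambda>h. \<Sum>i\<in>I. op_poly (c i) T (poly_op (p i) V h))"
  by (intro bounded_clinear_sum bounded_clinear_compose[OF bounded_clinear_op_poly[OF bounded_V] bounded_poly_op])

text \<open>On rational vectors each \<open>poly_op (p i) V\<close> is a k by k matrix over C(z),
  and such matrices form a space of dimension \<open>k * k\<close>. After clearing denominators the
  relation holds on the \<open>e a\<close>, hence everywhere by continuity.\<close>

lemma exists_annihilating_combination:
  fixes p :: "'i \<Rightarrow> 'n cpoly"
  assumes I: "finite I" "k * k < card I"
  shows "\<exists>c. (\<exists>i\<in>I. c i \<noteq> 0) \<and> (\<forall>h. (\<Sum>i\<in>I. op_poly (c i) T (poly_op (p i) V h)) = 0)"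
proof -
  have "finite (I \<times> {..<k})" using I by simp
  moreover have "(\<lambda>(i, a). poly_op (p i) V (e a)) ia \<in> rational" if "ia \<in> I \<times> {..<k}" for ia
    using that by (auto intro: poly_op_rational e_rational)
  ultimately obtain d v where d: "d \<noteq> 0"
    and v: "\<forall>ia\<in>I \<times> {..<k}. op_poly d T ((\<lambda>(i, a). poly_op (p i) V (e a)) ia) = vec (v ia)"
    using common_denominator[of "I \<times> {..<k}" "\<lambda>(i, a). poly_op (p i) V (e a)"] by blast
  from exists_linear_relation[OF I, of "\<lambda>i m. v (i, m div k) (m mod k)"]
  obtain c where c: "\<exists>i\<in>I. c i \<noteq> 0" "\<forall>m<k*k. (\<Sum>i\<in>I. c i * v (i, m div k) (m mod k)) = 0" by blast
  have c0: "(\<Sum>i\<in>I. c i * v (i, a) b) = 0" if "a < k" "b < k" for a b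
  proof -
    have "a * k + b < k * k"
      using that by (rule pair_index_less)
    then show ?thesis using c(2)[rule_format, of "a * k + b"] that by simp
  qed
  have "(\<Sum>i\<in>I. op_poly (c i * d) T (poly_op (p i) V h)) = 0" for h
  proof (rule bounded_clinear_eqI[of "\<lambda>h. \<Sum>i\<in>I. op_poly (c i * d) T (poly_op (p i) V h)" "\<lambda>h. 0" T])
    show "bounded_clinear (\<lambda>h. \<Sum>i\<in>I. op_poly (c i * d) T (poly_op (p i) V h))"
      by (rule bounded_combination)
    show "bounded_clinear (\<lambda>h::'a. 0::'a)"
      unfolding bounded_clinear_def using clinear_zero_fun by (auto intro: exI[of _ 0])
    show "(\<Sum>i\<in>I. op_poly (c i * d) T (poly_op (p i) V (T x))) = T (\<Sum>i\<in>I. op_poly (c i * d) T (poly_op (p i) V x))" for x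
      by (simp add: clinear_sum[OF lin] poly_op_op_commute op_poly_V)
    show "(\<Sum>i\<in>I. op_poly (c i * d) T (poly_op (p i) V (e a))) = 0" if a: "a < k" for a
    proof -
      have "(\<Sum>i\<in>I. op_poly (c i * d) T (poly_op (p i) V (e a))) = (\<Sum>i\<in>I. vec (\<lambda>b. c i * v (i, a) b))"
        using v a by (intro sum.cong refl) (auto simp: op_poly_mult[OF lin] op_poly_vec)
      also have "\<dots> = vec (\<lambda>b. 0)" unfolding vec_sum by (rule U_eqI) (simp add: U_vec c0 a)
      finally show ?thesis by (simp add: vec_zero)
    qed
  qed (simp add: clinear_0[OF lin])
  moreover have "\<exists>i\<in>I. c i * d \<noteq> 0" using c(1) d by auto
  ultimately show ?thesis by (intro exI[of _ "\<lambda>i. c i * d"]) simp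
qed

end

locale prime_shift_tuple = shift_tuple V i0 k U
  for V :: "'n::finite \<Rightarrow> 'a::complex_hilbert_space \<Rightarrow> 'a" and i0 k U +
  assumes prime: "primeideal (Ann V) ring_of_type_algebra"
begin

lemma in_Ann_iff: "p \<in> Ann V \<longleftrightarrow> (\<forall>h. poly_op p V h = 0)"
  by (simp add: Ann_def)

text \<open>The powers of \<open>p\<close> are dependent over C[z], so \<open>p\<close> is algebraic
  modulo \<open>Ann V\<close>. Primeness permits cancelling the lowest power that occurs; the
  constant term \<open>c l\<close> of what remains is then a multiple of \<open>p\<close>.\<close>

lemma exists_multiple_in_T:
  assumes p: "p \<notin> Ann V"
  shows "\<exists>b c. c \<noteq> 0 \<and> (\<forall>h. poly_op (b * p) V h = op_poly c T h)"
proof -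
  have "k * k < card {..k * k}" by simp
  from exists_annihilating_combination[OF finite_atMost this, of "\<lambda>i. p ^ i"]
  obtain c where c: "\<exists>i\<in>{..k*k}. c i \<noteq> 0" "\<And>h. (\<Sum>i\<le>k*k. op_poly (c i) T (poly_op (p ^ i) V h)) = 0" by blast
  define l where "l = (LEAST i. c i \<noteq> 0)"
  obtain i where i: "c i \<noteq> 0" "i \<le> k * k" using c(1) by auto
  have l: "c l \<noteq> 0" "l \<le> k * k" and l0: "\<And>i. i < l \<Longrightarrow> c i = 0"
    unfolding l_def using LeastI[of "\<lambda>i. c i \<noteq> 0", OF i(1)] Least_le[of "\<lambda>i. c i \<noteq> 0", OF i(1)] i(2) not_less_Least
    by auto
  define s where "s = (\<Sum>i\<in>{l..k*k}. embed_poly i0 (c i) * p ^ (i - l))"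
  have "poly_op (p ^ l * s) V h = 0" for h
  proof -
    have "p ^ l * s = (\<Sum>i\<in>{l..k*k}. embed_poly i0 (c i) * p ^ i)"
      unfolding s_def sum_distrib_left
    proof (rule sum.cong[OF refl])
      fix i assume "i \<in> {l..k*k}"
      then have "p ^ l * p ^ (i - l) = p ^ i" by (simp add: power_add[symmetric])
      then show "p ^ l * (embed_poly i0 (c i) * p ^ (i - l)) = embed_poly i0 (c i) * p ^ i"
        by (simp only: mult.left_commute[of "p ^ l"])
    qed
    then have "poly_op (p ^ l * s) V h = (\<Sum>i\<in>{l..k*k}. op_poly (c i) T (poly_op (p ^ i) V h))"
      by (simp add: poly_op_sum poly_op_mult poly_op_embed_poly)
    also have "\<dots> = (\<Sum>i\<le>k*k. op_poly (c i) T (poly_op (p ^ i) V h))"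
      by (rule sum.mono_neutral_left) (auto simp: l0 not_le)
    finally show ?thesis by (simp add: c(2))
  qed
  then have "p ^ l * s \<in> Ann V" by (simp add: in_Ann_iff)
  then have "s \<in> Ann V" using prime_AnnD[OF prime] power_not_in_Ann[OF prime p] by blast
  define b where "b = - (\<Sum>i\<in>{Suc l..k*k}. embed_poly i0 (c i) * p ^ (i - Suc l))"
  have "s = embed_poly i0 (c l) + (\<Sum>i\<in>{Suc l..k*k}. embed_poly i0 (c i) * p ^ (i - l))"
    unfolding s_def using l(2) by (subst sum.atLeast_Suc_atMost) auto
  also have "(\<Sum>i\<in>{Suc l..k*k}. embed_poly i0 (c i) * p ^ (i - l)) =
      (\<Sum>i\<in>{Suc l..k*k}. embed_poly i0 (c i) * p ^ (i - Suc l) * p)"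
  proof (intro sum.cong refl)
    fix i assume "i \<in> {Suc l..k*k}"
    then have "i - l = Suc (i - Suc l)" by auto
    then show "embed_poly i0 (c i) * p ^ (i - l) = embed_poly i0 (c i) * p ^ (i - Suc l) * p"
      by (simp add: mult_ac)
  qed
  also have "\<dots> = - (b * p)" by (simp add: b_def sum_distrib_right)
  finally have "b * p = embed_poly i0 (c l) - s" by simp
  then have "poly_op (b * p) V h = op_poly (c l) T h" for h
    using \<open>s \<in> Ann V\<close> by (simp add: poly_op_diff in_Ann_iff poly_op_embed_poly)
  then show ?thesis using l(1) by blast
qed

text \<open>Only the \<open>e a\<close> are candidates: they span the rational vectors over C(z), so
  a basis over the fraction field of C[x] / Ann(V) can be chosen among them.\<close>

definition indep :: "nat set \<Rightarrow> bool" where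
  "indep B \<longleftrightarrow> B \<subseteq> {..<k} \<and>
    (\<forall>p. (\<Sum>b\<in>B. poly_op (p b) V (e b)) = 0 \<longrightarrow> (\<forall>b\<in>B. p b \<in> Ann V))"

lemma indepD: "indep B \<Longrightarrow> (\<Sum>b\<in>B. poly_op (p b) V (e b)) = 0 \<Longrightarrow> b \<in> B \<Longrightarrow> p b \<in> Ann V"
  by (auto simp: indep_def)

text \<open>\<open>B\<close> is an independent set of largest size. An \<open>e a\<close> outside
  \<open>B\<close> satisfies a relation whose coefficient at \<open>a\<close> is not in
  \<open>Ann V\<close>; \<open>exists_multiple_in_T\<close> turns that coefficient into a nonzero
  polynomial in \<open>T\<close>, so all denominators lie in C[z].\<close>

lemma exists_basis:
  "\<exists>B g P. indep B \<and> (\<forall>a<k. g a \<noteq> 0 \<and> op_poly (g a) T (e a) = (\<Sum>b\<in>B. poly_op (P a b) V (e b)))"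
proof -
  have "indep {}" by (simp add: indep_def)
  moreover have "\<forall>B. indep B \<longrightarrow> card B < Suc k"
  proof (intro allI impI)
    fix B assume "indep B"
    then show "card B < Suc k" using card_mono[of "{..<k}" B] by (simp add: indep_def)
  qed
  ultimately have "\<exists>B. indep B \<and> (\<forall>B'. indep B' \<longrightarrow> card B' \<le> card B)"
    by (rule Lattices_Big.ex_has_greatest_nat)
  then obtain B where B: "indep B" and max: "\<And>B'. indep B' \<Longrightarrow> card B' \<le> card B" by blast
  have fin: "finite B" and sub: "B \<subseteq> {..<k}" using B by (auto simp: indep_def intro: finite_subset)
  have "\<exists>g P. g \<noteq> 0 \<and> op_poly g T (e a) = (\<Sum>b\<in>B. poly_op (P b) V (e b))" if a: "a < k" for a
  proof (cases "a \<in> B")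
    case True
    have "(\<Sum>b\<in>B. poly_op (if b = a then 1 else 0) V (e b)) = (\<Sum>b\<in>B. if b = a then e b else 0)"
      by (intro sum.cong refl) auto
    then show ?thesis using True fin
      by (intro exI[of _ 1] exI[of _ "\<lambda>b. if b = a then 1 else 0"]) simp
  next
    case False
    have "\<not> indep (insert a B)" using max[of "insert a B"] False fin by auto
    then obtain p where p: "(\<Sum>b\<in>insert a B. poly_op (p b) V (e b)) = 0" "\<not> (\<forall>b\<in>insert a B. p b \<in> Ann V)"
      using a sub by (auto simp: indep_def)
    have sum0: "poly_op (p a) V (e a) + (\<Sum>b\<in>B. poly_op (p b) V (e b)) = 0" using p(1) False fin by simp
    have pa: "p a \<notin> Ann V"
    proof
      assume "p a \<in> Ann V"
      then have "(\<Sum>b\<in>B. poly_op (p b) V (e b)) = 0" using sum0 by (simp add: in_Ann_iff)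
      then show False using indepD[OF B] p(2) \<open>p a \<in> Ann V\<close> by auto
    qed
    from exists_multiple_in_T[OF this] obtain q c where q: "c \<noteq> 0" "\<And>h. poly_op (q * p a) V h = op_poly c T h" by blast
    have "op_poly c T (e a) = poly_op q V (poly_op (p a) V (e a))" by (simp add: q(2)[symmetric] poly_op_mult)
    also have "poly_op (p a) V (e a) = - (\<Sum>b\<in>B. poly_op (p b) V (e b))" using sum0 by (simp add: eq_neg_iff_add_eq_0)
    also have "poly_op q V \<dots> = (\<Sum>b\<in>B. poly_op (- (q * p b)) V (e b))"
      using clinear_diff[OF clinear_poly_op[of q], of 0] clinear_0[OF clinear_poly_op[of q]]
      by (simp add: clinear_sum[OF clinear_poly_op] poly_op_uminus poly_op_mult sum_negf)
    finally show ?thesis using q(1) by (intro exI[of _ c] exI[of _ "\<lambda>b. - (q * p b)"]) simp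
  qed
  then show ?thesis using B by metis
qed

text \<open>In contrast to \<open>indep\<close>, which is independence over all of \<open>\<complex>[x] / Ann(V)\<close>, the scalars here are
  the polynomials in \<open>x\<^bsub>i0\<^esub>\<close> alone.\<close>

definition free_family :: "nat \<Rightarrow> (nat \<Rightarrow> 'n cpoly) \<Rightarrow> bool" where
  "free_family d m \<longleftrightarrow> (\<forall>c. (\<forall>h. (\<Sum>i<d. op_poly (c i) T (poly_op (m i) V h)) = 0) \<longrightarrow> (\<forall>i<d. c i = 0))"

text \<open>\<open>d\<close> is the degree of the fraction field of C[x] / Ann(V) over C(z). A
  largest family exists because \<open>exists_annihilating_combination\<close> bounds its size by
  \<open>k * k\<close>.\<close>

lemma exists_maximal_free_family:
  "\<exists>d m. free_family d m \<and>
    (\<forall>p. \<exists>c f. c \<noteq> 0 \<and> (\<forall>h. op_poly c T (poly_op p V h) = (\<Sum>i<d. op_poly (f i) T (poly_op (m i) V h))))"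
proof -
  have "\<exists>m. free_family 0 m" by (simp add: free_family_def)
  moreover have "\<forall>d. (\<exists>m. free_family d m) \<longrightarrow> d \<le> k * k"
  proof (intro allI impI, elim exE, rule ccontr)
    fix d m assume m: "free_family d m" "\<not> d \<le> k * k"
    then have "k * k < card {..<d}" by simp
    from exists_annihilating_combination[OF finite_lessThan this, of m] show False
      using m(1) unfolding free_family_def by blast
  qed
  ultimately have "\<exists>d. (\<exists>m. free_family d m) \<and> (\<forall>d'. (\<exists>m. free_family d' m) \<longrightarrow> d' \<le> d)"
    by (rule Nat.ex_has_greatest_nat)
  then obtain d m where m: "free_family d m" and max: "\<And>d' m'. free_family d' m' \<Longrightarrow> d' \<le> d" by blast
  have "\<exists>c f. c \<noteq> 0 \<and> (\<forall>h. op_poly c T (poly_op p V h) = (\<Sum>i<d. op_poly (f i) T (poly_op (m i) V h)))" for p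
  proof -
    have "\<not> free_family (Suc d) (m(d := p))" using max[of "Suc d"] by auto
    then obtain c where c: "\<And>h. (\<Sum>i<Suc d. op_poly (c i) T (poly_op ((m(d := p)) i) V h)) = 0"
      "\<not> (\<forall>i<Suc d. c i = 0)" unfolding free_family_def by blast
    have s: "(\<Sum>i<d. op_poly (c i) T (poly_op (m i) V h)) + op_poly (c d) T (poly_op p V h) = 0" for h
      using c(1)[of h] by simp
    have "c d \<noteq> 0"
    proof
      assume "c d = 0"
      then have "\<forall>i<d. c i = 0" using s m unfolding free_family_def by simp
      then show False using c(2) \<open>c d = 0\<close> by (auto simp: less_Suc_eq)
    qed
    moreover have "op_poly (c d) T (poly_op p V h) = (\<Sum>i<d. op_poly (- c i) T (poly_op (m i) V h))" for h
      using s[of h] by (simp add: op_poly_minus sum_negf eq_neg_iff_add_eq_0 add.commute)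
    ultimately show ?thesis by (intro exI[of _ "c d"] exI[of _ "\<lambda>i. - c i"]) simp
  qed
  then show ?thesis using m by blast
qed

text \<open>The tower law: the \<open>card B * d\<close> vectors
  \<open>poly_op (m i) V (e b)\<close> are independent over C(z) in a space of dimension
  \<open>k\<close>.\<close>

lemma rank_product_le:
  assumes B: "indep B" and m: "free_family d m"
  shows "card B * d \<le> k"
proof (rule ccontr)
  have fin: "finite B" and sub: "B \<subseteq> {..<k}" using B by (auto simp: indep_def intro: finite_subset)
  assume "\<not> card B * d \<le> k"
  then have card: "k < card (B \<times> {..<d})" by (simp add: card_cartesian_product)
  have fin2: "finite (B \<times> {..<d})" using fin by simp
  define y where "y bi = poly_op (m (snd bi)) V (e (fst bi))" for bi
  have "y bi \<in> rational" if "bi \<in> B \<times> {..<d}" for bi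
    using that sub by (auto simp: y_def intro!: poly_op_rational e_rational)
  from common_denominator[of _ y, OF fin2 this] obtain c v where c: "c \<noteq> 0"
    "\<forall>bi\<in>B \<times> {..<d}. op_poly c T (y bi) = vec (v bi)" by blast
  from exists_linear_relation[OF fin2 card, of v]
  obtain f where f: "\<exists>bi\<in>B \<times> {..<d}. f bi \<noteq> 0" "\<forall>a<k. (\<Sum>bi\<in>B \<times> {..<d}. f bi * v bi a) = 0" by blast
  define p where "p b = (\<Sum>i<d. embed_poly i0 (f (b, i) * c) * m i)" for b
  have pop: "poly_op (p b) V h = (\<Sum>i<d. op_poly (f (b, i) * c) T (poly_op (m i) V h))" for b h
    by (simp add: p_def poly_op_sum poly_op_mult poly_op_embed_poly)
  have "(\<Sum>b\<in>B. poly_op (p b) V (e b)) = (\<Sum>(b, i)\<in>B \<times> {..<d}. op_poly (f (b, i) * c) T (poly_op (m i) V (e b)))"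
    by (simp add: pop sum.cartesian_product)
  also have "\<dots> = (\<Sum>bi\<in>B \<times> {..<d}. vec (\<lambda>a. f bi * v bi a))"
    using c(2) by (intro sum.cong refl) (auto simp: y_def op_poly_mult[OF lin] op_poly_vec)
  also have "\<dots> = vec (\<lambda>a. 0)" unfolding vec_sum by (rule U_eqI) (simp add: U_vec f(2))
  finally have "(\<Sum>b\<in>B. poly_op (p b) V (e b)) = 0" by (simp add: vec_zero)
  then have "p b \<in> Ann V" if "b \<in> B" for b using indepD[OF B] that by blast
  then have "\<forall>i<d. f (b, i) * c = 0" if "b \<in> B" for b
    using m that unfolding free_family_def in_Ann_iff pop by (elim allE[of _ "\<lambda>i. f (b, i) * c"]) simp
  then show False using f(1) c(1) by auto
qed

section \<open>The number of generators up to finite codimension\<close>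

lemma T_span_invariant:
  assumes "x \<in> cspan {poly_op p V (h i) | p i. i < (s::nat)}"
  shows "T x \<in> cspan {poly_op p V (h i) | p i. i < s}"
  using assms
proof (induction rule: complex_vector.span_induct_alt)
  case base
  then show ?case by (simp add: clinear_0[OF lin] complex_vector.span_zero)
next
  case (step c x y)
  then obtain p i where x: "x = poly_op p V (h i)" "i < s" by auto
  have "T x = poly_op (cvar i0 * p) V (h i)" by (simp add: x poly_op_mult poly_op_cvar)
  then have "T x \<in> cspan {poly_op p V (h i) | p i. i < s}"
    using x(2) by (intro complex_vector.span_base) blast
  then show ?case using step
    by (simp add: clinear_add[OF lin] clinear_scale[OF lin] complex_vector.span_add complex_vector.span_scale)
qed

lemma span_generated_form:
  assumes "x \<in> cspan {poly_op p V (h i) | p i. i < (s::nat)}"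
  shows "\<exists>p. x = (\<Sum>l<s. poly_op (p l) V (h l))"
  using assms
proof (induction rule: complex_vector.span_induct_alt)
  case base
  then show ?case by (intro exI[of _ "\<lambda>_. 0"]) simp
next
  case (step c x y)
  then obtain p i q where x: "x = poly_op p V (h i)" "i < s" and y: "y = (\<Sum>l<s. poly_op (q l) V (h l))" by auto
  have sc: "c *\<^sub>C poly_op p V z = poly_op (embed_poly i0 [:c:] * p) V z" for z
    by (simp add: poly_op_mult poly_op_embed_poly op_poly_pCons[OF lin] clinear_0[OF lin])
  define r where "r l = (if l = i then embed_poly i0 [:c:] * p else 0) + q l" for l
  have "(\<Sum>l<s. poly_op (r l) V (h l)) = (\<Sum>l<s. if l = i then c *\<^sub>C poly_op p V (h l) else 0) + y"
    unfolding y sum.distrib[symmetric] by (intro sum.cong refl) (auto simp: r_def poly_op_add sc)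
  also have "\<dots> = c *\<^sub>C x + y" using x by simp
  finally show ?case by metis
qed

text \<open>The module generated by \<open>s\<close> vectors has rank at most \<open>s * d\<close>
  over C[z], and \<open>s * d < k\<close> by \<open>rank_product_le\<close>. So any \<open>k\<close>
  of its elements are dependent over C[z]. The \<open>h i\<close> need not be rational, hence a
  determinant of power series.\<close>

lemma few_generators_det_zero:
  assumes B: "indep B" and s: "s < card B"
    and u: "\<And>a. a < k \<Longrightarrow> u a \<in> cspan {poly_op p V (h i) | p i. i < s}"
  shows "det (mat k k (\<lambda>(b, a). fps_coord (u a) b)) = 0"
proof -
  obtain d m where m: "free_family d m"
    "\<And>p. \<exists>c f. c \<noteq> 0 \<and> (\<forall>h. op_poly c T (poly_op p V h) = (\<Sum>i<d. op_poly (f i) T (poly_op (m i) V h)))"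
    using exists_maximal_free_family by blast
  have sd: "s * d < k"
  proof (cases "d = 0")
    case False
    then have "s * d < card B * d" using s by (intro mult_less_mono1) auto
    then show ?thesis using rank_product_le[OF B m(1)] by linarith
  qed (simp add: k_pos)
  have "\<forall>a. \<exists>p. a < k \<longrightarrow> u a = (\<Sum>l<s. poly_op (p l) V (h l))" using span_generated_form[OF u] by blast
  from choice[OF this] obtain p where "\<forall>a. a < k \<longrightarrow> u a = (\<Sum>l<s. poly_op (p a l) V (h l))" by (rule exE)
  then have p: "\<And>a. a < k \<Longrightarrow> u a = (\<Sum>l<s. poly_op (p a l) V (h l))" by blast
  from choice[OF allI[OF m(2)]] obtain c where "\<forall>p. \<exists>f. c p \<noteq> 0 \<and>
    (\<forall>h. op_poly (c p) T (poly_op p V h) = (\<Sum>i<d. op_poly (f i) T (poly_op (m i) V h)))" by (rule exE)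
  from choice[OF this] obtain f where f: "\<forall>p. c p \<noteq> 0 \<and>
    (\<forall>h. op_poly (c p) T (poly_op p V h) = (\<Sum>i<d. op_poly (f p i) T (poly_op (m i) V h)))" by (rule exE)
  have c: "\<And>p. c p \<noteq> 0"
    "\<And>p h. op_poly (c p) T (poly_op p V h) = (\<Sum>i<d. op_poly (f p i) T (poly_op (m i) V h))"
    using f by simp_all
  \<comment> \<open>\<open>\<gamma>\<close> is a common denominator for all \<open>p a l\<close>,
    and \<open>\<gamma>' a l\<close> is its part without the factor of \<open>(a, l)\<close>. Below,
    \<open>F\<close> codes the pair \<open>(l, i)\<close> as the single index
    \<open>l * d + i\<close>.\<close>
  define \<gamma> where "\<gamma> = (\<Prod>al\<in>{..<k} \<times> {..<s}. c (case al of (a, l) \<Rightarrow> p a l))"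
  define \<gamma>' where "\<gamma>' a l = (\<Prod>al\<in>{..<k} \<times> {..<s} - {(a, l)}. c (case al of (a, l) \<Rightarrow> p a l))" for a l
  have "\<gamma> \<noteq> 0" unfolding \<gamma>_def using c(1) by simp
  define F where "F a j = \<gamma>' a (j div d) * f (p a (j div d)) (j mod d)" for a j
  have F: "op_poly \<gamma> T (u a) = (\<Sum>l<s. \<Sum>i<d. op_poly (F a (l * d + i)) T (poly_op (m i) V (h l)))" if a: "a < k" for a
  proof -
    have "op_poly \<gamma> T (u a) = (\<Sum>l<s. op_poly \<gamma> T (poly_op (p a l) V (h l)))"
      by (simp add: p[OF a] clinear_sum[OF clinear_op_poly[OF lin]])
    also have "\<dots> = (\<Sum>l<s. op_poly (\<gamma>' a l) T (op_poly (c (p a l)) T (poly_op (p a l) V (h l))))"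
    proof (intro sum.cong refl)
      fix l assume "l \<in> {..<s}"
      then show "op_poly \<gamma> T (poly_op (p a l) V (h l)) = op_poly (\<gamma>' a l) T (op_poly (c (p a l)) T (poly_op (p a l) V (h l)))"
        using a op_poly_prod_mem[OF lin, of "{..<k} \<times> {..<s}" "(a, l)" "\<lambda>al. c (case al of (a, l) \<Rightarrow> p a l)" i0]
        by (simp add: \<gamma>_def \<gamma>'_def)
    qed
    also have "\<dots> = (\<Sum>l<s. \<Sum>i<d. op_poly (\<gamma>' a l * f (p a l) i) T (poly_op (m i) V (h l)))"
      by (simp add: c(2) clinear_sum[OF clinear_op_poly[OF lin]] op_poly_mult[OF lin])
    also have "\<dots> = (\<Sum>l<s. \<Sum>i<d. op_poly (F a (l * d + i)) T (poly_op (m i) V (h l)))"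
      unfolding F_def by (intro sum.cong refl) simp
    finally show ?thesis .
  qed
  have "s * d < card {..<k}" using sd by simp
  from exists_linear_relation[OF finite_lessThan this, of F]
  obtain c' where c': "\<exists>a\<in>{..<k}. c' a \<noteq> 0" "\<forall>j<s*d. (\<Sum>a<k. c' a * F a j) = 0" by blast
  have z: "(\<Sum>a<k. op_poly (c' a * \<gamma>) T (u a)) = 0"
  proof -
    have "(\<Sum>a<k. op_poly (c' a * \<gamma>) T (u a)) =
        (\<Sum>a<k. \<Sum>l<s. \<Sum>i<d. op_poly (c' a * F a (l * d + i)) T (poly_op (m i) V (h l)))"
      by (intro sum.cong refl) (simp add: op_poly_mult[OF lin] F clinear_sum[OF clinear_op_poly[OF lin]])
    also have "\<dots> = (\<Sum>l<s. \<Sum>a<k. \<Sum>i<d. op_poly (c' a * F a (l * d + i)) T (poly_op (m i) V (h l)))"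
      by (rule sum.swap)
    also have "\<dots> = (\<Sum>l<s. \<Sum>i<d. \<Sum>a<k. op_poly (c' a * F a (l * d + i)) T (poly_op (m i) V (h l)))"
      by (intro sum.cong[OF refl] sum.swap)
    also have "\<dots> = 0"
    proof (rule sum.neutral, rule ballI, rule sum.neutral, rule ballI)
      fix l i assume "l \<in> {..<s}" "i \<in> {..<d}"
      then have "l * d + i < s * d"
        by (simp add: pair_index_less)
      then show "(\<Sum>a<k. op_poly (c' a * F a (l * d + i)) T (poly_op (m i) V (h l))) = 0"
        using c'(2) by (simp add: op_poly_sum[symmetric])
    qed
    finally show ?thesis .
  qed
  define A where "A = mat k k (\<lambda>(b, a). fps_coord (u a) b)"
  define w where "w = Matrix.vec k (\<lambda>a. fps_of_poly (c' a * \<gamma>))"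
  have "A *\<^sub>v w = 0\<^sub>v k"
  proof (rule eq_vecI)
    fix b assume "b < dim_vec (0\<^sub>v k :: complex fps Matrix.vec)"
    then have b: "b < k" by simp
    have "vec_index (A *\<^sub>v w) b = (\<Sum>a<k. fps_coord (u a) b * fps_of_poly (c' a * \<gamma>))"
      using b by (simp add: A_def w_def scalar_prod_def atLeast0LessThan)
    also have "\<dots> = fps_coord (\<Sum>a<k. op_poly (c' a * \<gamma>) T (u a)) b"
      by (simp only: fps_coord_sum fps_coord_op_poly mult.commute)
    finally show "vec_index (A *\<^sub>v w) b = vec_index (0\<^sub>v k) b" using b by (simp add: z fps_coord_zero)
  qed (simp add: A_def)
  moreover have "w \<noteq> 0\<^sub>v k"
  proof
    assume "w = 0\<^sub>v k"
    then have "fps_of_poly (c' a * \<gamma>) = 0" if "a < k" for a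
      using that by (metis w_def index_vec index_zero_vec(1))
    then show False using c'(1) \<open>\<gamma> \<noteq> 0\<close> by auto
  qed
  moreover have "A \<in> carrier_mat k k" "w \<in> carrier_vec k" by (auto simp: A_def w_def)
  ultimately show ?thesis unfolding A_def[symmetric] using det_0_iff_vec_prod_zero by blast
qed

text \<open>If \<open>s < card B\<close>, nonzero multiples \<open>op_poly (g a) T (e a)\<close> are
  limits of elements of the module generated by the \<open>h i\<close>. Determinants of
  \<open>k\<close> such elements vanish, and this passes to the limit; but the limit matrix is
  diagonal with the nonzero entries \<open>g a\<close>.\<close>

lemma generators_ge:
  assumes B: "indep B" and fc: "finite_codim (closure (cspan {poly_op p V (h i) | p i. i < s}))"
  shows "card B \<le> s"
proof (rule ccontr)
  assume "\<not> card B \<le> s"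
  then have s: "s < card B" by simp
  define N where "N = cspan {poly_op p V (h i) | p i. i < s}"
  have fc: "finite_codim (closure N)" using fc by (simp add: N_def)
  have cs: "csubspace (closure N)" unfolding N_def by (rule closure_csubspace) (rule complex_vector.subspace_span)
  have "\<exists>g. g \<noteq> 0 \<and> op_poly g T (e a) \<in> closure N" for a
    by (rule finite_codim_imp_poly[OF cs fc])
  then obtain g where g: "\<And>a. g a \<noteq> 0" "\<And>a. op_poly (g a) T (e a) \<in> closure N" by metis
  then have "\<forall>a. \<exists>f. (\<forall>n. f n \<in> N) \<and> f \<longlonglongrightarrow> op_poly (g a) T (e a)" unfolding closure_sequential by blast
  then obtain f where f: "\<And>a n. f a n \<in> N" "\<And>a. f a \<longlonglongrightarrow> op_poly (g a) T (e a)" by metis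
  have conv: "fps_conv (\<lambda>n. fps_coord (f a n) b) (fps_coord (op_poly (g a) T (e a)) b)" for a b
    unfolding fps_conv_def fps_coord_nth
  proof
    fix m
    have "(\<lambda>n. norm (f a n - op_poly (g a) T (e a))) \<longlonglongrightarrow> 0"
      using f(2)[of a] by (simp add: LIM_zero tendsto_norm_zero)
    then have "(\<lambda>n. U (f a n - op_poly (g a) T (e a)) m b) \<longlonglongrightarrow> 0"
      by (rule Lim_null_comparison[rotated]) (simp add: coordinate_le)
    then show "(\<lambda>n. U (f a n) m b) \<longlonglongrightarrow> U (op_poly (g a) T (e a)) m b"
      by (simp add: U_diff LIM_zero_iff)
  qed
  have "fps_conv (\<lambda>n. det (mat k k (\<lambda>(b, a). fps_coord (f a n) b)))
      (det (mat k k (\<lambda>(b, a). fps_coord (op_poly (g a) T (e a)) b)))"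
    by (rule fps_conv_det) (rule conv)
  moreover have "det (mat k k (\<lambda>(b, a). fps_coord (f a n) b)) = 0" for n
    by (rule few_generators_det_zero[OF B s]) (rule f(1)[unfolded N_def])
  ultimately have "det (mat k k (\<lambda>(b, a). fps_coord (op_poly (g a) T (e a)) b)) = 0"
    by (simp add: fps_conv_zeroD)
  moreover define A where "A = mat k k (\<lambda>(b, a). fps_coord (op_poly (g a) T (e a)) b)"
  ultimately have "det A = 0" by simp
  moreover have "A \<in> carrier_mat k k" by (simp add: A_def)
  ultimately obtain w where w: "w \<in> carrier_vec k" "w \<noteq> 0\<^sub>v k" "A *\<^sub>v w = 0\<^sub>v k"
    using det_0_iff_vec_prod_zero by blast
  have "vec_index w b = 0" if b: "b < k" for b
  proof -
    have "vec_index (A *\<^sub>v w) b = (\<Sum>a<k. fps_coord (op_poly (g a) T (e a)) b * vec_index w a)"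
      using b w(1) by (simp add: A_def scalar_prod_def atLeast0LessThan)
    also have "\<dots> = (\<Sum>a<k. if a = b then fps_of_poly (g b) * vec_index w b else 0)"
    proof (intro sum.cong refl)
      fix a assume "a \<in> {..<k}"
      then have "fps_coord (op_poly (g a) T (e a)) b = (if a = b then fps_of_poly (g a) else 0)"
        using U_op_poly_e by (intro fps_ext) auto
      then show "fps_coord (op_poly (g a) T (e a)) b * vec_index w a = (if a = b then fps_of_poly (g b) * vec_index w b else 0)"
        by simp
    qed
    also have "\<dots> = fps_of_poly (g b) * vec_index w b" using b by simp
    finally have "fps_of_poly (g b) * vec_index w b = 0" using b by (simp add: w(3))
    then show ?thesis using g(1)[of b] by simp
  qed
  then have "w = 0\<^sub>v k" using w(1) by (intro eq_vecI) auto
  with w(2) show False by simp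
qed

lemma basis_generates:
  assumes "indep B"
    and g: "\<And>a. a < k \<Longrightarrow> g a \<noteq> 0" "\<And>a. a < k \<Longrightarrow> op_poly (g a) T (e a) = (\<Sum>b\<in>B. poly_op (P a b) V (e b))"
  shows "\<exists>h. finite_codim (closure (cspan {poly_op p V (h i) | p i. i < card B}))"
proof -
  have fin: "finite B" using assms(1) by (auto simp: indep_def intro: finite_subset)
  obtain f where f: "bij_betw f {0..<card B} B" using ex_bij_betw_nat_finite[OF fin] by blast
  let ?N = "cspan {poly_op p V ((\<lambda>i. e (f i)) i) | p i. i < card B}"
  have "finite_codim (closure ?N)"
  proof (rule finite_codim_of_polys[OF _ closed_closure])
    show "csubspace (closure ?N)" by (rule closure_csubspace) (rule complex_vector.subspace_span)
    show "T x \<in> closure ?N" if "x \<in> closure ?N" for x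
      by (rule closure_invariant[OF bounded_V T_span_invariant that])
    show "op_poly (g a) T (e a) \<in> closure ?N" if "a < k" for a
    proof (rule subsetD[OF closure_subset])
      show "op_poly (g a) T (e a) \<in> ?N"
        unfolding g(2)[OF that]
      proof (intro complex_vector.span_sum complex_vector.span_base)
        fix b assume "b \<in> B"
        then have "b \<in> f ` {0..<card B}" using f by (simp add: bij_betw_def)
        then obtain i where "b = f i" "i < card B" by auto
        then show "poly_op (P a b) V (e b) \<in> {poly_op p V ((\<lambda>i. e (f i)) i) | p i. i < card B}" by blast
      qed
    qed
  qed (rule g(1))
  then show ?thesis by (rule exI[of _ "\<lambda>i. e (f i)"])
qed

lemma virtual_cyclicity_eq:
  assumes "indep B"
    and "\<And>a. a < k \<Longrightarrow> g a \<noteq> 0" "\<And>a. a < k \<Longrightarrow> op_poly (g a) T (e a) = (\<Sum>b\<in>B. poly_op (P a b) V (e b))"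
  shows "virtual_cyclicity V = card B"
  unfolding virtual_cyclicity_def
proof (rule Least_equality)
  show "\<exists>h. finite_codim (closure (cspan {poly_op p V (h i) |p i. i < card B}))"
    by (rule basis_generates[OF assms])
  show "card B \<le> s" if "\<exists>h. finite_codim (closure (cspan {poly_op p V (h i) |p i. i < s}))" for s
    using that by (elim exE) (rule generators_ge[OF assms(1)])
qed

end

section \<open>Similarity up to finite codimension\<close>

text \<open>Each root \<open>z\<close> contributes a factor T - z, and since \<open>T\<close> is an
  isometry, \<open>norm (T x - z *\<^sub>C x)\<close> is at least
  \<open>\<bar>1 - cmod z\<bar> * norm x\<close>.\<close>

lemma (in shift_model) op_poly_bounded_below:
  assumes "p \<noteq> 0" "\<And>z. cmod z = 1 \<Longrightarrow> poly p z \<noteq> 0"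
  shows "\<exists>c>0. \<forall>x. c * norm x \<le> norm (op_poly p T x)"
  using assms
proof (induction "degree p" arbitrary: p)
  case 0
  then obtain a where "p = [:a:]" by (metis degree_eq_zeroE)
  then show ?case using 0
    by (intro exI[of _ "cmod a"]) (auto simp: op_poly_pCons[OF clinear_T] clinear_0[OF clinear_T] norm_scaleC)
next
  case (Suc n)
  then have "\<not> constant (poly p)" by (simp add: constant_degree)
  then obtain z where "poly p z = 0" using fundamental_theorem_of_algebra by blast
  then obtain p1 where p1: "p = [:-z, 1:] * p1" by (auto simp: poly_eq_0_iff_dvd elim: dvdE)
  have "p1 \<noteq> 0" using Suc.prems(1) p1 by auto
  have "degree p = Suc (degree p1)" using \<open>p1 \<noteq> 0\<close> by (simp add: p1 degree_mult_eq del: mult_pCons_left)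
  then have "n = degree p1" using Suc.hyps(2) by simp
  moreover have "poly p1 w \<noteq> 0" if "cmod w = 1" for w
    using Suc.prems(2)[OF that] by (auto simp: p1)
  ultimately obtain c where c: "c > 0" "\<And>x. c * norm x \<le> norm (op_poly p1 T x)"
    using Suc.hyps(1) \<open>p1 \<noteq> 0\<close> by blast
  define d where "d = \<bar>1 - cmod z\<bar>"
  have "cmod z \<noteq> 1" using Suc.prems(2)[of z] p1 by auto
  then have "d > 0" by (simp add: d_def)
  have d: "d * norm x \<le> norm (op_poly [:-z, 1:] T x)" for x
  proof -
    have "op_poly [:-z, 1:] T x = T x - z *\<^sub>C x"
      by (simp add: op_poly_pCons[OF clinear_T] clinear_0[OF clinear_T])
    moreover have "d * norm x = \<bar>norm (T x) - norm (z *\<^sub>C x)\<bar>"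
    proof -
      have "norm (T x) - norm (z *\<^sub>C x) = (1 - cmod z) * norm x"
        by (simp add: norm_T norm_scaleC algebra_simps)
      then show ?thesis by (simp add: d_def abs_mult)
    qed
    ultimately show ?thesis using norm_triangle_ineq3[of "T x" "z *\<^sub>C x"] by simp
  qed
  have "(d * c) * norm x \<le> norm (op_poly p T x)" for x
  proof -
    have "(d * c) * norm x \<le> d * norm (op_poly p1 T x)"
      using mult_left_mono[OF c(2)[of x], of d] \<open>d > 0\<close> by (simp add: mult.assoc)
    also have "\<dots> \<le> norm (op_poly p T x)" using d by (simp add: p1 op_poly_mult[OF clinear_T] del: mult_pCons_left)
    finally show ?thesis .
  qed
  then show ?case using c(1) \<open>d > 0\<close> by (intro exI[of _ "d * c"]) simp
qed

section \<open>Multiplication by polynomial matrices between two shift spaces\<close>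

locale shift_pair = H: shift_model k U T + K: shift_model k' U' T'
  for k and U :: "'a::complex_hilbert_space \<Rightarrow> nat \<Rightarrow> nat \<Rightarrow> complex" and T
    and k' and U' :: "'b::complex_hilbert_space \<Rightarrow> nat \<Rightarrow> nat \<Rightarrow> complex" and T'
begin

text \<open>The matrix unit at position \<open>(a, b)\<close>, applied to every coefficient. For
  \<open>a < k\<close> the sequence lies in \<open>ell2 k\<close>, so \<open>inv_into\<close> has
  its intended value.\<close>

definition entry_op :: "nat \<Rightarrow> nat \<Rightarrow> 'b \<Rightarrow> 'a" where
  "entry_op a b w = inv_into UNIV U (\<lambda>j m. if m = a then U' w j b else 0)"

lemma coordinate_summable: "summable (\<lambda>j. (cmod (U' w j b))\<^sup>2)"
  and coordinate_suminf_le: "suminf (\<lambda>j. (cmod (U' w j b))\<^sup>2) \<le> (norm w)\<^sup>2"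
proof -
  let ?s = "\<lambda>j. \<Sum>m<k'. (cmod (U' w j m))\<^sup>2"
  have le: "(cmod (U' w j b))\<^sup>2 \<le> ?s j" for j
  proof (cases "b < k'")
    case True
    then show ?thesis by (intro member_le_sum[of b _ "\<lambda>m. (cmod (U' w j m))\<^sup>2"]) auto
  qed (simp add: K.U_outside sum_nonneg)
  have s: "summable ?s" "suminf ?s = (norm w)\<^sup>2" using K.norm_sums[of w] by (auto simp: sums_iff)
  show *: "summable (\<lambda>j. (cmod (U' w j b))\<^sup>2)"
    by (rule summable_comparison_test'[OF s(1), of 0]) (use le in auto)
  show "suminf (\<lambda>j. (cmod (U' w j b))\<^sup>2) \<le> (norm w)\<^sup>2"
    using suminf_le[OF le * s(1)] s(2) by simp
qed

lemma entry_norm_row: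
  assumes "a < k"
  shows "(\<Sum>m<k. (cmod (if m = a then U' w j b else 0))\<^sup>2) = (cmod (U' w j b))\<^sup>2"
proof -
  have "(\<Sum>m<k. (cmod (if m = a then U' w j b else 0))\<^sup>2) = (\<Sum>m<k. if m = a then (cmod (U' w j b))\<^sup>2 else 0)"
    by (intro sum.cong) auto
  then show ?thesis using assms by simp
qed

lemma U_entry_op:
  assumes "a < k"
  shows "U (entry_op a b w) j m = (if m = a then U' w j b else 0)"
proof -
  have "(\<lambda>j m. if m = a then U' w j b else 0) \<in> ell2 k"
    using assms coordinate_summable[of w b] entry_norm_row[OF assms] by (simp add: ell2_def)
  then have "(\<lambda>j m. if m = a then U' w j b else 0) \<in> range U"
    using H.U_bij by (simp add: bij_betw_def)
  from f_inv_into_f[OF this] show ?thesis by (simp add: entry_op_def)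
qed

lemma bounded_entry_op:
  assumes a: "a < k"
  shows "bounded_clinear (entry_op a b)"
proof -
  have "clinear (entry_op a b)"
    unfolding clinear_iff
    by (intro conjI allI; rule H.U_eqI) (simp_all add: U_entry_op[OF a] H.U_add H.U_scale K.U_add K.U_scale)
  moreover have "norm (entry_op a b w) \<le> 1 * norm w" for w
  proof -
    have "(\<lambda>j. (cmod (U' w j b))\<^sup>2) sums (norm (entry_op a b w))\<^sup>2"
      using H.norm_sums[of "entry_op a b w"] by (simp add: U_entry_op[OF a] entry_norm_row[OF a])
    then have "(norm (entry_op a b w))\<^sup>2 \<le> (norm w)\<^sup>2"
      using coordinate_suminf_le[of w b] by (simp add: sums_iff)
    from power2_le_imp_le[OF this norm_ge_zero] show ?thesis by simp
  qed
  ultimately show ?thesis unfolding bounded_clinear_def by blast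
qed

lemma entry_op_T:
  assumes a: "a < k"
  shows "entry_op a b (T' w) = T (entry_op a b w)"
proof (rule H.U_eqI)
  fix j m show "U (entry_op a b (T' w)) j m = U (T (entry_op a b w)) j m"
    by (cases j) (simp_all add: U_entry_op[OF a])
qed

lemma entry_op_e: "a < k \<Longrightarrow> c < k' \<Longrightarrow> entry_op a b (K.e c) = (if b = c then H.e a else 0)"
  by (rule H.U_eqI) (auto simp: U_entry_op K.U_e H.U_e H.U_zero)

definition mat_op :: "(nat \<Rightarrow> nat \<Rightarrow> complex poly) \<Rightarrow> 'b \<Rightarrow> 'a" where
  "mat_op M w = (\<Sum>a<k. \<Sum>b<k'. op_poly (M a b) T (entry_op a b w))"

lemma bounded_mat_op: "bounded_clinear (mat_op M)"
  unfolding mat_op_def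
  by (intro bounded_clinear_sum bounded_clinear_compose[OF bounded_clinear_op_poly[OF H.bounded_T]]
      bounded_entry_op) simp

lemma clinear_mat_op: "clinear (mat_op M)"
  by (rule bounded_clinearD(1)[OF bounded_mat_op])

lemma mat_op_T: "mat_op M (T' w) = T (mat_op M w)"
  by (simp add: mat_op_def entry_op_T clinear_sum[OF H.clinear_T]
      op_poly_intertwine[of T T T, OF H.clinear_T])

lemma mat_op_op_poly: "mat_op M (op_poly c T' w) = op_poly c T (mat_op M w)"
  by (rule op_poly_intertwine[of "mat_op M" T' T, OF clinear_mat_op mat_op_T])

lemma mat_op_e:
  assumes "c < k'"
  shows "mat_op M (K.e c) = H.vec (\<lambda>a. M a c)"
proof -
  have "(\<Sum>b<k'. op_poly (M a b) T (entry_op a b (K.e c))) = op_poly (M a c) T (H.e a)" if "a < k" for a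
  proof -
    have "(\<Sum>b<k'. op_poly (M a b) T (entry_op a b (K.e c))) = (\<Sum>b<k'. if b = c then op_poly (M a c) T (H.e a) else 0)"
      using that assms by (intro sum.cong refl)
        (auto simp: entry_op_e clinear_0[OF clinear_op_poly[OF H.clinear_T]])
    then show ?thesis using assms by simp
  qed
  then show ?thesis by (simp add: mat_op_def H.vec_def)
qed

lemma mat_op_vec: "mat_op M (K.vec v) = H.vec (\<lambda>a. \<Sum>b<k'. M a b * v b)"
proof -
  have "mat_op M (K.vec v) = (\<Sum>b<k'. H.vec (\<lambda>a. v b * M a b))"
    by (simp add: K.vec_def clinear_sum[OF clinear_mat_op] mat_op_op_poly mat_op_e H.op_poly_vec)
  then show ?thesis by (simp add: H.vec_sum mult.commute)
qed

end

locale prime_pair = H: prime_shift_tuple V i0 k U + K: prime_shift_tuple W i0 k' U'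
  for V :: "'n::finite \<Rightarrow> 'a::complex_hilbert_space \<Rightarrow> 'a" and W :: "'n \<Rightarrow> 'b::complex_hilbert_space \<Rightarrow> 'b"
    and i0 k U k' U' +
  assumes Ann_eq: "Ann V = Ann W" and cyclicity_eq: "virtual_cyclicity V = virtual_cyclicity W"
begin

sublocale shift_pair k U "V i0" k' U' "W i0" ..

text \<open>The two polynomial modules contain free \<open>\<complex>[x] / Ann\<close>-modules of the same rank, and matching
  their bases gives an intertwiner after clearing denominators.\<close>

lemma exists_injective_intertwiner:
  "\<exists>M. (\<forall>c. (\<forall>a<k. (\<Sum>b<k'. c b * M a b) = 0) \<longrightarrow> (\<forall>b<k'. c b = 0)) \<and>
    (\<forall>j w. mat_op M (W j w) = V j (mat_op M w))"
proof -
  obtain B0 g0 P0 where B0: "H.indep B0" "\<forall>a<k. g0 a \<noteq> 0 \<and> op_poly (g0 a) (V i0) (H.e a) = (\<Sum>b\<in>B0. poly_op (P0 a b) V (H.e b))"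
    using H.exists_basis by blast
  obtain B g P where B: "K.indep B" "\<forall>a<k'. g a \<noteq> 0 \<and> op_poly (g a) (W i0) (K.e a) = (\<Sum>b\<in>B. poly_op (P a b) W (K.e b))"
    using K.exists_basis by blast
  have "card B0 = virtual_cyclicity V" using H.virtual_cyclicity_eq[of B0 g0 P0] B0 by simp
  moreover have "card B = virtual_cyclicity W" using K.virtual_cyclicity_eq[of B g P] B by simp
  ultimately have "card B = card B0" using cyclicity_eq by simp
  have fin: "finite B" "finite B0" and sub: "B0 \<subseteq> {..<k}"
    using B(1) B0(1) by (auto simp: K.indep_def H.indep_def intro: finite_subset)
  then obtain \<phi> where \<phi>: "bij_betw \<phi> B B0" using \<open>card B = card B0\<close> finite_same_card_bij by blast
  \<comment> \<open>On either side a combination of basis vectors is 0 exactly if all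
    \<open>R c\<close> lie in the common annihilator. So matching the bases by \<open>\<phi>\<close>
    gives a well-defined injective C[x]-linear map.\<close>
  have transfer: "(\<Sum>c\<in>B. poly_op (R c) W (K.e c)) = 0 \<longleftrightarrow> (\<Sum>c\<in>B. poly_op (R c) V (H.e (\<phi> c))) = 0" for R
  proof
    assume "(\<Sum>c\<in>B. poly_op (R c) W (K.e c)) = 0"
    then have "R c \<in> Ann V" if "c \<in> B" for c using K.indepD[OF B(1)] that by (simp add: Ann_eq)
    then show "(\<Sum>c\<in>B. poly_op (R c) V (H.e (\<phi> c))) = 0" by (simp add: H.in_Ann_iff)
  next
    assume z: "(\<Sum>c\<in>B. poly_op (R c) V (H.e (\<phi> c))) = 0"
    have "(\<Sum>c\<in>B0. poly_op (R (inv_into B \<phi> c)) V (H.e c)) =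
        (\<Sum>c\<in>B. poly_op (R (inv_into B \<phi> (\<phi> c))) V (H.e (\<phi> c)))"
      by (rule sum.reindex_bij_betw[OF \<phi>, symmetric])
    also have "\<dots> = (\<Sum>c\<in>B. poly_op (R c) V (H.e (\<phi> c)))"
      using \<phi> by (intro sum.cong refl) (simp add: bij_betw_inv_into_left)
    finally have "(\<Sum>c\<in>B0. poly_op (R (inv_into B \<phi> c)) V (H.e c)) = 0" using z by simp
    then have "R (inv_into B \<phi> c) \<in> Ann V" if "c \<in> B0" for c
      using H.indepD[OF B0(1), of "\<lambda>c. R (inv_into B \<phi> c)"] that by blast
    moreover have "\<phi> c \<in> B0" "inv_into B \<phi> (\<phi> c) = c" if "c \<in> B" for c
      using that \<phi> by (auto simp: bij_betw_inv_into_left bij_betwE)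
    ultimately have "R c \<in> Ann W" if "c \<in> B" for c using that Ann_eq by metis
    then show "(\<Sum>c\<in>B. poly_op (R c) W (K.e c)) = 0" by (simp add: K.in_Ann_iff)
  qed
  define G where "G = (\<Prod>b<k'. g b)"
  have G0: "G \<noteq> 0" using B(2) by (simp add: G_def)
  \<comment> \<open>\<open>Q b c\<close> are the basis coordinates of
    \<open>op_poly G (W i0) (K.e b)\<close>, with \<open>G\<close> the common denominator. Below,
    \<open>x b\<close> is the image of this vector under the matching of bases, and \<open>d\<close>
    makes it polynomial: the result is column \<open>b\<close> of \<open>M\<close>.\<close>
  define Q where "Q b c = embed_poly i0 (\<Prod>b'\<in>{..<k'}-{b}. g b') * P b c" for b c
  have QW: "(\<Sum>c\<in>B. poly_op (Q b c) W (K.e c)) = op_poly G (W i0) (K.e b)" if "b < k'" for b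
  proof -
    have "op_poly G (W i0) (K.e b) = op_poly (\<Prod>b'\<in>{..<k'}-{b}. g b') (W i0) (\<Sum>c\<in>B. poly_op (P b c) W (K.e c))"
      unfolding G_def using that B(2) by (simp add: op_poly_prod_mem[OF K.lin, of "{..<k'}" b])
    then show ?thesis
      by (simp add: Q_def K.poly_op_mult K.poly_op_embed_poly clinear_sum[OF clinear_op_poly[OF K.lin]])
  qed
  define x where "x b = (\<Sum>c\<in>B. poly_op (Q b c) V (H.e (\<phi> c)))" for b
  have "x b \<in> H.rational" if "b \<in> {..<k'}" for b
    unfolding x_def using \<phi> sub
    by (intro complex_vector.subspace_sum[OF H.csubspace_rational] H.poly_op_rational H.e_rational)
      (auto simp: bij_betw_def)
  from H.common_denominator[of "{..<k'}" x, OF finite_lessThan this]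
  obtain d v where d: "d \<noteq> 0" and v: "\<And>b. b < k' \<Longrightarrow> op_poly d (V i0) (x b) = H.vec (v b)" by auto
  define M where "M a b = v b a" for a b
  have comb: "(\<Sum>b<k'. op_poly (c b) (W i0) (op_poly G (W i0) (K.e b))) =
        (\<Sum>c'\<in>B. poly_op (\<Sum>b<k'. embed_poly i0 (c b) * Q b c') W (K.e c'))"
    and combV: "(\<Sum>b<k'. op_poly (c b) (V i0) (x b)) =
        (\<Sum>c'\<in>B. poly_op (\<Sum>b<k'. embed_poly i0 (c b) * Q b c') V (H.e (\<phi> c')))" for c
  proof -
    have "(\<Sum>b<k'. op_poly (c b) (W i0) (op_poly G (W i0) (K.e b))) =
        (\<Sum>b<k'. \<Sum>c'\<in>B. poly_op (embed_poly i0 (c b) * Q b c') W (K.e c'))"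
      by (intro sum.cong refl)
        (simp add: QW[symmetric] clinear_sum[OF clinear_op_poly[OF K.lin]] K.poly_op_mult K.poly_op_embed_poly)
    also have "\<dots> = (\<Sum>c'\<in>B. \<Sum>b<k'. poly_op (embed_poly i0 (c b) * Q b c') W (K.e c'))" by (rule sum.swap)
    finally show "(\<Sum>b<k'. op_poly (c b) (W i0) (op_poly G (W i0) (K.e b))) =
        (\<Sum>c'\<in>B. poly_op (\<Sum>b<k'. embed_poly i0 (c b) * Q b c') W (K.e c'))"
      by (simp add: K.poly_op_sum)
    have "(\<Sum>b<k'. op_poly (c b) (V i0) (x b)) =
        (\<Sum>b<k'. \<Sum>c'\<in>B. poly_op (embed_poly i0 (c b) * Q b c') V (H.e (\<phi> c')))"
      by (intro sum.cong refl)
        (simp add: x_def clinear_sum[OF clinear_op_poly[OF H.lin]] H.poly_op_mult H.poly_op_embed_poly)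
    also have "\<dots> = (\<Sum>c'\<in>B. \<Sum>b<k'. poly_op (embed_poly i0 (c b) * Q b c') V (H.e (\<phi> c')))" by (rule sum.swap)
    finally show "(\<Sum>b<k'. op_poly (c b) (V i0) (x b)) =
        (\<Sum>c'\<in>B. poly_op (\<Sum>b<k'. embed_poly i0 (c b) * Q b c') V (H.e (\<phi> c')))"
      by (simp add: H.poly_op_sum)
  qed
  have vecM: "H.vec (\<lambda>a. \<Sum>b<k'. M a b * c b) = op_poly d (V i0) (\<Sum>b<k'. op_poly (c b) (V i0) (x b))" for c
  proof -
    have "op_poly d (V i0) (op_poly (c b) (V i0) (x b)) = op_poly (c b) (V i0) (op_poly d (V i0) (x b))" for b
      by (simp add: op_poly_mult[OF H.lin, symmetric] mult.commute)
    then have "op_poly d (V i0) (\<Sum>b<k'. op_poly (c b) (V i0) (x b)) = (\<Sum>b<k'. H.vec (\<lambda>a. c b * v b a))"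
      by (simp add: clinear_sum[OF clinear_op_poly[OF H.lin]] v H.op_poly_vec)
    then show ?thesis by (simp add: H.vec_sum M_def mult.commute)
  qed
  have indep: "\<forall>b<k'. c b = 0" if c: "\<forall>a<k. (\<Sum>b<k'. c b * M a b) = 0" for c
  proof -
    have "H.vec (\<lambda>a. \<Sum>b<k'. M a b * c b) = H.vec (\<lambda>a. 0)"
      using c by (intro H.U_eqI) (simp add: H.U_vec mult.commute)
    then have "op_poly d (V i0) (\<Sum>b<k'. op_poly (c b) (V i0) (x b)) = 0" by (simp add: vecM H.vec_zero)
    then have "(\<Sum>b<k'. op_poly (c b) (V i0) (x b)) = 0" by (rule H.op_poly_eq_0[OF d])
    then have "(\<Sum>b<k'. op_poly (c b) (W i0) (op_poly G (W i0) (K.e b))) = 0"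
      unfolding combV comb transfer .
    then have "op_poly G (W i0) (K.vec c) = 0"
      by (simp add: K.vec_def clinear_sum[OF clinear_op_poly[OF K.lin]] op_poly_mult[OF K.lin, symmetric] mult.commute)
    then have "K.vec c = K.vec (\<lambda>_. 0)" using K.op_poly_eq_0[OF G0] by (simp add: K.vec_zero)
    then show ?thesis using K.vec_inject by blast
  qed
  have "mat_op M (W j w) = V j (mat_op M w)" for j w
  proof (rule K.bounded_clinear_eqI[of "\<lambda>w. mat_op M (W j w)" "\<lambda>w. V j (mat_op M w)" "V i0"])
    show "bounded_clinear (\<lambda>w. mat_op M (W j w))"
      by (rule bounded_clinear_compose[OF bounded_mat_op K.bounded_V])
    show "bounded_clinear (\<lambda>w. V j (mat_op M w))"
      by (rule bounded_clinear_compose[OF H.bounded_V bounded_mat_op])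
    show "mat_op M (W j (W i0 w)) = V i0 (mat_op M (W j w))" for w
      by (simp add: K.commute'[of j i0] mat_op_T)
    show "V j (mat_op M (W i0 w)) = V i0 (V j (mat_op M w))" for w
      by (simp add: mat_op_T H.commute'[of j i0])
    fix b assume b: "b < k'"
    obtain f F where f: "f \<noteq> 0" "op_poly f (W i0) (W j (K.e b)) = K.vec F"
      using K.V_rational[OF K.e_rational[OF b]] unfolding K.rational_def by blast
    \<comment> \<open>The expression of \<open>W j (K.e b)\<close> by \<open>f\<close> and
      \<open>F\<close> becomes a relation among the basis vectors for \<open>W\<close>; transferred
      to \<open>V\<close>, it says that the \<open>x c\<close> satisfy the same relation.\<close>
    have "(\<Sum>c'\<in>B. poly_op ((\<Sum>c<k'. embed_poly i0 (F c) * Q c c') - embed_poly i0 f * cvar j * Q b c') W (K.e c')) =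
        (\<Sum>c<k'. op_poly (F c) (W i0) (op_poly G (W i0) (K.e c))) - op_poly f (W i0) (W j (op_poly G (W i0) (K.e b)))"
      by (simp add: K.poly_op_diff sum_subtractf comb QW[OF b, symmetric] K.poly_op_mult K.poly_op_embed_poly
          K.poly_op_cvar clinear_sum[OF clinear_op_poly[OF K.lin]] clinear_sum[OF K.lin])
    also have "\<dots> = op_poly G (W i0) (K.vec F) - op_poly G (W i0) (op_poly f (W i0) (W j (K.e b)))"
      by (simp add: K.vec_def clinear_sum[OF clinear_op_poly[OF K.lin]] op_poly_mult[OF K.lin, symmetric] mult.commute
          K.op_poly_V[symmetric])
    also have "\<dots> = 0" by (simp add: f(2))
    finally have "(\<Sum>c'\<in>B. poly_op ((\<Sum>c<k'. embed_poly i0 (F c) * Q c c') - embed_poly i0 f * cvar j * Q b c') V (H.e (\<phi> c'))) = 0"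
      unfolding transfer .
    moreover have "op_poly f (V i0) (V j (x b)) =
        (\<Sum>c'\<in>B. poly_op (embed_poly i0 f * cvar j * Q b c') V (H.e (\<phi> c')))"
      by (simp add: x_def H.poly_op_mult H.poly_op_embed_poly
          H.poly_op_cvar clinear_sum[OF clinear_op_poly[OF H.lin]] clinear_sum[OF H.lin])
    ultimately have eq: "(\<Sum>c<k'. op_poly (F c) (V i0) (x c)) = op_poly f (V i0) (V j (x b))"
      by (simp add: H.poly_op_diff sum_subtractf combV)
    have "op_poly f (V i0) (mat_op M (W j (K.e b))) = mat_op M (K.vec F)"
      by (simp add: mat_op_op_poly[symmetric] f(2))
    also have "\<dots> = op_poly d (V i0) (op_poly f (V i0) (V j (x b)))" by (simp add: mat_op_vec vecM eq)
    also have "\<dots> = op_poly f (V i0) (V j (op_poly d (V i0) (x b)))"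
      by (simp add: H.op_poly_V[symmetric] op_poly_mult[OF H.lin, symmetric] mult.commute)
    also have "op_poly d (V i0) (x b) = mat_op M (K.e b)" by (simp add: v[OF b] mat_op_e[OF b] M_def)
    finally show "mat_op M (W j (K.e b)) = V j (mat_op M (K.e b))" by (rule H.op_poly_inject[OF f(1)])
  qed
  then show ?thesis using indep by blast
qed

text \<open>The \<open>k'\<close> columns of \<open>M\<close> are linearly independent in C[z]^k.
  Exchanging the tuples gives the opposite inequality.\<close>

lemma multiplicity_le: "k' \<le> k"
proof (rule ccontr)
  assume "\<not> k' \<le> k"
  then have "k < card {..<k'}" by simp
  obtain M where M: "(\<forall>c. (\<forall>a<k. (\<Sum>b<k'. c b * M a b) = 0) \<longrightarrow> (\<forall>b<k'. c b = 0)) \<and>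
      (\<forall>j w. mat_op M (W j w) = V j (mat_op M w))"
    using exists_injective_intertwiner by (rule exE)
  from exists_linear_relation[OF finite_lessThan \<open>k < card {..<k'}\<close>, of "\<lambda>b a. M a b"]
  obtain c where "\<exists>b\<in>{..<k'}. c b \<noteq> 0" "\<forall>a<k. (\<Sum>b<k'. c b * M a b) = 0" by (elim exE conjE)
  then show False using conjunct1[OF M, THEN spec, of c] by blast
qed

end

text \<open>One \<open>q\<close> has to serve both tuples: \<open>adjoint_intertwines\<close>
  requires both matrices to be the same multiple of unitary ones. A product of two suitable
  polynomials works for each tuple.\<close>

lemma common_range_poly:
  assumes "shift_tuple V i0 k U" "shift_tuple W i0 k' U'"
  shows "\<exists>q. (\<forall>z. cmod z = 1 \<longrightarrow> poly q z \<noteq> 0) \<and> (\<forall>x. op_poly q (V i0) x \<in> range (V j)) \<and>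
    (\<forall>x. op_poly q (W i0) x \<in> range (W j))"
proof -
  interpret H: shift_tuple V i0 k U by fact
  interpret K: shift_tuple W i0 k' U' by fact
  obtain p where p: "\<And>z. cmod z \<ge> 1 \<Longrightarrow> poly p z \<noteq> 0" "\<And>x. op_poly p (V i0) x \<in> range (V j)"
    using H.exists_poly_into_range by blast
  obtain r where r: "\<And>z. cmod z \<ge> 1 \<Longrightarrow> poly r z \<noteq> 0" "\<And>x. op_poly r (W i0) x \<in> range (W j)"
    using K.exists_poly_into_range by blast
  have "op_poly (r * p) (W i0) x \<in> range (W j)" for x by (simp add: op_poly_mult[OF K.lin] r(2))
  moreover have "op_poly (p * r) (V i0) x \<in> range (V j)" for x by (simp add: op_poly_mult[OF H.lin] p(2))
  ultimately show ?thesis using p(1) r(1) by (intro exI[of _ "p * r"]) (simp add: mult.commute)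
qed

text \<open>Equal multiplicities make the intertwining matrix square, so the zeros of its
  determinant can be removed from the circle. The adjugate then yields both the lower bound for
  \<open>S\<close> and the finite codimension of its range.\<close>

lemma virt_sim_le_of_square:
  assumes "prime_pair V W i0 k U k U'"
  shows "virt_sim_le W V"
proof -
  interpret prime_pair V W i0 k U k U' by fact
  interpret R: shift_pair k U' "W i0" k U "V i0" ..
  obtain M where M0: "(\<forall>c. (\<forall>a<k. (\<Sum>b<k. c b * M a b) = 0) \<longrightarrow> (\<forall>b<k. c b = 0)) \<and>
      (\<forall>j w. mat_op M (W j w) = V j (mat_op M w))"
    using exists_injective_intertwiner by (rule exE)
  then have ind: "\<And>c. (\<forall>a<k. (\<Sum>b<k. c b * M a b) = 0) \<Longrightarrow> (\<forall>b<k. c b = 0)"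
    and M: "\<And>j w. mat_op M (W j w) = V j (mat_op M w)"
    by simp_all
  have "\<forall>j. \<exists>q. (\<forall>z. cmod z = 1 \<longrightarrow> poly q z \<noteq> 0) \<and> (\<forall>x. op_poly q (V i0) x \<in> range (V j)) \<and>
    (\<forall>x. op_poly q (W i0) x \<in> range (W j))"
    using common_range_poly[OF H.shift_tuple_axioms K.shift_tuple_axioms] by blast
  from choice[OF this] obtain q where "\<forall>j. (\<forall>z. cmod z = 1 \<longrightarrow> poly (q j) z \<noteq> 0) \<and>
    (\<forall>x. op_poly (q j) (V i0) x \<in> range (V j)) \<and> (\<forall>x. op_poly (q j) (W i0) x \<in> range (W j))" by (rule exE)
  then have q: "\<And>j z. cmod z = 1 \<Longrightarrow> poly (q j) z \<noteq> 0"
    and qV: "\<And>j x. op_poly (q j) (V i0) x \<in> range (V j)"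
    and qW: "\<And>j x. op_poly (q j) (W i0) x \<in> range (W j)" by simp_all
  have q_nz: "q j \<noteq> 0" for j using q[of 1 j] by auto
  define G where "G j = H.quot_mat (q j) j" for j
  define G' where "G' j = K.quot_mat (q j) j" for j
  have G: "G j \<in> carrier_mat k k" "G' j \<in> carrier_mat k k" for j
    using H.quot_mat_carrier K.quot_mat_carrier by (simp_all add: G_def G'_def)
  define Z where "Z = mat k k (\<lambda>(a, b). M a b)"
  have Z: "Z \<in> carrier_mat k k" by (simp add: Z_def)
  have ZG: "Z * G' j = G j * Z" for j
  proof (rule eq_matI)
    fix a b assume "a < dim_row (G j * Z)" "b < dim_col (G j * Z)"
    then have ab: "a < k" "b < k" using G[of j] Z by auto
    have "mat_op M (K.quot_op (q j) j w) = H.quot_op (q j) j (mat_op M w)" for w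
    proof (rule H.V_inject[of j])
      have "V j (mat_op M (K.quot_op (q j) j w)) = mat_op M (op_poly (q j) (W i0) w)"
        by (simp only: M[symmetric] K.V_quot_op[OF qW])
      then show "V j (mat_op M (K.quot_op (q j) j w)) = V j (H.quot_op (q j) j (mat_op M w))"
        by (simp only: mat_op_op_poly H.V_quot_op[OF qV])
    qed
    from this[of "K.e b"] have "H.vec (\<lambda>a. \<Sum>c<k. M a c * G' j $$ (c, b)) = H.vec (\<lambda>a. \<Sum>c<k. G j $$ (a, c) * M c b)"
      using ab by (simp add: K.quot_op_e[OF qW] H.quot_op_vec[OF qV] mat_op_e mat_op_vec G_def G'_def)
    from H.vec_inject[OF this ab(1)] show "(Z * G' j) $$ (a, b) = (G j * Z) $$ (a, b)"
      unfolding index_mult_mat_sum[OF Z G(2) ab] index_mult_mat_sum[OF G(1) Z ab]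
      using ab by (simp add: Z_def)
  qed (use G[of j] Z in auto)
  have dZ: "det Z \<noteq> 0"
  proof
    assume "det Z = 0"
    then obtain c where c: "c \<in> carrier_vec k" "c \<noteq> 0\<^sub>v k" "Z *\<^sub>v c = 0\<^sub>v k"
      using det_0_iff_vec_prod_zero[OF Z] by blast
    have "(\<Sum>b<k. vec_index c b * M a b) = 0" if "a < k" for a
    proof -
      have "vec_index (Z *\<^sub>v c) a = (\<Sum>b<k. vec_index c b * M a b)"
        using that c(1) by (simp add: Z_def scalar_prod_def atLeast0LessThan mult.commute)
      then show ?thesis using that c(3) by simp
    qed
    then have "\<forall>b<k. vec_index c b = 0" using ind[of "vec_index c"] by simp
    then have "c = 0\<^sub>v k" using c(1) by (intro eq_vecI) auto
    with c(2) show False by simp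
  qed
  have "\<exists>Y\<in>carrier_mat k k. (\<forall>j. Y * G' j = G j * Y) \<and> det Y \<noteq> 0 \<and> (\<forall>z. cmod z = 1 \<longrightarrow> poly (det Y) z \<noteq> 0)"
    by (rule intertwiner_invertible_on_circle[where q = q, OF G q _ _ Z ZG dZ])
      (simp_all add: G_def G'_def H.quot_mat_unitary[OF qV] K.quot_mat_unitary[OF qW])
  then obtain Y where Y: "Y \<in> carrier_mat k k" "\<And>j. Y * G' j = G j * Y" "det Y \<noteq> 0"
    "\<And>z. cmod z = 1 \<Longrightarrow> poly (det Y) z \<noteq> 0" by blast
  define S where "S = mat_op (\<lambda>a b. Y $$ (a, b))"
  have S: "bounded_clinear S" "clinear S" by (simp_all add: S_def bounded_mat_op clinear_mat_op)
  have S_T: "S (W i0 w) = V i0 (S w)" for w by (simp add: S_def mat_op_T)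
  have S_op: "S (op_poly c (W i0) w) = op_poly c (V i0) (S w)" for c w by (simp add: S_def mat_op_op_poly)
  have S_quot: "S (K.quot_op (q j) j w) = H.quot_op (q j) j (S w)" for j w
  proof (rule K.bounded_clinear_eqI[of "\<lambda>w. S (K.quot_op (q j) j w)" "\<lambda>w. H.quot_op (q j) j (S w)" "V i0"])
    show "bounded_clinear (\<lambda>w. S (K.quot_op (q j) j w))"
      by (rule bounded_clinear_compose[OF S(1) K.bounded_quot_op[OF qW]])
    show "bounded_clinear (\<lambda>w. H.quot_op (q j) j (S w))"
      by (rule bounded_clinear_compose[OF H.bounded_quot_op[OF qV] S(1)])
    show "S (K.quot_op (q j) j (W i0 w)) = V i0 (S (K.quot_op (q j) j w))" for w
      by (simp add: K.quot_op_T[OF qW] S_T)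
    show "H.quot_op (q j) j (S (W i0 w)) = V i0 (H.quot_op (q j) j (S w))" for w
      by (simp add: H.quot_op_T[OF qV] S_T)
    fix b assume b: "b < k"
    have "S (K.quot_op (q j) j (K.e b)) = H.vec (\<lambda>a. (Y * G' j) $$ (a, b))"
      unfolding K.quot_op_e[OF qW b] S_def mat_op_vec G'_def[symmetric]
      by (rule H.U_eqI) (use b in \<open>simp add: H.U_vec index_mult_mat_sum[OF Y(1) G(2)] del: index_mult_mat\<close>)
    also have "\<dots> = H.quot_op (q j) j (S (K.e b))"
      unfolding Y(2) S_def mat_op_e[OF b] H.quot_op_vec[OF qV] G_def[symmetric]
      by (rule H.U_eqI) (use b in \<open>simp add: H.U_vec index_mult_mat_sum[OF G(1) Y(1)] del: index_mult_mat\<close>)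
    finally show "S (K.quot_op (q j) j (K.e b)) = H.quot_op (q j) j (S (K.e b))" .
  qed
  \<comment> \<open>Inserting \<open>W j w\<close> into \<open>S_quot\<close> gives the equation
    after an application of \<open>op_poly (q j) (V i0)\<close>, which is injective.\<close>
  have SW: "S (W j w) = V j (S w)" for j w
  proof (rule H.op_poly_inject[OF q_nz[of j]])
    have "op_poly (q j) (V i0) (S (W j w)) = V j (S (K.quot_op (q j) j (W j w)))"
      by (simp only: S_quot H.V_quot_op[OF qV])
    then show "op_poly (q j) (V i0) (S (W j w)) = op_poly (q j) (V i0) (V j (S w))"
      by (simp only: K.quot_op_V[OF qW] S_op H.op_poly_V)
  qed
  define A where "A = adj_mat Y"
  have A: "A \<in> carrier_mat k k" "Y * A = det Y \<cdot>\<^sub>m 1\<^sub>m k" "A * Y = det Y \<cdot>\<^sub>m 1\<^sub>m k"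
    using adj_mat[OF Y(1)] by (auto simp: A_def)
  \<comment> \<open>The operator of the adjugate inverts \<open>S\<close> up to the polynomial
    \<open>det Y\<close>. The product \<open>S' (S w)\<close> gives the lower bound, and
    \<open>S (S' (H.e a))\<close> gives vectors in the range that force finite codimension.\<close>
  define S' where "S' = R.mat_op (\<lambda>a b. A $$ (a, b))"
  have S': "bounded_clinear S'" by (simp add: S'_def R.bounded_mat_op)
  have S'S: "S' (S w) = op_poly (det Y) (W i0) w" for w
  proof (rule K.bounded_clinear_eqI[of "\<lambda>w. S' (S w)" "op_poly (det Y) (W i0)" "W i0"])
    fix b assume b: "b < k"
    have "S' (S (K.e b)) = K.vec (\<lambda>a. (A * Y) $$ (a, b))"
      unfolding S_def S'_def mat_op_e[OF b] R.mat_op_vec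
      by (rule K.U_eqI) (use b in \<open>simp add: K.U_vec index_mult_mat_sum[OF A(1) Y(1)] del: index_mult_mat\<close>)
    also have "\<dots> = op_poly (det Y) (W i0) (K.e b)"
      unfolding A(3) by (rule K.U_eqI) (use b in \<open>auto simp: K.U_vec K.U_op_poly_e\<close>)
    finally show "S' (S (K.e b)) = op_poly (det Y) (W i0) (K.e b)" .
  qed (auto simp: S'_def R.mat_op_T S_T K.op_poly_V intro: bounded_clinear_compose R.bounded_mat_op S(1) bounded_clinear_op_poly K.bounded_V)
  have SS': "S (S' (H.e a)) = op_poly (det Y) (V i0) (H.e a)" if a: "a < k" for a
  proof -
    have "S (S' (H.e a)) = H.vec (\<lambda>b. (Y * A) $$ (b, a))"
      unfolding S_def S'_def R.mat_op_e[OF a] mat_op_vec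
      by (rule H.U_eqI) (use a in \<open>simp add: H.U_vec index_mult_mat_sum[OF Y(1) A(1)] del: index_mult_mat\<close>)
    also have "\<dots> = op_poly (det Y) (V i0) (H.e a)"
      unfolding A(2) by (rule H.U_eqI) (use a in \<open>auto simp: H.U_vec H.U_op_poly_e\<close>)
    finally show ?thesis .
  qed
  obtain c where c: "c > 0" "\<And>w. c * norm w \<le> norm (op_poly (det Y) (W i0) w)"
    using K.op_poly_bounded_below[OF Y(3,4)] by blast
  obtain C where C: "\<And>x. norm (S' x) \<le> C * norm x" using S' unfolding bounded_clinear_def by blast
  \<comment> \<open>The bound \<open>C\<close> is not known to be positive; \<open>D\<close> is, and
    may be divided by.\<close>
  define D where "D = \<bar>C\<bar> + 1"
  have "D > 0" by (simp add: D_def)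
  have below: "c / D * norm w \<le> norm (S w)" for w
  proof -
    have "c * norm w \<le> C * norm (S w)" using c(2)[of w] C[of "S w"] by (simp add: S'S)
    also have "\<dots> \<le> D * norm (S w)" by (intro mult_right_mono) (auto simp: D_def)
    finally show ?thesis using \<open>D > 0\<close> by (simp add: field_simps)
  qed
  have inj: "inj S"
  proof (rule injI)
    fix x y assume "S x = S y"
    then have "S (x - y) = 0" by (simp add: clinear_diff[OF S(2)])
    then have "c / D * norm (x - y) \<le> 0" using below[of "x - y"] by simp
    then have "norm (x - y) \<le> 0" using c(1) \<open>D > 0\<close> by (simp add: mult_le_0_iff divide_le_0_iff)
    then show "x = y" by simp
  qed
  have cl: "closed (range S)"
  proof -
    have "0 < c / D" using c(1) \<open>D > 0\<close> by simp
    then have "complete (range S)"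
      by (rule complete_isometric_image[OF _ subspace_UNIV bounded_clinearD(2)[OF S(1)] _ complete_UNIV])
        (simp add: below del: times_divide_eq_left)
    then show ?thesis by (rule complete_imp_closed)
  qed
  have cs: "csubspace (range S)"
  proof (rule complex_vector.subspaceI)
    show "0 \<in> range S" by (rule range_eqI[of _ _ 0]) (simp add: clinear_0[OF S(2)])
    fix x y c assume "x \<in> range S"
    then obtain x' where x': "x = S x'" by blast
    show "c *\<^sub>C x \<in> range S" by (rule range_eqI[of _ _ "c *\<^sub>C x'"]) (simp add: x' clinear_scale[OF S(2)])
    assume "y \<in> range S"
    then obtain y' where y': "y = S y'" by blast
    show "x + y \<in> range S" by (rule range_eqI[of _ _ "x' + y'"]) (simp add: x' y' clinear_add[OF S(2)])
  qed
  have "finite_codim (range S)"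
  proof (rule H.finite_codim_of_polys[OF cs cl, of "\<lambda>_. det Y"])
    show "V i0 x \<in> range S" if "x \<in> range S" for x
      using that by (auto simp: S_T[symmetric])
    show "op_poly (det Y) (V i0) (H.e a) \<in> range S" if "a < k" for a
      by (simp add: SS'[OF that, symmetric])
  qed (rule Y(3))
  moreover have "V i ` range S \<subseteq> range S" for i by (auto simp: SW[symmetric])
  moreover have "norm (inv_into UNIV S y) \<le> D / c * norm y" if "y \<in> range S" for y
  proof -
    from \<open>y \<in> range S\<close> obtain w where w: "y = S w" by blast
    then have "inv_into UNIV S y = w" using inj by simp
    then show ?thesis using below[of w] c(1) \<open>D > 0\<close> by (simp add: w field_simps)
  qed
  moreover have "S \<circ> W i = V i \<circ> S" for i by (auto simp: SW)
  moreover have "bij_betw S UNIV (range S)" using inj by (simp add: inj_on_imp_bij_betw)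
  ultimately show ?thesis
    unfolding virt_sim_le_def closed_csubspace_def using cs cl S(1) by blast
qed

lemma virt_sim_le_of_invariants:
  assumes "commuting_shifts V" "commuting_shifts W" "primeideal (Ann V) ring_of_type_algebra"
    and "Ann V = Ann W" "virtual_cyclicity V = virtual_cyclicity W"
  shows "virt_sim_le W V"
proof -
  \<comment> \<open>Any coordinate may be the distinguished one.\<close>
  fix i0
  obtain k U where V: "shift_tuple V i0 k U" using commuting_shifts_model[OF assms(1)] by blast
  obtain k' U' where W: "shift_tuple W i0 k' U'" using commuting_shifts_model[OF assms(2)] by blast
  interpret H: prime_shift_tuple V i0 k U
    using V assms(3) by (intro prime_shift_tuple.intro prime_shift_tuple_axioms.intro)
  interpret K: prime_shift_tuple W i0 k' U'
    using W assms(3,4) by (intro prime_shift_tuple.intro prime_shift_tuple_axioms.intro) simp_all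
  interpret P: prime_pair V W i0 k U k' U' by unfold_locales (use assms in simp_all)
  interpret P': prime_pair W V i0 k' U' k U by unfold_locales (use assms in simp_all)
  have "k' = k" using P.multiplicity_le P'.multiplicity_le by simp
  then have "prime_pair V W i0 k U k U'" using P.prime_pair_axioms by simp
  then show ?thesis by (rule virt_sim_le_of_square)
qed

section \<open>Invariance of the annihilator and of the cyclicity under virtual similarity\<close>

lemma commuting_shifts_family:
  assumes "commuting_shifts V"
  shows "commuting_family V"
proof -
  fix i0
  obtain k U where "shift_tuple V i0 k U" using commuting_shifts_model[OF assms] by blast
  then show ?thesis by (rule shift_tuple.axioms(1))
qed

text \<open>\<open>S\<close> carries \<open>poly_op p V h\<close> to
  \<open>poly_op p W (S h) = 0\<close>, and \<open>S\<close> is injective.\<close>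

lemma virt_sim_le_Ann:
  assumes "commuting_family V" "commuting_family W" "virt_sim_le V W"
  shows "Ann W \<subseteq> Ann V"
proof
  fix p assume p: "p \<in> Ann W"
  obtain S N where S: "bounded_clinear S" "bij_betw S UNIV N" "\<And>i. S \<circ> V i = W i \<circ> S"
    using assms(3) unfolding virt_sim_le_def by blast
  have lin: "clinear S" by (rule bounded_clinearD(1)[OF S(1)])
  have "S (V i x) = W i (S x)" for i x using S(3)[of i] by (metis comp_apply)
  then have "S (poly_op p V h) = poly_op p W (S h)" for h
    by (rule commuting_family.poly_op_intertwine[OF assms(1,2) lin])
  then have "S (poly_op p V h) = S 0" for h using p by (simp add: Ann_def clinear_0[OF lin])
  then have "poly_op p V h = 0" for h using S(2) by (metis bij_betw_def injD)
  then show "p \<in> Ann V" by (simp add: Ann_def)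
qed

text \<open>The vectors \<open>S (h i)\<close> serve as generators. \<open>S\<close> maps the closed
  module of the \<open>h i\<close> into theirs; the image of the finite set \<open>F\<close> then
  accounts for the rest of \<open>range S\<close>, and \<open>F'\<close> for what
  \<open>range S\<close> misses.\<close>

lemma virt_sim_le_generators:
  assumes V: "commuting_family V" and W: "commuting_family W" and "virt_sim_le V W"
    and fc: "finite_codim (closure (cspan {poly_op p V (h i) | p i. i < (s::nat)}))"
  shows "\<exists>h. finite_codim (closure (cspan {poly_op p W (h i) | p i. i < s}))"
proof -
  obtain S N where S: "bounded_clinear S" "bij_betw S UNIV N" "\<And>i. S \<circ> V i = W i \<circ> S" and N: "finite_codim N"
    using assms(3) unfolding virt_sim_le_def by blast
  have lin: "clinear S" by (rule bounded_clinearD(1)[OF S(1)])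
  have SV: "S (V i x) = W i (S x)" for i x using S(3)[of i] by (metis comp_apply)
  then have S_poly: "S (poly_op p V x) = poly_op p W (S x)" for p x
    by (rule commuting_family.poly_op_intertwine[OF V W lin])
  obtain F where F: "finite F" "cspan (closure (cspan {poly_op p V (h i) | p i. i < s}) \<union> F) = UNIV"
    using fc unfolding finite_codim_def by blast
  obtain F' where F': "finite F'" "cspan (N \<union> F') = UNIV" using N unfolding finite_codim_def by blast
  define C where "C = closure (cspan {poly_op p W ((\<lambda>i. S (h i)) i) | p i. i < s})"
  have C: "csubspace C" unfolding C_def by (rule closure_csubspace) (rule complex_vector.subspace_span)
  have pre: "csubspace {x. S x \<in> E}" if E: "csubspace E" for E
    by (rule complex_vector.subspaceI)
      (auto simp: clinear_0[OF lin] clinear_add[OF lin] clinear_scale[OF lin]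
        intro: complex_vector.subspace_0[OF E] complex_vector.subspace_add[OF E] complex_vector.subspace_scale[OF E])
  have "{poly_op p V (h i) | p i. i < s} \<subseteq> {x. S x \<in> C}"
  proof
    fix x assume "x \<in> {poly_op p V (h i) | p i. i < s}"
    then obtain p i where x: "x = poly_op p V (h i)" "i < s" by (elim CollectE exE conjE)
    have "S x = poly_op p W (S (h i))" unfolding x(1) by (rule S_poly)
    also have "\<dots> \<in> C" unfolding C_def
      by (rule subsetD[OF closure_subset], rule complex_vector.span_base, rule CollectI,
          rule exI[of _ p], rule exI[of _ i]) (simp add: x(2))
    finally show "x \<in> {x. S x \<in> C}" by simp
  qed
  then have "cspan {poly_op p V (h i) | p i. i < s} \<subseteq> {x. S x \<in> C}"
    using pre[OF C] by (rule complex_vector.span_minimal)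
  moreover have "closed {x. S x \<in> C}"
    using closed_vimage[OF _ bounded_clinear_continuous[OF S(1)], of C] by (simp add: C_def vimage_def)
  ultimately have "closure (cspan {poly_op p V (h i) | p i. i < s}) \<subseteq> {x. S x \<in> C}"
    by (rule closure_minimal)
  moreover have "C \<subseteq> cspan (C \<union> (S ` F \<union> F'))" by (auto intro: complex_vector.span_base)
  moreover have "S ` F \<union> F' \<subseteq> cspan (C \<union> (S ` F \<union> F'))" by (auto intro: complex_vector.span_base)
  ultimately have sub: "closure (cspan {poly_op p V (h i) | p i. i < s}) \<union> F \<subseteq> {x. S x \<in> cspan (C \<union> (S ` F \<union> F'))}"
    and F'_sub: "F' \<subseteq> cspan (C \<union> (S ` F \<union> F'))" by auto
  have "cspan (closure (cspan {poly_op p V (h i) | p i. i < s}) \<union> F) \<subseteq> {x. S x \<in> cspan (C \<union> (S ` F \<union> F'))}"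
    by (rule complex_vector.span_minimal[OF sub pre]) (rule complex_vector.subspace_span)
  then have "range S \<subseteq> cspan (C \<union> (S ` F \<union> F'))" unfolding F(2) by auto
  then have "N \<union> F' \<subseteq> cspan (C \<union> (S ` F \<union> F'))" using S(2) F'_sub by (simp add: bij_betw_def)
  then have "cspan (N \<union> F') \<subseteq> cspan (C \<union> (S ` F \<union> F'))"
    by (rule complex_vector.span_minimal) (rule complex_vector.subspace_span)
  then have "cspan (C \<union> (S ` F \<union> F')) = UNIV" unfolding F'(2) by auto
  moreover have "finite (S ` F \<union> F')" using F(1) F'(1) by simp
  ultimately have "finite_codim C" unfolding finite_codim_def by (intro exI[of _ "S ` F \<union> F'"] conjI)
  then show ?thesis unfolding C_def by (rule exI[of _ "\<lambda>i. S (h i)"])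
qed

theorem theorem4p10:
  fixes V :: "'n::finite \<Rightarrow> 'a::separable_hilbert_space \<Rightarrow> 'a"
    and W :: "'n \<Rightarrow> 'b::separable_hilbert_space \<Rightarrow> 'b"
  assumes "CARD('n) \<ge> 2"
    and "commuting_shifts V"
    and "commuting_shifts W"
    and "primeideal (Ann V) ring_of_type_algebra"
  shows "virtually_similar V W \<longleftrightarrow>
    Ann V = Ann W \<and> virtual_cyclicity V = virtual_cyclicity W"
proof
  note fam = commuting_shifts_family[OF assms(2)] commuting_shifts_family[OF assms(3)]
  assume "virtually_similar V W"
  then have le: "virt_sim_le V W" "virt_sim_le W V" by (auto simp: virtually_similar_def)
  have "Ann V = Ann W"
    using virt_sim_le_Ann[OF fam le(1)] virt_sim_le_Ann[OF fam(2,1) le(2)] by blast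
  \<comment> \<open>The two cyclicities are least elements of the same set of numbers
    \<open>s\<close>.\<close>
  moreover have "(\<exists>h. finite_codim (closure (cspan {poly_op p V (h i) | p i. i < s}))) \<longleftrightarrow>
      (\<exists>h. finite_codim (closure (cspan {poly_op p W (h i) | p i. i < s})))" for s :: nat
    by (intro iffI; elim exE)
      (rule virt_sim_le_generators[OF fam le(1)] virt_sim_le_generators[OF fam(2,1) le(2)]; assumption)+
  ultimately show "Ann V = Ann W \<and> virtual_cyclicity V = virtual_cyclicity W"
    by (simp add: virtual_cyclicity_def)
next
  assume "Ann V = Ann W \<and> virtual_cyclicity V = virtual_cyclicity W"
  then have eq: "Ann V = Ann W" "virtual_cyclicity V = virtual_cyclicity W" by auto
  have "virt_sim_le W V" by (rule virt_sim_le_of_invariants[OF assms(2-4) eq])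
  moreover have "virt_sim_le V W"
    using virt_sim_le_of_invariants[OF assms(3,2) _ eq[symmetric]] assms(4) eq(1) by simp
  ultimately show "virtually_similar V W" by (simp add: virtually_similar_def)
qed

end
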